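(* For all natural numbers $m\le n$, the ultrahomogeneous structure $\mathbb{U}(n,m)$ is rainbow Ramsey and delta rainbow Ramsey. If moreover $m+2(n-m)\ge 2$, then the structures $\mathbb{T}(n,m)$ and $\mathbb{D}(n,m)$ are also rainbow Ramsey and delta rainbow Ramsey.
   Context: Rainbow notions: $\binom{\mathrm{A}}{\mathrm{C}}$ is the set of induced substructures of $\mathrm{A}$ isomorphic to $\mathrm{C}$. A $\delta$-system of copies of $\mathrm{C}$ in $\mathrm{A}$ is $\mathcal{S}\subseteq\binom{\mathrm{A}}{\mathrm{C}}$ with $X\setminus\bigcap_{Y\in\mathcal{S}}Y$ a singleton for each $X\in\mathcal{S}$. A colouring $\gamma:\binom{\mathrm{A}}{\mathrm{C}}\to\omega$ is $k$-bounded if $|\gamma^{-1}(j)|\le k$ for all $j$, and $k$-delta if it is constant on no $\delta$-system with $k+1$ elements. A countably infinite relational structure $\mathrm{R}$ is rainbow Ramsey (resp. delta rainbow Ramsey) if for every finite induced substructure $\mathrm{C}$ of $\mathrm{R}$, every $k\in\omega$ and every $k$-bounded (resp. $k$-delta) colouring $\gamma:\binom{\mathrm{R}}{\mathrm{C}}\to\omega$ there is $\mathrm{R}^*\in\binom{\mathrm{R}}{\mathrm{R}}$ such that $\gamma$ is one-to-one on $\binom{\mathrm{R}^*}{\mathrm{C}}$. $\mathbb{U}(n,m)$: for $m\le n$, consider structures with binary relations $E_0,\dots,E_{n-1}$ where each $E_i$ is irreflexive, $E_i$ is symmetric for $i<m$, $E_i(x,y)$ implies $\neg E_i(y,x)$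 for $m\le i<n$, for distinct $x,y$ and $i\ne j$ $E_i(x,y)$ implies $\neg E_j(x,y)$ and $\neg E_j(y,x)$, and every pair of distinct elements $x,y$ satisfies $E_i(x,y)$ for some $i$. $\mathbb{U}(n,m)$ is the Fraïssé limit of the class of finite such structures (e.g. $\mathbb{U}(2,2)$ is the Rado graph, $\mathbb{U}(1,0)$ the random tournament, $\mathbb{U}(1,1)$ the countable complete graph, and $\mathbb{U}(0,0)$ the countably infinite set with no relations). Trees: with $\mathfrak{d}=m+2(n-m)\ge2$, $\mathfrak{T_d}$ is the set of finite sequences with entries in $\{0,\dots,\mathfrak{d}-1\}$ ordered by end-extension $\subseteq$; $|x|$ is length, $x(i)$ the $i$-th entry, $x\wedge y$ the longest common initial segment; for incomparable $x,y$, $x\prec y$ means $x(|x\wedge y|)<y(|x\wedge y|)$. $\mathbb{T}(n,m)$ has universe $\mathfrak{T_d}$, with, for distinct $x,y$ (and no other instances): (1) if $|x|<|y|$ and $p=y(|x|)$: if $p<m$, $E_p(x,y)$ and $E_p(y,x)$; if $p\ge m$, $p-m$ even, $E_{m+(p-m)/2}(x,y)$; if $p\ge m$, $p-m$ odd, $E_{m+(p-m-1)/2}(y,x)$. (2) If $|x|=|y|$ and $x\prec y$: $E_0(x,y)$ if $m=0$; $E_0(x,y)$ and $E_0(y,x)$ if $m>0$. A set $S\subseteq\mathfrak{T_d}$ is strongly diagonal if it is a $\subseteq$-antichain, its closure $\{x\wedge y:x,y\in S\}$ is transversal (distinct elements have distinct lengths), each closure element has at most two immediate successors in the closure, and for all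 $x,y,z\in S$, $x\ne y$: (i) if $|x\wedge y|<|z|$ and $x\wedge y\not\subseteq z$ then $z(|x\wedge y|)=0$; (ii) $x(|x\wedge y|)\in\{0,1\}$. A strong diagonalization is an injection $f:\mathfrak{T_d}\to\mathfrak{T_d}$ with strongly diagonal image such that $|x\wedge y|<|z\wedge u|$ implies $|f(x)\wedge f(y)|<|f(z)\wedge f(u)|$, $|z|>|x|$ implies $z(|x|)=f(z)(|f(x)|)$, and $x\prec y$ implies $f(x)\prec f(y)$. Such maps exist; fix one with image $\mathfrak{D_d}$, and let $\mathbb{D}(n,m)$ be the substructure of $\mathbb{T}(n,m)$ induced on $\mathfrak{D_d}$.
   Formalization: For delta rainbow Ramsey, k is taken to be at least 1: for k = 0 no δ-system has exactly one element, so every colouring, even a constant one, is 0-delta and the claim fails. *)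

theory Defs
  imports Main "HOL-Library.Sublist" "HOL-Library.Countable_Set"
begin

(* Relational structures whose symbols E_0, E_1, ... are binary.  A structure in the finite
   language E_0, ..., E_(n-1) interprets E_i, i >= n, as the empty relation on its universe.
   Whether rel i x y holds for x or y outside the universe is irrelevant throughout. *)
record 'a binstr =
  univ :: "'a set"
  rel :: "nat \<Rightarrow> 'a \<Rightarrow> 'a \<Rightarrow> bool"

definition isomorphism :: "('a \<Rightarrow> 'b) \<Rightarrow> 'a binstr \<Rightarrow> 'b binstr \<Rightarrow> bool" where
  "isomorphism f A B \<longleftrightarrow> bij_betw f (univ A) (univ B) \<and>
     (\<forall>i. \<forall>x\<in>univ A. \<forall>y\<in>univ A. rel A i x y \<longleftrightarrow> rel B i (f x) (f y))"

definition isomorphic :: "'a binstr \<Rightarrow> 'b binstr \<Rightarrow> bool" where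
  "isomorphic A B \<longleftrightarrow> (\<exists>f. isomorphism f A B)"

definition induced :: "'a binstr \<Rightarrow> 'a set \<Rightarrow> 'a binstr" where
  "induced A X = \<lparr>univ = X, rel = (\<lambda>i x y. x \<in> X \<and> y \<in> X \<and> rel A i x y)\<rparr>"


section \<open>Rainbow Ramsey structures\<close>

(* An induced substructure is identified with its universe. *)
definition copies :: "'a binstr \<Rightarrow> 'b binstr \<Rightarrow> 'a set set" where
  "copies A C = {X. X \<subseteq> univ A \<and> isomorphic (induced A X) C}"

definition delta_system :: "'a binstr \<Rightarrow> 'b binstr \<Rightarrow> 'a set set \<Rightarrow> bool" where
  "delta_system A C S \<longleftrightarrow> S \<subseteq> copies A C \<and> (\<forall>X\<in>S. is_singleton (X - \<Inter>S))"

(* A colouring of the copies of C in A is a function on all sets; only its values on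
   copies A C matter. *)
definition k_bounded :: "nat \<Rightarrow> 'a binstr \<Rightarrow> 'b binstr \<Rightarrow> ('a set \<Rightarrow> nat) \<Rightarrow> bool" where
  "k_bounded k A C \<gamma> \<longleftrightarrow>
     (\<forall>j. finite {X \<in> copies A C. \<gamma> X = j} \<and> card {X \<in> copies A C. \<gamma> X = j} \<le> k)"

definition k_delta :: "nat \<Rightarrow> 'a binstr \<Rightarrow> 'b binstr \<Rightarrow> ('a set \<Rightarrow> nat) \<Rightarrow> bool" where
  "k_delta k A C \<gamma> \<longleftrightarrow>
     \<not> (\<exists>S. delta_system A C S \<and> card S = k + 1 \<and> (\<exists>j. \<forall>X\<in>S. \<gamma> X = j))"

definition rainbow_Ramsey :: "'a binstr \<Rightarrow> bool" where
  "rainbow_Ramsey R \<longleftrightarrow> countable (univ R) \<and> infinite (univ R) \<and>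
     (\<forall>F k \<gamma>. F \<subseteq> univ R \<and> finite F \<and> k_bounded k R (induced R F) \<gamma> \<longrightarrow>
        (\<exists>X \<in> copies R R. inj_on \<gamma> (copies (induced R X) (induced R F))))"

(* k = 0 is excluded: if S = {X} then X - \<Inter>S is empty, so no delta-system has exactly one
   element and every colouring, even a constant one, would count as 0-delta. *)
definition delta_rainbow_Ramsey :: "'a binstr \<Rightarrow> bool" where
  "delta_rainbow_Ramsey R \<longleftrightarrow> countable (univ R) \<and> infinite (univ R) \<and>
     (\<forall>F k \<gamma>. F \<subseteq> univ R \<and> finite F \<and> 1 \<le> k \<and> k_delta k R (induced R F) \<gamma> \<longrightarrow>
        (\<exists>X \<in> copies R R. inj_on \<gamma> (copies (induced R X) (induced R F))))"


section \<open>Fraisse limits and the structures U(n,m)\<close>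

definition ultrahomogeneous :: "'a binstr \<Rightarrow> bool" where
  "ultrahomogeneous A \<longleftrightarrow>
     (\<forall>F G f. F \<subseteq> univ A \<and> finite F \<and> G \<subseteq> univ A \<and> finite G
        \<and> isomorphism f (induced A F) (induced A G) \<longrightarrow>
        (\<exists>g. isomorphism g A A \<and> (\<forall>x\<in>F. g x = f x)))"

(* Finite structures are represented, up to isomorphism, by those with universe in nat. *)
definition age :: "'a binstr \<Rightarrow> nat binstr set" where
  "age A = {C. finite (univ C) \<and> (\<exists>X \<subseteq> univ A. isomorphic C (induced A X))}"

definition fraisse_limit :: "nat binstr set \<Rightarrow> 'a binstr \<Rightarrow> bool" where
  "fraisse_limit K A \<longleftrightarrow> countable (univ A) \<and> ultrahomogeneous A \<and> age A = K"

(* In the last clause the pair is unordered, as asymmetric relations require.  The clause is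
   dropped in the empty language, where every set counts as a structure: U(0,0) is the
   countably infinite set without relations. *)
definition nm_structure :: "nat \<Rightarrow> nat \<Rightarrow> 'a binstr \<Rightarrow> bool" where
  "nm_structure n m A \<longleftrightarrow>
     (\<forall>i\<ge>n. \<forall>x\<in>univ A. \<forall>y\<in>univ A. \<not> rel A i x y) \<and>
     (\<forall>i<n. \<forall>x\<in>univ A. \<not> rel A i x x) \<and>
     (\<forall>i<m. \<forall>x\<in>univ A. \<forall>y\<in>univ A. rel A i x y \<longrightarrow> rel A i y x) \<and>
     (\<forall>i. m \<le> i \<and> i < n \<longrightarrow> (\<forall>x\<in>univ A. \<forall>y\<in>univ A. rel A i x y \<longrightarrow> \<not> rel A i y x)) \<and>
     (\<forall>i<n. \<forall>j<n. \<forall>x\<in>univ A. \<forall>y\<in>univ A. i \<noteq> j \<and> x \<noteq> y \<and> rel A i x y \<longrightarrow>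
        \<not> rel A j x y \<and> \<not> rel A j y x) \<and>
     (n \<noteq> 0 \<longrightarrow> (\<forall>x\<in>univ A. \<forall>y\<in>univ A. x \<noteq> y \<longrightarrow> (\<exists>i<n. rel A i x y \<or> rel A i y x)))"

(* U(n,m) is determined only up to isomorphism, hence a predicate. *)
definition is_U :: "nat \<Rightarrow> nat \<Rightarrow> 'a binstr \<Rightarrow> bool" where
  "is_U n m U \<longleftrightarrow> fraisse_limit {C. finite (univ C) \<and> nm_structure n m C} U"


section \<open>The tree structures T(n,m) and D(n,m)\<close>

definition tree :: "nat \<Rightarrow> nat list set" where
  "tree d = {x. set x \<subseteq> {..<d}}"

abbreviation meet :: "nat list \<Rightarrow> nat list \<Rightarrow> nat list" where
  "meet \<equiv> longest_common_prefix"

definition prec :: "nat list \<Rightarrow> nat list \<Rightarrow> bool" where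
  "prec x y \<longleftrightarrow> parallel x y \<and> x ! length (meet x y) < y ! length (meet x y)"

definition deg :: "nat \<Rightarrow> nat \<Rightarrow> nat" where
  "deg n m = m + 2 * (n - m)"

inductive tree_rel :: "nat \<Rightarrow> nat \<Rightarrow> nat list \<Rightarrow> nat list \<Rightarrow> bool" for m where
  sym1: "length x < length y \<Longrightarrow> p = y ! length x \<Longrightarrow> p < m \<Longrightarrow> tree_rel m p x y"
| sym2: "length x < length y \<Longrightarrow> p = y ! length x \<Longrightarrow> p < m \<Longrightarrow> tree_rel m p y x"
| even: "length x < length y \<Longrightarrow> p = y ! length x \<Longrightarrow> p \<ge> m \<Longrightarrow> even (p - m) \<Longrightarrow>
           tree_rel m (m + (p - m) div 2) x y"
| odd: "length x < length y \<Longrightarrow> p = y ! length x \<Longrightarrow> p \<ge> m \<Longrightarrow> odd (p - m) \<Longrightarrow>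
           tree_rel m (m + (p - m - 1) div 2) y x"
| level1: "length x = length y \<Longrightarrow> prec x y \<Longrightarrow> tree_rel m 0 x y"
| level2: "length x = length y \<Longrightarrow> prec x y \<Longrightarrow> m > 0 \<Longrightarrow> tree_rel m 0 y x"

definition T_str :: "nat \<Rightarrow> nat \<Rightarrow> nat list binstr" where
  "T_str n m = \<lparr>univ = tree (deg n m),
     rel = (\<lambda>i x y. x \<in> tree (deg n m) \<and> y \<in> tree (deg n m) \<and> tree_rel m i x y)\<rparr>"

definition meet_closure :: "nat list set \<Rightarrow> nat list set" where
  "meet_closure S = {meet x y | x y. x \<in> S \<and> y \<in> S}"

definition immediate_succs :: "nat list set \<Rightarrow> nat list \<Rightarrow> nat list set" where
  "immediate_succs P s =
     {t \<in> P. strict_prefix s t \<and> \<not> (\<exists>u\<in>P. strict_prefix s u \<and> strict_prefix u t)}"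

definition strongly_diagonal :: "nat \<Rightarrow> nat list set \<Rightarrow> bool" where
  "strongly_diagonal d S \<longleftrightarrow> S \<subseteq> tree d \<and>
     (\<forall>x\<in>S. \<forall>y\<in>S. x \<noteq> y \<longrightarrow> parallel x y) \<and>
     inj_on length (meet_closure S) \<and>
     (\<forall>s\<in>meet_closure S. finite (immediate_succs (meet_closure S) s) \<and>
        card (immediate_succs (meet_closure S) s) \<le> 2) \<and>
     (\<forall>x\<in>S. \<forall>y\<in>S. \<forall>z\<in>S. x \<noteq> y \<longrightarrow>
        (length (meet x y) < length z \<and> \<not> prefix (meet x y) z \<longrightarrow> z ! length (meet x y) = 0) \<and>
        x ! length (meet x y) \<in> {0, 1})"

definition strong_diagonalization :: "nat \<Rightarrow> (nat list \<Rightarrow> nat list) \<Rightarrow> bool" where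
  "strong_diagonalization d f \<longleftrightarrow>
     inj_on f (tree d) \<and> f ` tree d \<subseteq> tree d \<and> strongly_diagonal d (f ` tree d) \<and>
     (\<forall>x\<in>tree d. \<forall>y\<in>tree d. \<forall>z\<in>tree d. \<forall>u\<in>tree d.
        length (meet x y) < length (meet z u) \<longrightarrow>
        length (meet (f x) (f y)) < length (meet (f z) (f u))) \<and>
     (\<forall>x\<in>tree d. \<forall>z\<in>tree d. length z > length x \<longrightarrow> z ! length x = f z ! length (f x)) \<and>
     (\<forall>x\<in>tree d. \<forall>y\<in>tree d. prec x y \<longrightarrow> prec (f x) (f y))"

(* D(n,m) relative to the chosen strong diagonalization f. *)
definition D_str :: "nat \<Rightarrow> nat \<Rightarrow> (nat list \<Rightarrow> nat list) \<Rightarrow> nat list binstr" where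
  "D_str n m f = induced (T_str n m) (f ` tree (deg n m))"

end

theory Submission
  imports Defs "HOL-Library.FuncSet"
begin

text \<open>
  A \<open>k\<close>-bounded colouring is \<open>k\<close>-delta, and all the structures in question embed the tree of words
  over \<open>d\<close> letters with vertices of different length related as in \<open>\<T>(n,m)\<close>. So it suffices to find,
  for every \<open>k\<close>-delta colouring \<open>\<gamma>\<close> of the \<open>c\<close>-element sets of words and all prescribed letters
  \<open>e j i\<close>, words \<open>v 0, v 1, \<dots>\<close> of increasing length with \<open>v j ! length (v i) = e j i\<close> for \<open>i < j\<close>
  on which \<open>\<gamma>\<close> is injective.

  By Milliken's theorem and a fusion argument we may assume that, for each level \<open>m\<close>, whether two small
  sets of words have equal colours is not changed by any strong embedding that fixes the words shorter
  than \<open>m\<close>. Then the \<open>v i\<close> can be chosen one after the other, so that no two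
  sets \<open>X \<noteq> Y\<close> of chosen words have a common continuation \<open>Z\<close> with
  \<open>\<gamma> (X \<union> Z) = \<gamma> (Y \<union> Z)\<close>. By homogeneity only finitely many \<open>Z\<close> have to be considered, their
  number does not depend on the number \<open>N\<close> of candidates \<open>b\<close> for the next word, and each triple
  \<open>X, Y, Z\<close> rules out at most \<open>k\<close> of them, as the sets \<open>insert b (Y \<union> Z)\<close> form a delta-system.

  The Halpern--Lauchli theorem behind Milliken's theorem is proved with idempotents in a minimal left
  ideal of the semigroup of ultrafilters on words of letter functions.
\<close>

section \<open>Ultrafilters\<close>

text \<open>Two obstacles shape the proof. The colouring has infinitely many values, so partition
  theorems apply only to the finite pattern of equalities between colours of small sets. Homogeneity
  of this pattern does not make colours distinct; it replaces infinitely many possible tails by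
  finitely many, and the delta condition then wins by counting. The other obstacle is in the
  Halpern--Lauchli theorem: the tree branches while the embedding is built, so consecutive steps are
  read along different sections of the levels. A single idempotent would absorb only itself. In a
  minimal left ideal every idempotent is a right identity, so all projections of one ultrafilter
  absorb one another. Letters are functions on nodes for the same purpose: one word describes what
  happens above all nodes of a level at once, however many nodes later levels have.\<close>

definition ultra :: "'a set set \<Rightarrow> bool" where
  "ultra U \<longleftrightarrow> (\<forall>A B. A \<inter> B \<in> U \<longleftrightarrow> A \<in> U \<and> B \<in> U) \<and> (\<forall>A. - A \<in> U \<longleftrightarrow> A \<notin> U)"

lemma ultra_Int: "ultra U \<Longrightarrow> A \<inter> B \<in> U \<longleftrightarrow> A \<in> U \<and> B \<in> U"
  by (simp add: ultra_def)

lemma ultra_Compl: "ultra U \<Longrightarrow> - A \<in> U \<longleftrightarrow> A \<notin> U"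
  by (simp add: ultra_def)

lemma ultra_mono: "ultra U \<Longrightarrow> A \<in> U \<Longrightarrow> A \<subseteq> B \<Longrightarrow> B \<in> U"
  by (metis inf.absorb_iff1 ultra_Int)

lemma ultra_empty: "ultra U \<Longrightarrow> {} \<notin> U"
  by (metis Compl_disjoint ultra_Compl ultra_Int)

lemma ultra_UNIV: "ultra U \<Longrightarrow> UNIV \<in> U"
  by (metis Compl_UNIV_eq ultra_Compl ultra_empty)

lemma ultra_nonempty: "ultra U \<Longrightarrow> A \<in> U \<Longrightarrow> \<exists>x. x \<in> A"
  using ultra_empty[of U] by (metis ex_in_conv)

lemma ultra_Inter:
  assumes "ultra U" "finite F"
  shows "\<Inter>F \<in> U \<longleftrightarrow> F \<subseteq> U"
  using assms(2) by (induction F rule: finite_induct) (use assms(1) in \<open>auto simp: ultra_UNIV ultra_Int\<close>)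

lemma ultra_eqI: "ultra U \<Longrightarrow> ultra V \<Longrightarrow> U \<subseteq> V \<Longrightarrow> U = V"
  by (metis subsetD subsetI subset_antisym ultra_Compl)

lemma ultra_finite_Ball:
  assumes "ultra U" "finite I"
  shows "{x. \<forall>i\<in>I. P i x} \<in> U \<longleftrightarrow> (\<forall>i\<in>I. {x. P i x} \<in> U)"
proof -
  have "{x. \<forall>i\<in>I. P i x} = \<Inter>((\<lambda>i. {x. P i x}) ` I)" by auto
  then show ?thesis using ultra_Inter[OF assms(1), of "(\<lambda>i. {x. P i x}) ` I"] assms(2) by auto
qed

lemma ultra_finite_range:
  assumes "ultra U" "finite (c ` S)" "S \<in> U"
  shows "\<exists>j. {x \<in> S. c x = j} \<in> U"
proof (rule ccontr)
  assume *: "\<not> ?thesis"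
  have "{x. \<forall>j\<in>c ` S. \<not> (x \<in> S \<and> c x = j)} \<in> U"
    unfolding ultra_finite_Ball[OF assms(1,2)]
  proof
    fix j
    have "- {x \<in> S. c x = j} \<in> U" using * assms(1) by (simp add: ultra_Compl)
    moreover have "- {x \<in> S. c x = j} = {x. \<not> (x \<in> S \<and> c x = j)}" by auto
    ultimately show "{x. \<not> (x \<in> S \<and> c x = j)} \<in> U" by metis
  qed
  then have "{x. \<forall>j\<in>c ` S. \<not> (x \<in> S \<and> c x = j)} \<inter> S \<in> U"
    using assms by (simp add: ultra_Int)
  moreover have "{x. \<forall>j\<in>c ` S. \<not> (x \<in> S \<and> c x = j)} \<inter> S = {}" by auto
  ultimately show False using ultra_empty[OF assms(1)] by simp
qed

section \<open>Compactness of the space of ultrafilters\<close>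

definition FIP :: "'a set set \<Rightarrow> bool" where
  "FIP F \<longleftrightarrow> (\<forall>G. finite G \<and> G \<subseteq> F \<longrightarrow> \<Inter>G \<noteq> {})"

lemma FIP_insert_dest:
  assumes "FIP F" "\<not> FIP (insert A F)"
  obtains G where "finite G" "G \<subseteq> F" "A \<inter> \<Inter>G = {}"
proof -
  obtain G where G: "finite G" "G \<subseteq> insert A F" "\<Inter>G = {}"
    using assms(2) by (auto simp: FIP_def)
  then have "finite (G - {A})" "G - {A} \<subseteq> F" "A \<inter> \<Inter>(G - {A}) = {}" by auto
  then show ?thesis by (rule that)
qed

lemma FIP_chain:
  assumes "subset.chain {F. FIP F} C" "C \<noteq> {}"
  shows "FIP (\<Union>C)"
  unfolding FIP_def
proof (intro allI impI)
  fix G assume G: "finite G \<and> G \<subseteq> \<Union>C"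
  then obtain M where "M \<in> C" "G \<subseteq> M"
    using finite_subset_Union_chain[of G C "{F. FIP F}"] assms by auto
  then show "\<Inter>G \<noteq> {}" using assms(1) G by (auto simp: FIP_def subset_chain_def)
qed

text \<open>A maximal family with the finite intersection property decides every set: a finite
  subfamily avoiding \<open>A\<close> and one avoiding its complement would together have empty
  intersection.\<close>

lemma FIP_imp_ultra:
  fixes F :: "'a set set"
  assumes "FIP F"
  shows "\<exists>U. ultra U \<and> F \<subseteq> U"
proof -
  have "\<exists>U\<in>{U. FIP U \<and> F \<subseteq> U}. \<forall>X\<in>{U. FIP U \<and> F \<subseteq> U}. U \<subseteq> X \<longrightarrow> X = U"
  proof (rule subset_Zorn)
    fix C assume C: "subset.chain {U. FIP U \<and> F \<subseteq> U} C"
    show "\<exists>U\<in>{U. FIP U \<and> F \<subseteq> U}. \<forall>X\<in>C. X \<subseteq> U"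
    proof (cases "C = {}")
      case True then show ?thesis using assms by auto
    next
      case False
      have "subset.chain {F. FIP F} C" using C by (auto simp: subset_chain_def)
      then have "FIP (\<Union>C)" using FIP_chain False by blast
      moreover have "F \<subseteq> \<Union>C" using C False unfolding subset_chain_def by blast
      ultimately show ?thesis by blast
    qed
  qed
  then obtain U where U': "U \<in> {U. FIP U \<and> F \<subseteq> U}"
    and max': "\<forall>X\<in>{U. FIP U \<and> F \<subseteq> U}. U \<subseteq> X \<longrightarrow> X = U" by (elim bexE)
  then have U: "FIP U" "F \<subseteq> U" by simp_all
  have max: "X = U" if "FIP X" "U \<subseteq> X" for X
  proof -
    have "X \<in> {U. FIP U \<and> F \<subseteq> U}" using U(2) that by auto
    then show ?thesis using bspec[OF max'] that(2) by blast
  qed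
  have mem: "\<exists>G. finite G \<and> G \<subseteq> U \<and> A \<inter> \<Inter>G = {}" if "A \<notin> U" for A
  proof -
    have "\<not> FIP (insert A U)" using max[of "insert A U"] that by (metis insertI1 subset_insertI)
    then show ?thesis using FIP_insert_dest[OF U(1)] by metis
  qed
  have compl: "- A \<in> U \<longleftrightarrow> A \<notin> U" for A
  proof
    assume *: "- A \<in> U" show "A \<notin> U"
    proof
      assume "A \<in> U"
      then have "finite {A, - A} \<and> {A, - A} \<subseteq> U" using * by simp
      then have "\<Inter>{A, - A} \<noteq> {}" using U(1) unfolding FIP_def by metis
      then show False by simp
    qed
  next
    assume "A \<notin> U"
    then obtain G where G: "finite G" "G \<subseteq> U" "A \<inter> \<Inter>G = {}" using mem by metis
    show "- A \<in> U"
    proof (rule ccontr)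
      assume "- A \<notin> U"
      then obtain G' where G': "finite G'" "G' \<subseteq> U" "- A \<inter> \<Inter>G' = {}" using mem by metis
      have "\<Inter>(G \<union> G') = {}" using G(3) G'(3) by (simp add: Inter_Un_distrib) blast
      moreover have "finite (G \<union> G') \<and> G \<union> G' \<subseteq> U" using G G' by simp
      ultimately show False using U(1) unfolding FIP_def by metis
    qed
  qed
  have up: "B \<in> U" if "G \<subseteq> U" "finite G" "\<Inter>G \<subseteq> B" for B G
  proof (rule ccontr)
    assume "B \<notin> U" then have "- B \<in> U" using compl by blast
    then have "finite (insert (- B) G) \<and> insert (- B) G \<subseteq> U" using that by simp
    then have "\<Inter>(insert (- B) G) \<noteq> {}" using U(1) unfolding FIP_def by metis
    then show False using that by auto
  qed
  have "A \<inter> B \<in> U \<longleftrightarrow> A \<in> U \<and> B \<in> U" for A B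
  proof
    assume "A \<inter> B \<in> U"
    then show "A \<in> U \<and> B \<in> U"
      by (intro conjI up[of "{A \<inter> B}" A] up[of "{A \<inter> B}" B]) auto
  next
    assume "A \<in> U \<and> B \<in> U"
    then show "A \<inter> B \<in> U" by (intro up[of "{A, B}" "A \<inter> B"]) auto
  qed
  then have "ultra U" using compl by (simp add: ultra_def)
  then show ?thesis using U by blast
qed

text \<open>These are the closed sets of the Stone topology; closedness is handled through the
  families \<open>F\<close> instead of a topology.\<close>

definition cls :: "'a set set \<Rightarrow> 'a set set set" where
  "cls F = {U. ultra U \<and> F \<subseteq> U}"

definition closedU :: "'a set set set \<Rightarrow> bool" where
  "closedU C \<longleftrightarrow> (\<exists>F. C = cls F)"

lemma cls_nonempty_iff: "cls F \<noteq> {} \<longleftrightarrow> FIP F"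
proof
  assume "cls F \<noteq> {}"
  then obtain U where U: "ultra U" "F \<subseteq> U" by (auto simp: cls_def)
  show "FIP F" unfolding FIP_def
  proof (intro allI impI)
    fix G assume G: "finite G \<and> G \<subseteq> F"
    then have "\<Inter>G \<in> U" using U ultra_Inter by blast
    then show "\<Inter>G \<noteq> {}" using ultra_empty[OF U(1)] by metis
  qed
qed (auto simp: cls_def dest: FIP_imp_ultra)

lemma closedU_ultra: "closedU C \<Longrightarrow> U \<in> C \<Longrightarrow> ultra U"
  by (auto simp: closedU_def cls_def)

lemma closedU_Inter: "\<C> \<noteq> {} \<Longrightarrow> (\<And>C. C \<in> \<C> \<Longrightarrow> closedU C) \<Longrightarrow> closedU (\<Inter>\<C>)"
proof -
  assume *: "\<C> \<noteq> {}" "\<And>C. C \<in> \<C> \<Longrightarrow> closedU C"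
  then obtain f where f: "\<And>C. C \<in> \<C> \<Longrightarrow> C = cls (f C)" unfolding closedU_def by metis
  have f': "U \<in> C \<longleftrightarrow> ultra U \<and> f C \<subseteq> U" if "C \<in> \<C>" for U C
    using arg_cong[OF f[OF that], of "\<lambda>D. U \<in> D"] unfolding cls_def by blast
  have "\<Inter>\<C> = cls (\<Union>(f ` \<C>))"
  proof (rule set_eqI)
    fix U
    have "U \<in> \<Inter>\<C> \<longleftrightarrow> (\<forall>C\<in>\<C>. ultra U \<and> f C \<subseteq> U)" using f' by (meson InterE InterI)
    also have "\<dots> \<longleftrightarrow> U \<in> cls (\<Union>(f ` \<C>))" using *(1) unfolding cls_def by blast
    finally show "U \<in> \<Inter>\<C> \<longleftrightarrow> U \<in> cls (\<Union>(f ` \<C>))" .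
  qed
  then show ?thesis by (auto simp: closedU_def)
qed

lemma closedU_Int: "closedU C \<Longrightarrow> closedU D \<Longrightarrow> closedU (C \<inter> D)"
  using closedU_Inter[of "{C, D}"] by auto

lemma closedU_chain_nonempty:
  assumes "\<C> \<noteq> {}" "\<And>C. C \<in> \<C> \<Longrightarrow> closedU C \<and> C \<noteq> {}"
    and chain: "\<And>C D. C \<in> \<C> \<Longrightarrow> D \<in> \<C> \<Longrightarrow> C \<subseteq> D \<or> D \<subseteq> C"
  shows "\<Inter>\<C> \<noteq> {}"
proof -
  \<comment> \<open>This is the largest family that defines \<open>C\<close>. The choice reverses
    inclusions, so a chain of closed sets gives a chain of families and \<open>FIP_chain\<close>
    applies.\<close>
  define g where "g C = \<Inter>C" for C :: "'a set set set"
  have g: "C = cls (g C)" if C: "C \<in> \<C>" for C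
  proof -
    obtain F where F: "C = cls F" using assms(2)[OF C] unfolding closedU_def by metis
    have "F \<subseteq> g C" unfolding F g_def cls_def by blast
    then have "cls (g C) \<subseteq> C" unfolding F cls_def by blast
    moreover have "C \<subseteq> cls (g C)" using F unfolding g_def cls_def by blast
    ultimately show ?thesis by (rule subset_antisym[rotated])
  qed
  have "subset.chain {F. FIP F} (g ` \<C>)"
    unfolding subset_chain_def
  proof (intro conjI ballI)
    show "g ` \<C> \<subseteq> {F. FIP F}"
    proof
      fix F assume "F \<in> g ` \<C>"
      then obtain C where "C \<in> \<C>" "F = g C" by blast
      then show "F \<in> {F. FIP F}" using g[of C] assms(2)[of C] cls_nonempty_iff[of F] by simp
    qed
    show "x \<subseteq> y \<or> y \<subseteq> x" if xy: "x \<in> g ` \<C>" "y \<in> g ` \<C>" for x y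
    proof -
      obtain C D where CD: "C \<in> \<C>" "x = g C" "D \<in> \<C>" "y = g D" using xy by blast
      show ?thesis using chain[OF CD(1,3)] unfolding CD(2,4) g_def by blast
    qed
  qed
  then have "FIP (\<Union>(g ` \<C>))" using FIP_chain assms(1) by blast
  then obtain U where U: "ultra U" "\<Union>(g ` \<C>) \<subseteq> U" using FIP_imp_ultra by blast
  have "U \<in> C" if "C \<in> \<C>" for C
  proof -
    have "U \<in> cls (g C)" using U that unfolding cls_def by blast
    then show ?thesis using g[OF that] by simp
  qed
  then show ?thesis by blast
qed

text \<open>Zorn's lemma downwards, hence run on complements; compactness keeps the intersection of
  a chain nonempty. It yields both minimal subsemigroups and minimal left ideals.\<close>

lemma minimal_closed:
  assumes P0: "P C0" and cl: "\<And>C. P C \<Longrightarrow> closedU C \<and> C \<noteq> {}"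
    and ch: "\<And>\<C>. \<C> \<noteq> {} \<Longrightarrow> (\<And>C. C \<in> \<C> \<Longrightarrow> P C) \<Longrightarrow> \<Inter>\<C> \<noteq> {} \<Longrightarrow> closedU (\<Inter>\<C>) \<Longrightarrow> P (\<Inter>\<C>)"
  obtains M where "P M" "M \<subseteq> C0" "\<And>C. P C \<Longrightarrow> C \<subseteq> M \<Longrightarrow> C = M"
proof -
  let ?A = "uminus ` {C. P C \<and> C \<subseteq> C0}"
  have "\<exists>M\<in>?A. \<forall>X\<in>?A. M \<subseteq> X \<longrightarrow> X = M"
  proof (rule subset_Zorn)
    fix D assume D: "subset.chain ?A D"
    show "\<exists>U\<in>?A. \<forall>X\<in>D. X \<subseteq> U"
    proof (cases "D = {}")
      case True then show ?thesis using P0 by blast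
    next
      case False
      let ?C = "uminus ` D"
      have mem: "P C" "C \<subseteq> C0" if "C \<in> ?C" for C
        using that D by (auto simp: subset_chain_def)
      have "\<Inter>?C \<noteq> {}"
      proof (rule closedU_chain_nonempty)
        show "?C \<noteq> {}" using False by simp
        show "closedU C \<and> C \<noteq> {}" if "C \<in> ?C" for C using cl mem(1)[OF that] .
        show "C \<subseteq> E \<or> E \<subseteq> C" if CE: "C \<in> ?C" "E \<in> ?C" for C E
        proof -
          obtain x y where xy: "x \<in> D" "y \<in> D" "C = - x" "E = - y" using CE by blast
          then have "x \<subseteq> y \<or> y \<subseteq> x" using D unfolding subset_chain_def by metis
          then show ?thesis unfolding xy(3,4) by blast
        qed
      qed
      moreover have "closedU (\<Inter>?C)"
        by (rule closedU_Inter) (use False mem(1) cl in blast)+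
      ultimately have "P (\<Inter>?C)"
        by (intro ch) (use False mem(1) in blast)+
      moreover have "\<Inter>?C \<subseteq> C0" using False mem(2) by blast
      moreover have "\<forall>X\<in>D. X \<subseteq> - \<Inter>?C" by auto
      ultimately show ?thesis by blast
    qed
  qed
  then obtain N where N: "N \<in> ?A" and mx: "\<forall>X\<in>?A. N \<subseteq> X \<longrightarrow> X = N" by (elim bexE)
  from N obtain M where M: "N = - M" "P M" "M \<subseteq> C0" by (elim imageE) simp
  show ?thesis
  proof (rule that[OF M(2,3)])
    fix C assume C: "P C" "C \<subseteq> M"
    then have "- C \<in> ?A" using M(3) by simp
    moreover have "N \<subseteq> - C" using C(2) unfolding M(1) by simp
    ultimately have "- C = N" using bspec[OF mx, of "- C"] by simp
    then show "C = M" unfolding M(1) by simp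
  qed
qed

text \<open>By Stone duality, taking preimages of ultrafilters under a Boolean homomorphism is a
  continuous map. Push-forwards and right multiplication by a fixed ultrafilter both have this form,
  so closed images and preimages are treated once for both.\<close>

definition bhom :: "('a set \<Rightarrow> 'b set) \<Rightarrow> bool" where
  "bhom h \<longleftrightarrow> (\<forall>A B. h (A \<inter> B) = h A \<inter> h B) \<and> (\<forall>A. h (- A) = - h A)"

lemma ultra_pull: "bhom h \<Longrightarrow> ultra U \<Longrightarrow> ultra (h -` U)"
  by (simp add: ultra_def bhom_def)

lemma bhom_vimage: "bhom ((-`) f)"
  by (auto simp: bhom_def)

lemma bhom_UNIV: "bhom h \<Longrightarrow> h UNIV = UNIV"
proof -
  assume h: "bhom h"
  have "h (UNIV \<inter> - UNIV) = h UNIV \<inter> - h UNIV" "h (- (UNIV \<inter> - UNIV)) = - h (UNIV \<inter> - UNIV)"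
    using h unfolding bhom_def by blast+
  then show ?thesis by simp
qed

lemma bhom_Inter:
  assumes "bhom h" "finite G"
  shows "h (\<Inter>G) = \<Inter>(h ` G)"
  using assms(2)
proof (induction G rule: finite_induct)
  case empty show ?case using assms(1) by (simp add: bhom_UNIV)
next
  case (insert A G)
  have "h (A \<inter> \<Inter>G) = h A \<inter> h (\<Inter>G)" using assms(1) by (simp add: bhom_def)
  then show ?case using insert by simp
qed

lemma closedU_preimage:
  assumes "bhom h" "closedU C"
  shows "closedU {U. ultra U \<and> h -` U \<in> C}"
proof -
  obtain F where F: "C = cls F" using assms by (auto simp: closedU_def)
  have "{U. ultra U \<and> h -` U \<in> C} = cls (h ` F)"
    using ultra_pull[OF assms(1)] by (auto simp: F cls_def)
  then show ?thesis by (auto simp: closedU_def)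
qed

text \<open>A continuous image of a compact set is closed. Let \<open>W\<close> contain every set
  common to all image points. If \<open>W\<close> had no preimage in \<open>C\<close>, then by
  compactness some \<open>A\<close> in \<open>W\<close> would belong to no image point, so that
  \<open>- A\<close> would be common to all of them and lie in \<open>W\<close>.\<close>

lemma closedU_image:
  fixes h :: "'a set \<Rightarrow> 'b set"
  assumes h: "bhom h" and C: "closedU C"
  shows "closedU ((\<lambda>U. h -` U) ` C)"
proof -
  obtain F where F: "C = cls F" using C by (auto simp: closedU_def)
  let ?G = "\<Inter>((\<lambda>U. h -` U) ` C)"
  have "(\<lambda>U. h -` U) ` C = (if C = {} then {} else cls ?G)"
  proof (cases "C = {}")
    case False
    have "W \<in> (\<lambda>U. h -` U) ` C" if W: "ultra W" "?G \<subseteq> W" for W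
    proof -
      have "FIP (F \<union> h ` W)" unfolding FIP_def
      proof (intro allI impI notI)
        fix G assume G: "finite G \<and> G \<subseteq> F \<union> h ` W" and e: "\<Inter>G = {}"
        have "finite (G \<inter> h ` W)" "G \<inter> h ` W \<subseteq> h ` W" using G by simp_all
        then obtain W' where W': "finite W'" "W' \<subseteq> W" "G \<inter> h ` W = h ` W'"
          by (metis finite_subset_image)
        let ?F = "G \<inter> F" and ?A = "\<Inter>W'"
        have A: "?A \<in> W" using ultra_Inter[OF W(1) W'(1)] W'(2) by simp
        have "G = ?F \<union> (G \<inter> h ` W)" using G by blast
        then have "G = ?F \<union> h ` W'" unfolding W'(3) .
        then have "\<Inter>G = \<Inter>?F \<inter> \<Inter>(h ` W')" by (metis Inter_Un_distrib)
        then have e': "\<Inter>?F \<inter> h ?A = {}" using e bhom_Inter[OF h W'(1)] by simp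
        have "- ?A \<in> h -` U" if "U \<in> C" for U
        proof -
          have U: "ultra U" "F \<subseteq> U" using that by (auto simp: F cls_def)
          have "finite ?F" "?F \<subseteq> U" using G U(2) by auto
          then have "\<Inter>?F \<in> U" using ultra_Inter[OF U(1)] by simp
          moreover have "\<Inter>?F \<subseteq> - h ?A" using e' by (simp only: disjoint_eq_subset_Compl)
          ultimately have "- h ?A \<in> U" by (rule ultra_mono[OF U(1)])
          then show ?thesis using h by (simp add: bhom_def)
        qed
        then have "- ?A \<in> ?G" by simp
        then have "- ?A \<in> W" by (rule subsetD[OF W(2)])
        then show False using A W(1) by (simp add: ultra_Compl)
      qed
      then obtain U where U: "ultra U" "F \<union> h ` W \<subseteq> U" using FIP_imp_ultra by metis
      then have UC: "U \<in> C" and "W \<subseteq> h -` U" by (auto simp: F cls_def)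
      then have "W = h -` U" using ultra_eqI[OF W(1) ultra_pull[OF h U(1)]] by simp
      then show ?thesis using UC by simp
    qed
    then have "cls ?G \<subseteq> (\<lambda>U. h -` U) ` C" unfolding cls_def by (intro subsetI) simp
    moreover have "(\<lambda>U. h -` U) ` C \<subseteq> cls ?G"
    proof
      fix W assume "W \<in> (\<lambda>U. h -` U) ` C"
      then obtain U where U: "U \<in> C" "W = h -` U" by (elim imageE) simp
      have "ultra U" using U(1) by (simp add: F cls_def)
      then have "ultra W" using ultra_pull[OF h] U(2) by simp
      moreover have "?G \<subseteq> W" using U by (intro Inter_lower) simp
      ultimately show "W \<in> cls ?G" by (simp add: cls_def)
    qed
    ultimately show ?thesis using False by simp
  qed simp
  moreover have "closedU {}"
  proof -
    have "cls {{}} = {}" by (auto simp: cls_def ultra_empty)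
    then show ?thesis unfolding closedU_def by metis
  qed
  ultimately show ?thesis unfolding closedU_def by metis
qed

section \<open>The semigroup of ultrafilters on words\<close>

definition uconv :: "'a list set set \<Rightarrow> 'a list set set \<Rightarrow> 'a list set set" (infixl "\<odot>" 70) where
  "U \<odot> V = {A. {x. {y. x @ y \<in> A} \<in> V} \<in> U}"

lemma uconv_pull: "U \<odot> V = (\<lambda>A. {x. {y. x @ y \<in> A} \<in> V}) -` U"
  by (auto simp: uconv_def)

text \<open>Right multiplication by a fixed ultrafilter is thus continuous. This is why left ideals
  are used: their right translates stay closed.\<close>

lemma bhom_uconv: "ultra V \<Longrightarrow> bhom (\<lambda>A. {x. {y. x @ y \<in> A} \<in> V})"
  unfolding bhom_def
proof (intro conjI allI)
  fix A B :: "'a list set" assume V: "ultra V"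
  have "{y. x @ y \<in> A \<inter> B} = {y. x @ y \<in> A} \<inter> {y. x @ y \<in> B}" for x by auto
  then show "{x. {y. x @ y \<in> A \<inter> B} \<in> V} = {x. {y. x @ y \<in> A} \<in> V} \<inter> {x. {y. x @ y \<in> B} \<in> V}"
    using V by (auto simp: ultra_Int)
  have "{y. x @ y \<in> - A} = - {y. x @ y \<in> A}" for x by auto
  then show "{x. {y. x @ y \<in> - A} \<in> V} = - {x. {y. x @ y \<in> A} \<in> V}"
    using V by (auto simp: ultra_Compl)
qed

lemma ultra_uconv: "ultra U \<Longrightarrow> ultra V \<Longrightarrow> ultra (U \<odot> V)"
  by (simp add: uconv_pull ultra_pull bhom_uconv)

lemma uconv_assoc: "U \<odot> V \<odot> W = U \<odot> (V \<odot> W)"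
  by (simp add: uconv_def)

lemma closedU_uconv: "closedU C \<Longrightarrow> ultra V \<Longrightarrow> closedU ((\<lambda>U. U \<odot> V) ` C)"
  unfolding uconv_pull by (intro closedU_image bhom_uconv)

definition pushU :: "('a \<Rightarrow> 'b) \<Rightarrow> 'a set set \<Rightarrow> 'b set set" where
  "pushU f U = {A. f -` A \<in> U}"

lemma pushU_pull: "pushU f U = (-`) f -` U"
  by (auto simp: pushU_def)

lemma ultra_push: "ultra U \<Longrightarrow> ultra (pushU f U)"
  by (simp add: pushU_pull ultra_pull bhom_vimage)

lemma pushU_uconv:
  assumes "\<And>x y. f (x @ y) = f x @ f y"
  shows "pushU f (U \<odot> V) = pushU f U \<odot> pushU f V"
  by (simp add: pushU_def uconv_def vimage_def assms)

definition subsemi :: "'a list set set set \<Rightarrow> bool" where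
  "subsemi C \<longleftrightarrow> closedU C \<and> C \<noteq> {} \<and> (\<forall>U\<in>C. \<forall>V\<in>C. U \<odot> V \<in> C)"

text \<open>The Ellis--Numakura argument. In a minimal closed subsemigroup \<open>T\<close> the
  right translate by \<open>e\<close> is again a closed subsemigroup, so it is all of
  \<open>T\<close>, and some \<open>t\<close> satisfies \<open>t \<odot> e = e\<close>. All such
  \<open>t\<close> form a closed subsemigroup too, so it is all of \<open>T\<close> and contains
  \<open>e\<close> itself.\<close>

lemma Ellis:
  assumes "subsemi C"
  shows "\<exists>e\<in>C. e \<odot> e = e"
proof -
  obtain T where T: "subsemi T" "T \<subseteq> C" and min: "\<And>D. subsemi D \<Longrightarrow> D \<subseteq> T \<Longrightarrow> D = T"
    by (rule minimal_closed[of subsemi, OF assms]) (auto simp: subsemi_def)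
  obtain e where e: "e \<in> T" using T by (auto simp: subsemi_def)
  have ue: "ultra e" using T e closedU_ultra by (auto simp: subsemi_def)
  have "subsemi ((\<lambda>U. U \<odot> e) ` T)"
    unfolding subsemi_def
  proof (intro conjI ballI)
    show "closedU ((\<lambda>U. U \<odot> e) ` T)" using T ue closedU_uconv by (auto simp: subsemi_def)
    fix U V assume "U \<in> (\<lambda>U. U \<odot> e) ` T" "V \<in> (\<lambda>U. U \<odot> e) ` T"
    then obtain U' V' where *: "U = U' \<odot> e" "V = V' \<odot> e" "U' \<in> T" "V' \<in> T" by auto
    then have "U \<odot> V = (U' \<odot> e \<odot> V') \<odot> e" by (simp add: uconv_assoc)
    moreover have "U' \<odot> e \<odot> V' \<in> T" using * e T by (auto simp: subsemi_def)
    ultimately show "U \<odot> V \<in> (\<lambda>U. U \<odot> e) ` T" by blast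
  qed (use e in auto)
  then have "(\<lambda>U. U \<odot> e) ` T = T" using T e by (intro min) (auto simp: subsemi_def)
  then obtain t where t: "t \<in> T" "t \<odot> e = e" using e by (metis imageE)
  let ?D = "{U \<in> T. U \<odot> e = e}"
  have "closedU {U. ultra U \<and> (\<lambda>A. {x. {y. x @ y \<in> A} \<in> e}) -` U \<in> {e}}"
  proof (rule closedU_preimage[OF bhom_uconv[OF ue]])
    have "{e} = cls e" using ue ultra_eqI by (auto simp: cls_def)
    then show "closedU {e}" by (auto simp: closedU_def)
  qed
  moreover have "?D = T \<inter> {U. ultra U \<and> (\<lambda>A. {x. {y. x @ y \<in> A} \<in> e}) -` U \<in> {e}}"
    using T closedU_ultra by (auto simp: subsemi_def uconv_pull)
  moreover have "closedU T" using T(1) by (simp add: subsemi_def)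
  ultimately have "closedU ?D" using closedU_Int by simp
  moreover have "U \<odot> V \<in> ?D" if "U \<in> ?D" "V \<in> ?D" for U V
    using that T(1) by (simp add: subsemi_def uconv_assoc)
  ultimately have "subsemi ?D" using t unfolding subsemi_def by blast
  then have "?D = T" by (rule min) simp
  then have "e \<odot> e = e" using e by blast
  then show ?thesis using e T(2) by (intro bexI[of _ e]) auto
qed

text \<open>For the last property: the right translate of \<open>L\<close> by \<open>f\<close> is a
  closed left ideal inside \<open>L\<close>, hence equal to \<open>L\<close>. So
  \<open>V = z \<odot> f\<close> for some \<open>z\<close>, and multiplying by \<open>f\<close> once
  more changes nothing.\<close>

lemma minimal_left_ideal:
  assumes B: "subsemi B"
  obtains L where "subsemi L" "L \<subseteq> B" "\<And>U V. U \<in> B \<Longrightarrow> V \<in> L \<Longrightarrow> U \<odot> V \<in> L"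
    "\<And>V f. V \<in> L \<Longrightarrow> f \<in> L \<Longrightarrow> f \<odot> f = f \<Longrightarrow> V \<odot> f = V"
proof -
  define P where "P C \<longleftrightarrow> closedU C \<and> C \<noteq> {} \<and> C \<subseteq> B \<and> (\<forall>U\<in>B. \<forall>V\<in>C. U \<odot> V \<in> C)" for C
  obtain L where L: "P L" and min: "\<And>D. P D \<Longrightarrow> D \<subseteq> L \<Longrightarrow> D = L"
  proof (rule minimal_closed[of P B])
    show "P B" using B by (simp add: P_def subsemi_def)
    show "closedU C \<and> C \<noteq> {}" if "P C" for C using that by (simp add: P_def)
    fix \<C> assume *: "\<C> \<noteq> {}" "\<And>C. C \<in> \<C> \<Longrightarrow> P C" "\<Inter>\<C> \<noteq> {}" "closedU (\<Inter>\<C>)"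
    obtain C where C: "C \<in> \<C>" using *(1) by blast
    have "\<Inter>\<C> \<subseteq> B" using Inter_lower[OF C] *(2)[OF C] unfolding P_def by (meson order_trans)
    moreover have "U \<odot> V \<in> \<Inter>\<C>" if UV: "U \<in> B" "V \<in> \<Inter>\<C>" for U V
    proof (rule InterI)
      fix D assume D: "D \<in> \<C>"
      then show "U \<odot> V \<in> D" using *(2)[OF D] UV InterD[OF UV(2) D] unfolding P_def by simp
    qed
    ultimately show "P (\<Inter>\<C>)" using *(3,4) unfolding P_def by simp
  qed metis
  show ?thesis
  proof (rule that[of L])
    show "subsemi L" using L by (auto simp: subsemi_def P_def)
    show "L \<subseteq> B" "\<And>U V. U \<in> B \<Longrightarrow> V \<in> L \<Longrightarrow> U \<odot> V \<in> L" using L by (auto simp: P_def)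
    fix V f assume V: "V \<in> L" and f: "f \<in> L" "f \<odot> f = f"
    have uf: "ultra f" using L f closedU_ultra by (auto simp: P_def)
    have LB: "L \<subseteq> B" using L by (simp add: P_def)
    have Lf: "U \<odot> f \<in> L" if "U \<in> L" for U
      using L f subsetD[OF LB that] by (simp add: P_def)
    then have LfL: "(\<lambda>U. U \<odot> f) ` L \<subseteq> L" by (rule image_subsetI)
    have "P ((\<lambda>U. U \<odot> f) ` L)"
      unfolding P_def
    proof (intro conjI ballI)
      show "closedU ((\<lambda>U. U \<odot> f) ` L)" using L closedU_uconv[OF _ uf] by (simp add: P_def)
      show "(\<lambda>U. U \<odot> f) ` L \<noteq> {}" using f by auto
      show "(\<lambda>U. U \<odot> f) ` L \<subseteq> B" using LfL LB by (rule order_trans)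
      fix U W assume U: "U \<in> B" "W \<in> (\<lambda>U. U \<odot> f) ` L"
      then obtain W' where W: "W' \<in> L" "W = W' \<odot> f" by (elim imageE) simp
      then have "U \<odot> W' \<in> L" using L U(1) by (simp add: P_def)
      then show "U \<odot> W \<in> (\<lambda>U. U \<odot> f) ` L"
        unfolding W(2) uconv_assoc[symmetric] by (rule imageI)
    qed
    then have "(\<lambda>U. U \<odot> f) ` L = L" using LfL by (rule min)
    then obtain z where "V = z \<odot> f" using V by (metis imageE)
    then show "V \<odot> f = V" using f(2) by (simp add: uconv_assoc)
  qed
qed

section \<open>Push-forwards, and the ultrafilters for one stage of the Halpern--Lauchli
  construction\<close>

lemma pushU_cong:
  assumes "ultra U" "{x. f x = g x} \<in> U"
  shows "pushU f U = pushU g U"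
proof -
  have "f -` A \<in> U \<longleftrightarrow> g -` A \<in> U" for A
  proof
    assume "f -` A \<in> U"
    then have "f -` A \<inter> {x. f x = g x} \<in> U" using assms by (simp add: ultra_Int)
    then show "g -` A \<in> U" by (rule ultra_mono[OF assms(1)]) auto
  next
    assume "g -` A \<in> U"
    then have "g -` A \<inter> {x. f x = g x} \<in> U" using assms by (simp add: ultra_Int)
    then show "f -` A \<in> U" by (rule ultra_mono[OF assms(1)]) auto
  qed
  then show ?thesis by (simp add: pushU_def)
qed

lemma pushU_comp: "pushU f (pushU g U) = pushU (f \<circ> g) U"
  by (simp add: pushU_def vimage_def)

lemma pushU_id: "pushU (\<lambda>x. x) U = U"
  by (simp add: pushU_def)

definition principal :: "'a \<Rightarrow> 'a set set" where
  "principal a = {A. a \<in> A}"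

lemma ultra_principal: "ultra (principal a)"
  by (simp add: ultra_def principal_def)

lemma principal_uconv: "principal a \<odot> U = pushU (\<lambda>y. a @ y) U"
  by (simp add: principal_def uconv_def pushU_def vimage_def)

text \<open>A letter is a function on nodes, and in the application \<open>\<sigma>\<close> replaces
  each node of \<open>D\<close> by a node above it. The projection tells, from the point of view of
  \<open>D\<close>, what the word does at the chosen nodes. \<open>restrict\<close> makes letters
  that agree on \<open>D\<close> equal.\<close>

definition project :: "'b set \<Rightarrow> ('b \<Rightarrow> 'b) \<Rightarrow> ('b \<Rightarrow> 'c) list \<Rightarrow> ('b \<Rightarrow> 'c) list" where
  "project D \<sigma> = map (\<lambda>g. restrict (g \<circ> \<sigma>) D)"

lemma project_append: "project D \<sigma> (x @ y) = project D \<sigma> x @ project D \<sigma> y"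
  by (simp add: project_def)

text \<open>
  In a minimal left ideal \<open>L\<close>, every idempotent \<open>f\<close> satisfies \<open>V \<odot> f = V\<close> for all \<open>V \<in> L\<close>. The
  ultrafilter \<open>x\<close> is an idempotent of the closed semigroup of those ultrafilters that start with the
  letter \<open>\<iota>\<close> and have all projections in \<open>L\<close>; it is nonempty because of the diagonal image of any
  \<open>e \<in> L\<close> under \<open>\<rho>\<close>.
\<close>

lemma stage_ultrafilters:
  fixes \<rho> :: "'b \<Rightarrow> 'b" and \<iota> :: "'b \<Rightarrow> 'c" and D :: "'b set"
  defines "Sec \<equiv> {\<sigma>. \<forall>u\<in>D. \<rho> (\<sigma> u) = u}"
  assumes "Sec \<noteq> {}"
  shows "\<exists>V x. ultra V \<and> ultra x \<and> {z. set z \<subseteq> extensional D} \<in> V \<and>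
    {y. y \<noteq> [] \<and> hd y = \<iota>} \<in> x \<and>
    (\<forall>\<sigma>\<in>Sec. V \<odot> pushU (project D \<sigma>) x = V) \<and>
    (\<forall>\<sigma>\<in>Sec. \<forall>\<sigma>'\<in>Sec.
      pushU (project D \<sigma>) x \<odot> pushU (project D \<sigma>') x = pushU (project D \<sigma>) x)"
proof -
  define E :: "('b \<Rightarrow> 'c) list set" where "E = {z. set z \<subseteq> extensional D}"
  define B where "B = cls {E}"
  have memB: "U \<in> B \<longleftrightarrow> ultra U \<and> E \<in> U" for U by (simp add: B_def cls_def)
  have "subsemi B"
    unfolding subsemi_def
  proof (intro conjI ballI)
    show "closedU B" by (auto simp: closedU_def B_def)
    have "principal [] \<in> B" by (simp add: memB ultra_principal) (simp add: principal_def E_def)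
    then show "B \<noteq> {}" by blast
    fix U V assume UV: "U \<in> B" "V \<in> B"
    have "E \<subseteq> {x. {y. x @ y \<in> E} \<in> V}"
    proof
      fix x assume "x \<in> E"
      then have "{y. x @ y \<in> E} = E" by (auto simp: E_def)
      then show "x \<in> {x. {y. x @ y \<in> E} \<in> V}" using UV by (simp add: memB)
    qed
    then have "E \<in> U \<odot> V" unfolding uconv_def
      using UV by (simp add: memB ultra_mono[of U E])
    then show "U \<odot> V \<in> B" using UV by (simp add: memB ultra_uconv)
  qed
  then obtain L where L: "subsemi L" "L \<subseteq> B" and ideal: "\<And>U V. U \<in> B \<Longrightarrow> V \<in> L \<Longrightarrow> U \<odot> V \<in> L"
    and absorb: "\<And>V f. V \<in> L \<Longrightarrow> f \<in> L \<Longrightarrow> f \<odot> f = f \<Longrightarrow> V \<odot> f = V"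
    by (rule minimal_left_ideal) blast
  have Lu: "ultra U" "E \<in> U" if "U \<in> L" for U using L(2) that memB by auto
  obtain e where e: "e \<in> L" using L(1) by (auto simp: subsemi_def)
  define K where "K = {x. ultra x \<and> (\<forall>\<sigma>\<in>Sec. pushU (project D \<sigma>) x \<in> L)}"
  have Kcl: "closedU K"
  proof -
    have "K = \<Inter>((\<lambda>\<sigma>. {U. ultra U \<and> (-`) (project D \<sigma>) -` U \<in> L}) ` Sec)"
      using \<open>Sec \<noteq> {}\<close> unfolding K_def pushU_pull by blast
    moreover have "closedU {U. ultra U \<and> (-`) (project D \<sigma>) -` U \<in> L}" for \<sigma>
      using L(1) by (intro closedU_preimage bhom_vimage) (simp add: subsemi_def)
    ultimately show ?thesis
      using \<open>Sec \<noteq> {}\<close> by (simp only:) (rule closedU_Inter, auto)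
  qed
  define H where "H = {y. y \<noteq> [] \<and> hd y = \<iota>}"
  \<comment> \<open>The condition on projections is put on the tail because the leading letter is
    prescribed; prepending a letter stays in a left ideal. Closure of \<open>T\<close> under
    products is another use of the ideal property.\<close>
  define T where "T = {x. ultra x \<and> H \<in> x \<and> pushU tl x \<in> K}"
  have Tcl: "closedU T"
  proof -
    have "T = cls {H} \<inter> {U. ultra U \<and> (-`) tl -` U \<in> K}"
      unfolding T_def pushU_pull cls_def by auto
    moreover have "closedU (cls {H})" by (auto simp: closedU_def)
    ultimately show ?thesis by (simp only: closedU_Int closedU_preimage[OF bhom_vimage Kcl])
  qed
  have TL: "pushU (project D \<sigma>) y \<in> L" if y: "y \<in> T" and \<sigma>: "\<sigma> \<in> Sec" for y \<sigma>
  proof -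
    \<comment> \<open>Almost every word for \<open>y\<close> starts with \<open>\<iota>\<close>,
      whose projection is the fixed letter \<open>?a\<close>. So the projection of \<open>y\<close>
      is a left multiple of the projection of its tail.\<close>
    let ?a = "[restrict (\<iota> \<circ> \<sigma>) D]"
    have "pushU (project D \<sigma>) y = pushU (\<lambda>b. ?a @ project D \<sigma> (tl b)) y"
    proof (rule pushU_cong)
      have "H \<subseteq> {x. project D \<sigma> x = ?a @ project D \<sigma> (tl x)}"
      proof
        fix x assume "x \<in> H"
        then have "x = \<iota> # tl x" by (cases x) (auto simp: H_def)
        then show "x \<in> {x. project D \<sigma> x = ?a @ project D \<sigma> (tl x)}"
          by (metis (mono_tags, lifting) append_Cons append_Nil list.simps(9) mem_Collect_eq project_def)
      qed
      then show "{x. project D \<sigma> x = ?a @ project D \<sigma> (tl x)} \<in> y"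
        using y ultra_mono[of y H] by (simp add: T_def)
    qed (use y in \<open>simp add: T_def\<close>)
    also have "\<dots> = principal ?a \<odot> pushU (project D \<sigma>) (pushU tl y)"
      by (simp add: principal_uconv pushU_comp comp_def)
    finally have eq: "pushU (project D \<sigma>) y = principal ?a \<odot> pushU (project D \<sigma>) (pushU tl y)" .
    have "principal ?a \<in> B" by (simp add: memB ultra_principal) (simp add: principal_def E_def)
    then show ?thesis unfolding eq using y \<sigma> by (intro ideal) (auto simp: T_def K_def)
  qed
  have "subsemi T"
    unfolding subsemi_def
  proof (intro conjI ballI Tcl)
    \<comment> \<open>For every \<open>\<sigma>\<close> in \<open>Sec\<close> the map
      \<open>\<rho> \<circ> \<sigma>\<close> is the identity on \<open>D\<close>, so all these
      projections of the tail of \<open>?x\<close> equal \<open>e\<close> simultaneously.\<close>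
    let ?x = "pushU (\<lambda>z. \<iota> # map (\<lambda>g. g \<circ> \<rho>) z) e"
    have "pushU (project D \<sigma>) (pushU tl ?x) = e" if "\<sigma> \<in> Sec" for \<sigma>
    proof -
      have "pushU (project D \<sigma>) (pushU tl ?x) = pushU (\<lambda>z. map (\<lambda>g. restrict (g \<circ> \<rho> \<circ> \<sigma>) D) z) e"
        by (simp add: pushU_comp comp_def project_def)
      also have "\<dots> = pushU (\<lambda>z. z) e"
      proof (rule pushU_cong)
        have "E \<subseteq> {z. map (\<lambda>g. restrict (g \<circ> \<rho> \<circ> \<sigma>) D) z = z}"
        proof
          fix z assume z: "z \<in> E"
          have "restrict (g \<circ> \<rho> \<circ> \<sigma>) D = g" if "g \<in> set z" for g
          proof
            fix u
            have "g \<in> extensional D" using z that by (auto simp: E_def)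
            then show "restrict (g \<circ> \<rho> \<circ> \<sigma>) D u = g u"
              using \<open>\<sigma> \<in> Sec\<close> by (auto simp: Sec_def extensional_def restrict_def)
          qed
          then show "z \<in> {z. map (\<lambda>g. restrict (g \<circ> \<rho> \<circ> \<sigma>) D) z = z}"
            by (simp add: map_idI)
        qed
        then show "{z. map (\<lambda>g. restrict (g \<circ> \<rho> \<circ> \<sigma>) D) z = z} \<in> e"
          using Lu[OF e] ultra_mono[of e E] by simp
      qed (use Lu e in simp)
      finally show ?thesis by (simp add: pushU_id)
    qed
    then have "pushU tl ?x \<in> K" using e Lu(1)[OF e] by (simp add: K_def ultra_push)
    moreover have "H \<in> ?x" using ultra_UNIV[OF Lu(1)[OF e]] by (simp add: pushU_def H_def vimage_def)
    ultimately have "?x \<in> T" using Lu(1)[OF e] by (simp add: T_def ultra_push)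
    then show "T \<noteq> {}" by blast
    fix x y assume x: "x \<in> T" and y: "y \<in> T"
    have u: "ultra x" "ultra y" using x y by (auto simp: T_def)
    have Hx: "H \<in> x" using x by (simp add: T_def)
    have "H \<subseteq> {a. {b. a @ b \<in> H} \<in> y}"
      using ultra_UNIV[OF u(2)] by (auto simp: H_def)
    then have H: "H \<in> x \<odot> y" unfolding uconv_def using ultra_mono[OF u(1) Hx] by simp
    have "pushU tl (x \<odot> y) = pushU tl x \<odot> y"
    proof -
      have "tl -` A \<in> x \<odot> y \<longleftrightarrow> A \<in> pushU tl x \<odot> y" for A
      proof -
        have "{a. {b. a @ b \<in> tl -` A} \<in> y} \<inter> H = {a. {b. tl a @ b \<in> A} \<in> y} \<inter> H"
          by (auto simp: H_def)
        then have "{a. {b. a @ b \<in> tl -` A} \<in> y} \<in> x \<longleftrightarrow> {a. {b. tl a @ b \<in> A} \<in> y} \<in> x"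
          using Hx ultra_Int[OF u(1)] by metis
        then show ?thesis by (simp add: uconv_def pushU_def vimage_def)
      qed
      then show ?thesis by (auto simp: pushU_def)
    qed
    moreover have "pushU tl x \<odot> y \<in> K"
      unfolding K_def
    proof (intro CollectI conjI ballI)
      show "ultra (pushU tl x \<odot> y)" using u by (simp add: ultra_uconv ultra_push)
      fix \<sigma> assume \<sigma>: "\<sigma> \<in> Sec"
      have "pushU (project D \<sigma>) (pushU tl x) \<in> L" using x \<sigma> by (simp add: T_def K_def)
      then have "pushU (project D \<sigma>) (pushU tl x) \<in> B" using L(2) by blast
      then show "pushU (project D \<sigma>) (pushU tl x \<odot> y) \<in> L"
        unfolding pushU_uconv[OF project_append] using TL[OF y \<sigma>] by (rule ideal)
    qed
    ultimately show "x \<odot> y \<in> T" using u H by (simp add: T_def ultra_uconv)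
  qed
  then obtain x where x: "x \<in> T" "x \<odot> x = x" using Ellis by blast
  have idem: "pushU (project D \<sigma>) x \<odot> pushU (project D \<sigma>) x = pushU (project D \<sigma>) x" for \<sigma>
    by (simp add: pushU_uconv[OF project_append, symmetric] x(2))
  show ?thesis
  proof (rule exI[of _ e], rule exI[of _ x], intro conjI ballI)
    show "ultra e" using Lu(1)[OF e] .
    show "{z. set z \<subseteq> extensional D} \<in> e" using Lu(2)[OF e] by (simp add: E_def)
    show "ultra x" "{y. y \<noteq> [] \<and> hd y = \<iota>} \<in> x" using x(1) by (auto simp: T_def H_def)
    show "e \<odot> pushU (project D \<sigma>) x = e" if "\<sigma> \<in> Sec" for \<sigma>
      using absorb[OF e TL[OF x(1) that] idem] .
    show "pushU (project D \<sigma>) x \<odot> pushU (project D \<sigma>') x = pushU (project D \<sigma>) x"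
      if "\<sigma> \<in> Sec" "\<sigma>' \<in> Sec" for \<sigma> \<sigma>'
      using absorb[OF TL[OF x(1) that(1)] TL[OF x(1) that(2)] idem] .
  qed
qed

section \<open>Strong embeddings of trees of words\<close>

definition lev :: "nat \<Rightarrow> nat \<Rightarrow> nat list set" where
  "lev d l = {u \<in> tree d. length u = l}"

text \<open>The level-preserving embeddings of Milliken's theorem. Words of length exactly
  \<open>m\<close> may already be lengthened. The first two conditions range over all lists, so that
  lengths and passing letters can be computed without checking membership in the tree.\<close>

definition semb :: "nat \<Rightarrow> nat \<Rightarrow> (nat list \<Rightarrow> nat list) \<Rightarrow> bool" where
  "semb d m k \<longleftrightarrow> (\<forall>u a. prefix (k u @ [a]) (k (u @ [a]))) \<and>
     (\<forall>u v. length u = length v \<longrightarrow> length (k u) = length (k v)) \<and>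
     (\<forall>u\<in>tree d. k u \<in> tree d) \<and> (\<forall>u. length u < m \<longrightarrow> k u = u)"

lemma tree_append [simp]: "u @ v \<in> tree d \<longleftrightarrow> u \<in> tree d \<and> v \<in> tree d"
  by (auto simp: tree_def)

lemma tree_Cons [simp]: "a # v \<in> tree d \<longleftrightarrow> a < d \<and> v \<in> tree d"
  by (auto simp: tree_def)

lemma tree_Nil [simp]: "[] \<in> tree d"
  by (simp add: tree_def)

lemma tree_prefix: "v \<in> tree d \<Longrightarrow> prefix u v \<Longrightarrow> u \<in> tree d"
  by (auto simp: prefix_def)

lemma tree_take: "v \<in> tree d \<Longrightarrow> take n v \<in> tree d"
  using tree_prefix take_is_prefix by blast

lemma tree_drop: "v \<in> tree d \<Longrightarrow> drop n v \<in> tree d"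
  by (metis append_take_drop_id tree_append)

lemma tree_nth: "v \<in> tree d \<Longrightarrow> i < length v \<Longrightarrow> v ! i < d"
  by (force simp: tree_def)

lemma tree_replicate [simp]: "a < d \<Longrightarrow> replicate n a \<in> tree d"
  by (auto simp: tree_def)

lemma finite_lev: "finite (lev d l)"
proof -
  have "lev d l = {u. set u \<subseteq> {..<d} \<and> length u = l}" by (auto simp: lev_def tree_def)
  then show ?thesis using finite_lists_length_eq[of "{..<d}" l] by simp
qed

lemma semb_id: "semb d m (\<lambda>u. u)"
  by (simp add: semb_def)

lemma semb_mono: "semb d m k \<Longrightarrow> m' \<le> m \<Longrightarrow> semb d m' k"
  unfolding semb_def by (metis less_le_trans)

lemma semb_tree: "semb d m k \<Longrightarrow> u \<in> tree d \<Longrightarrow> k u \<in> tree d"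
  by (simp add: semb_def)

lemma semb_fix: "semb d m k \<Longrightarrow> length u < m \<Longrightarrow> k u = u"
  by (simp add: semb_def)

lemma semb_length_cong: "semb d m k \<Longrightarrow> length u = length v \<Longrightarrow> length (k u) = length (k v)"
  unfolding semb_def by metis

lemma semb_step: "semb d m k \<Longrightarrow> prefix (k u @ [a]) (k (u @ [a]))"
  by (simp add: semb_def)

lemma semb_prefix:
  assumes "semb d m k" "prefix u v"
  shows "prefix (k u) (k v)"
proof -
  have "prefix (k u) (k (u @ w))" for w
  proof (induction w rule: rev_induct)
    case (snoc a w)
    have "prefix (k (u @ w)) (k (u @ w @ [a]))"
      using semb_step[OF assms(1), of "u @ w" a] by (auto dest: append_prefixD)
    then show ?case using snoc by (rule prefix_order.trans[rotated])
  qed simp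
  then show ?thesis using assms(2) by (auto simp: prefix_def)
qed

text \<open>Here \<open>u\<close> need not be an initial segment of \<open>v\<close>: its image is
  as long as the image of the initial segment of \<open>v\<close> on the same level. So passing
  letters between arbitrary words survive.\<close>

lemma semb_passing:
  assumes k: "semb d m k" and "length u < length v"
  shows "length (k u) < length (k v)" "k v ! length (k u) = v ! length u"
    "prefix (k (take (length u) v) @ [v ! length u]) (k v)"
proof -
  let ?p = "take (length u) v"
  have "prefix (k ?p @ [v ! length u]) (k (?p @ [v ! length u]))" by (rule semb_step[OF k])
  moreover have "prefix (k (?p @ [v ! length u])) (k v)"
    using assms(2) by (intro semb_prefix[OF k])
      (metis take_Suc_conv_app_nth take_is_prefix)
  ultimately show p: "prefix (k ?p @ [v ! length u]) (k v)" by (rule prefix_order.trans)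
  moreover have len: "length (k ?p) = length (k u)"
    using assms(2) by (intro semb_length_cong[OF k]) simp
  ultimately show "length (k u) < length (k v)" "k v ! length (k u) = v ! length u"
    by (auto simp: prefix_def nth_append)
qed

lemma semb_length_le: "semb d m k \<Longrightarrow> length u \<le> length v \<Longrightarrow> length (k u) \<le> length (k v)"
  using semb_passing(1)[of d m k u v] semb_length_cong[of d m k u v]
  by (cases "length u = length v") (auto simp: less_imp_le)

lemma semb_length_less_iff: "semb d m k \<Longrightarrow> length (k u) < length (k v) \<longleftrightarrow> length u < length v"
  using semb_passing(1)[of d m k u v] semb_length_le[of d m k v u] by fastforce

lemma semb_length_ge: "semb d m k \<Longrightarrow> length u \<le> length (k u)"
proof (induction u rule: rev_induct)
  case (snoc a u)
  then show ?case using semb_passing(1)[of d m k u "u @ [a]"] by fastforce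
qed simp

lemma semb_comp:
  assumes f: "semb d m f" and g: "semb d m g"
  shows "semb d m (\<lambda>u. f (g u))"
  unfolding semb_def
proof (intro conjI allI ballI impI)
  fix u a
  have "prefix (f (g u) @ [a]) (f (g u @ [a]))" by (rule semb_step[OF f])
  then show "prefix (f (g u) @ [a]) (f (g (u @ [a])))"
    using semb_prefix[OF f semb_step[OF g, of u a]] by (rule prefix_order.trans)
next
  fix u v :: "nat list" assume "length u = length v"
  then show "length (f (g u)) = length (f (g v))"
    by (intro semb_length_cong[OF f] semb_length_cong[OF g])
next
  fix u assume "u \<in> tree d"
  then show "f (g u) \<in> tree d" by (intro semb_tree[OF f] semb_tree[OF g])
next
  fix u :: "nat list" assume "length u < m"
  then show "f (g u) = u" using semb_fix[OF f] semb_fix[OF g] by simp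
qed

lemma semb_comp_le:
  assumes "semb d m f" "semb d m' g" "m \<le> m'"
  shows "semb d m (\<lambda>u. f (g u))"
  using assms semb_comp semb_mono by blast

text \<open>The initial segment of length \<open>m - 1\<close> is fixed, and the letter that follows
  it is preserved.\<close>

lemma semb_take:
  assumes k: "semb d m k" and "m \<le> length u"
  shows "take m (k u) = take m u"
proof (cases m)
  case (Suc n)
  then have n: "length (take n u) < length u" "length (take n u) = n" using assms by auto
  have "prefix (k (take n u) @ [u ! n]) (k u)"
    using semb_passing(3)[OF k n(1)] n by simp
  moreover have "k (take n u) = take n u" using semb_fix[OF k] Suc n by simp
  moreover have "take n u @ [u ! n] = take m u" using Suc assms(2) by (simp add: take_Suc_conv_app_nth)
  ultimately have "prefix (take m u) (k u)" by simp
  then show ?thesis using assms(2) by (auto simp: prefix_def)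
qed simp

lemma semb_inj:
  assumes k: "semb d m k"
  shows "inj k"
proof (rule injI)
  fix u v assume eq: "k u = k v"
  have len: "length u = length v"
    using semb_length_less_iff[OF k, of u v] semb_length_less_iff[OF k, of v u] eq by simp
  show "u = v"
  proof (rule nth_equalityI[OF len])
    fix i assume i: "i < length u"
    have "k u ! length (k (take i u)) = u ! i" using semb_passing(2)[OF k, of "take i u" u] i by simp
    moreover have "k v ! length (k (take i u)) = v ! i"
      using semb_passing(2)[OF k, of "take i u" v] i len by simp
    ultimately show "u ! i = v ! i" using eq by simp
  qed
qed

section \<open>The Halpern--Lauchli theorem\<close>

text \<open>
  A list of functions encodes, for all \<open>u\<close> at once, a word of the same length; the reduction
  \<open>mod d\<close> keeps the letters below \<open>d\<close>.
\<close>

definition evw :: "nat \<Rightarrow> nat list \<Rightarrow> (nat list \<Rightarrow> nat) list \<Rightarrow> nat list" where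
  "evw d u z = map (\<lambda>g. g u mod d) z"

lemma length_evw [simp]: "length (evw d u z) = length z"
  by (simp add: evw_def)

lemma evw_tree: "0 < d \<Longrightarrow> evw d u z \<in> tree d"
  by (auto simp: evw_def tree_def)

text \<open>The simplest embedding with a prescribed effect on level \<open>m\<close>: every node of
  the level is lengthened by its own reading of \<open>z\<close>, and all later letters are
  copied.\<close>

definition insert_word :: "nat \<Rightarrow> nat \<Rightarrow> (nat list \<Rightarrow> nat) list \<Rightarrow> nat list \<Rightarrow> nat list" where
  "insert_word d m z u =
    (if length u < m then u else take m u @ evw d (take m u) z @ drop m u)"

lemma semb_insert_word:
  assumes "0 < d"
  shows "semb d m (insert_word d m z)"
  unfolding semb_def
proof (intro conjI allI ballI impI)
  fix u a
  show "prefix (insert_word d m z u @ [a]) (insert_word d m z (u @ [a]))"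
    by (cases "length u + 1 = m") (auto simp: insert_word_def)
next
  fix u v :: "nat list"
  assume "length u = length v"
  then show "length (insert_word d m z u) = length (insert_word d m z v)"
    by (simp add: insert_word_def)
next
  fix u assume "u \<in> tree d"
  then show "insert_word d m z u \<in> tree d"
    using assms by (simp add: insert_word_def evw_tree tree_take tree_drop)
qed (simp add: insert_word_def)

text \<open>One node above each node of level \<open>m\<close>, all on one level: restrictions of
  strong embeddings to level \<open>m\<close> are of this kind. There are finitely many, so
  ultrafilters can treat all of them at once.\<close>

definition sections :: "nat \<Rightarrow> nat \<Rightarrow> nat \<Rightarrow> (nat list \<Rightarrow> nat list) set" where
  "sections d m n = PiE (lev d m) (\<lambda>u. {v \<in> lev d (m + n). take m v = u})"

lemma finite_sections: "finite (sections d m n)"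
  unfolding sections_def by (intro finite_PiE finite_lev) (simp add: finite_lev)

lemma sections_take: "\<sigma> \<in> sections d m n \<Longrightarrow> u \<in> lev d m \<Longrightarrow> take m (\<sigma> u) = u"
  by (auto simp: sections_def dest!: PiE_mem)

lemma sections_0: "\<sigma> \<in> sections d m 0 \<Longrightarrow> u \<in> lev d m \<Longrightarrow> \<sigma> u = u"
  by (auto simp: sections_def lev_def dest!: PiE_mem)

lemma sections_butlast:
  assumes "\<sigma> \<in> sections d m (Suc n)"
  shows "restrict (butlast \<circ> \<sigma>) (lev d m) \<in> sections d m n"
  unfolding sections_def
proof (rule restrict_PiE_iff[THEN iffD2], rule ballI)
  fix u assume u: "u \<in> lev d m"
  then have v: "\<sigma> u \<in> lev d (m + Suc n)" "take m (\<sigma> u) = u"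
    using assms by (auto simp: sections_def dest!: PiE_mem)
  then have "butlast (\<sigma> u) = take (m + n) (\<sigma> u)" by (simp add: butlast_conv_take lev_def)
  then show "(butlast \<circ> \<sigma>) u \<in> {v \<in> lev d (m + n). take m v = u}"
    using v by (auto simp: lev_def tree_take min_def)
qed

lemma project_butlast:
  "project D \<sigma> (map (\<lambda>g. g \<circ> butlast) W) = project D (restrict (butlast \<circ> \<sigma>) D) W"
  by (auto simp: project_def restrict_def fun_eq_iff)

lemma project_sections_0:
  assumes "\<sigma> \<in> sections d m 0" "set W \<subseteq> extensional (lev d m)"
  shows "project (lev d m) \<sigma> W = W"
  unfolding project_def
proof (rule map_idI)
  fix g assume "g \<in> set W"
  then have "g \<in> extensional (lev d m)" using assms(2) by blast
  then show "restrict (g \<circ> \<sigma>) (lev d m) = g"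
    using sections_0[OF assms(1)] by (auto simp: restrict_def fun_eq_iff extensional_def)
qed

text \<open>The words \<open>W n\<close> are a strong embedding under construction. Read at a node
  of level \<open>m + n\<close>, the letters composed with \<open>butlast\<close> repeat what the
  parent received, \<open>last\<close> is the passing letter of the node, and \<open>Y n\<close> is
  filler supplied by \<open>x\<close>.\<close>

lemma Halpern_Lauchli_words:
  fixes m d :: nat and A :: "(nat list \<Rightarrow> nat) list set" and V x
  defines "D \<equiv> lev d m"
  assumes uV: "ultra V" and ux: "ultra x" and E: "{z. set z \<subseteq> extensional D} \<in> V"
    and H: "{y. y \<noteq> [] \<and> hd y = last} \<in> x" and A: "A \<in> V"
    and Vx: "\<And>\<sigma> n. \<sigma> \<in> sections d m n \<Longrightarrow> V \<odot> pushU (project D \<sigma>) x = V"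
    and xx: "\<And>\<sigma> \<sigma>' n n'. \<sigma> \<in> sections d m n \<Longrightarrow> \<sigma>' \<in> sections d m n' \<Longrightarrow>
      pushU (project D \<sigma>) x \<odot> pushU (project D \<sigma>') x = pushU (project D \<sigma>) x"
  shows "\<exists>W Y. (\<forall>n. \<forall>\<sigma>\<in>sections d m n. project D \<sigma> (W n) \<in> A) \<and>
    (\<forall>n. W (Suc n) = map (\<lambda>g. g \<circ> butlast) (W n) @ last # Y n)"
proof -
  define bl where "bl \<sigma> = restrict (butlast \<circ> \<sigma>) D" for \<sigma> :: "nat list \<Rightarrow> nat list"
  have bl: "bl \<sigma> \<in> sections d m n" if "\<sigma> \<in> sections d m (Suc n)" for \<sigma> n
    using sections_butlast[OF that] by (simp add: bl_def D_def)
  define good where "good n W \<longleftrightarrow> (\<forall>\<sigma>\<in>sections d m n. project D \<sigma> W \<in> A) \<and>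
    (\<forall>\<sigma>\<in>sections d m (Suc n). {y. project D (bl \<sigma>) W @ project D \<sigma> y \<in> A} \<in> x)" for n W
  \<comment> \<open>The second part of \<open>good\<close> says that almost every next step stays in \<open>A\<close>. As the projections of
    \<open>x\<close> absorb each other, almost every next step preserves it.\<close>
  have conv: "{z. {y. z @ project D \<sigma> y \<in> B} \<in> x} \<in> U \<longleftrightarrow> B \<in> U \<odot> pushU (project D \<sigma>) x"
    for \<sigma> B U by (simp add: uconv_def pushU_def vimage_def)
  have base: "\<exists>W. good 0 W"
  proof -
    \<comment> \<open>As \<open>A\<close> is in \<open>V\<close> and \<open>V\<close> absorbs the
      projections of \<open>x\<close>, \<open>V\<close>-almost every word stays in \<open>A\<close>
      after \<open>x\<close>-almost every step.\<close>
    have "{z. \<forall>\<sigma>\<in>sections d m (Suc 0). {y. z @ project D \<sigma> y \<in> A} \<in> x} \<in> V"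
      unfolding ultra_finite_Ball[OF uV finite_sections] conv using Vx A by simp
    then have "{z. \<forall>\<sigma>\<in>sections d m (Suc 0). {y. z @ project D \<sigma> y \<in> A} \<in> x}
        \<inter> (A \<inter> {z. set z \<subseteq> extensional D}) \<in> V"
      using E A by (simp add: ultra_Int[OF uV])
    from ultra_nonempty[OF uV this]
    obtain W where W: "\<forall>\<sigma>\<in>sections d m (Suc 0). {y. W @ project D \<sigma> y \<in> A} \<in> x"
      "W \<in> A" "set W \<subseteq> extensional D"
      by (elim exE IntE CollectE)
    have "good 0 W"
      unfolding good_def
    proof (intro conjI ballI)
      fix \<sigma> assume "\<sigma> \<in> sections d m 0"
      then show "project D \<sigma> W \<in> A" using project_sections_0[of \<sigma> d m W] W by (simp add: D_def)
    next
      fix \<sigma> assume \<sigma>: "\<sigma> \<in> sections d m (Suc 0)"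
      then have "project D (bl \<sigma>) W = W" using project_sections_0[OF bl[OF \<sigma>], of W] W by (simp add: D_def)
      then show "{y. project D (bl \<sigma>) W @ project D \<sigma> y \<in> A} \<in> x" using W(1) \<sigma> by simp
    qed
    then show ?thesis by blast
  qed
  have step: "\<exists>y. good (Suc n) (map (\<lambda>g. g \<circ> butlast) W @ last # y)" if W: "good n W" for n W
  proof -
    let ?W = "map (\<lambda>g. g \<circ> butlast) W"
    have proj: "project D \<sigma> (?W @ y) = project D (bl \<sigma>) W @ project D \<sigma> y" for \<sigma> y
      by (simp add: project_append project_butlast bl_def)
    have 1: "{y. \<forall>\<sigma>\<in>sections d m (Suc n). project D \<sigma> (?W @ y) \<in> A} \<in> x"
      unfolding ultra_finite_Ball[OF ux finite_sections] proj using W by (simp add: good_def)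
    have 2: "{y. \<forall>\<sigma>\<in>sections d m (Suc (Suc n)).
        {y'. project D (bl \<sigma>) (?W @ y) @ project D \<sigma> y' \<in> A} \<in> x} \<in> x"
      unfolding ultra_finite_Ball[OF ux finite_sections]
    proof
      fix \<sigma> assume \<sigma>: "\<sigma> \<in> sections d m (Suc (Suc n))"
      let ?w = "project D (bl (bl \<sigma>)) W" and ?f = "\<lambda>\<sigma>. pushU (project D \<sigma>) x"
      have "{y. ?w @ project D (bl \<sigma>) y \<in> A} \<in> x" using W bl[OF \<sigma>] by (simp add: good_def)
      then have "{z. ?w @ z \<in> A} \<in> ?f (bl \<sigma>)" by (simp add: pushU_def vimage_def)
      \<comment> \<open>The earlier step is read along \<open>bl \<sigma>\<close> and the later one
        along \<open>\<sigma>\<close>; idempotence alone would not cover two different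
        sections.\<close>
      then have "{z. ?w @ z \<in> A} \<in> ?f (bl \<sigma>) \<odot> ?f \<sigma>" using xx[OF bl[OF \<sigma>] \<sigma>] by simp
      then show "{y. {y'. project D (bl \<sigma>) (?W @ y) @ project D \<sigma> y' \<in> A} \<in> x} \<in> x"
        unfolding conv[symmetric] proj by (simp add: pushU_def vimage_def)
    qed
    have "{y. \<forall>\<sigma>\<in>sections d m (Suc n). project D \<sigma> (?W @ y) \<in> A}
      \<inter> ({y. \<forall>\<sigma>\<in>sections d m (Suc (Suc n)).
        {y'. project D (bl \<sigma>) (?W @ y) @ project D \<sigma> y' \<in> A} \<in> x}
      \<inter> {y. y \<noteq> [] \<and> hd y = last}) \<in> x"
      using 1 2 H by (simp only: ultra_Int[OF ux])
    from ultra_nonempty[OF ux this]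
    obtain y where y: "\<forall>\<sigma>\<in>sections d m (Suc n). project D \<sigma> (?W @ y) \<in> A"
      "\<forall>\<sigma>\<in>sections d m (Suc (Suc n)). {y'. project D (bl \<sigma>) (?W @ y) @ project D \<sigma> y' \<in> A} \<in> x"
      "y \<noteq> []" "hd y = last"
      by (elim exE IntE CollectE conjE)
    have "y = last # tl y" using y(3,4) by (cases y) auto
    then show ?thesis using y(1,2) unfolding good_def by metis
  qed
  obtain W where W: "\<And>n. good n (W n)"
    "\<And>n. \<exists>y. W (Suc n) = map (\<lambda>g. g \<circ> butlast) (W n) @ last # y"
    using dependent_nat_choice[of good "\<lambda>n W W'. \<exists>y. W' = map (\<lambda>g. g \<circ> butlast) W @ last # y"]
      base step by metis
  then obtain Y where "\<And>n. W (Suc n) = map (\<lambda>g. g \<circ> butlast) (W n) @ last # Y n" by metis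
  moreover have "\<forall>\<sigma>\<in>sections d m n. project D \<sigma> (W n) \<in> A" for n
    using W(1)[of n] by (simp add: good_def)
  ultimately show ?thesis by (intro exI[of _ W] exI[of _ Y]) simp
qed

lemma Halpern_Lauchli_limit:
  fixes W :: "nat \<Rightarrow> (nat list \<Rightarrow> nat) list"
  assumes "0 < d" and W: "\<And>n. W (Suc n) = map (\<lambda>g. g \<circ> butlast) (W n) @ last # Y n"
  shows "\<exists>k. semb d m k \<and> (\<forall>n. \<forall>u\<in>lev d (m + n). k u = take m u @ evw d u (W n))"
proof -
  \<comment> \<open>The symbol \<open>u ! (m + n)\<close> itself is inserted, not the reading of
    \<open>last\<close>, which is reduced modulo \<open>d\<close>: passing letters must be kept for
    all lists. On nodes of the tree the two agree.\<close>
  define t where "t u = rec_nat (take m u @ evw d (take m u) (W 0))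
    (\<lambda>n r. r @ [u ! (m + n)] @ evw d (take (m + Suc n) u) (Y n))" for u
  have t0: "t u 0 = take m u @ evw d (take m u) (W 0)"
    and tS: "t u (Suc n) = t u n @ [u ! (m + n)] @ evw d (take (m + Suc n) u) (Y n)" for u n
    by (simp_all add: t_def)
  define k where "k u = (if length u < m then u else t u (length u - m))" for u
  have t_append: "t (u @ w) n = t u n" if "m + n \<le> length u" for u w n
    using that by (induction n) (simp_all add: t0 tS nth_append)
  have t_length: "length (t u n) = length (t v n)" if "m \<le> length u" "m \<le> length v" for u v n
    using that by (induction n) (simp_all add: t0 tS)
  have t_tree: "t u n \<in> tree d" if "u \<in> tree d" "m + n \<le> length u" for u n
    using that assms(1) by (induction n) (simp_all add: t0 tS evw_tree tree_take tree_nth)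
  have "semb d m k"
    unfolding semb_def
  proof (intro conjI allI ballI impI)
    fix u a
    show "prefix (k u @ [a]) (k (u @ [a]))"
    proof (cases "length u < m")
      case True
      then show ?thesis by (cases "length (u @ [a]) < m") (auto simp: k_def t0)
    next
      case False
      then have "k (u @ [a]) = t (u @ [a]) (Suc (length u - m))"
        by (simp add: k_def Suc_diff_le)
      then show ?thesis using False by (simp add: k_def tS t_append)
    qed
  next
    fix u v :: "nat list" assume "length u = length v"
    then show "length (k u) = length (k v)" using t_length[of u v] by (simp add: k_def)
  next
    fix u assume "u \<in> tree d"
    then show "k u \<in> tree d" using t_tree[of u "length u - m"] by (simp add: k_def)
  qed (simp add: k_def)
  moreover have "k u = take m u @ evw d u (W n)" if u: "u \<in> lev d (m + n)" for u n
  proof -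
    have "t u i = take m u @ evw d (take (m + i) u) (W i)" if "i \<le> n" for i
      using that
    proof (induction i)
      case (Suc i)
      let ?v = "take (m + Suc i) u"
      have len: "length u = m + n" "u \<in> tree d" using u by (auto simp: lev_def)
      then have v: "?v = take (m + i) u @ [u ! (m + i)]"
        using Suc.prems by (simp add: take_Suc_conv_app_nth)
      have "u ! (m + i) < d" using tree_nth[OF len(2)] len(1) Suc.prems by simp
      then have "evw d ?v (W (Suc i)) = evw d (take (m + i) u) (W i) @ (u ! (m + i)) # evw d ?v (Y i)"
        unfolding W v by (simp add: evw_def)
      then show ?case using Suc by (simp add: tS)
    qed (simp add: t0)
    then show ?thesis using u by (simp add: k_def lev_def)
  qed
  ultimately show ?thesis by blast
qed

text \<open>By \<open>dep\<close> only the choice of one node above each of the \<open>d ^ m\<close>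
  nodes of level \<open>m\<close> is coloured, all chosen on a common level. These nodes are the
  roots of the finitely many trees in the usual formulation.\<close>

theorem Halpern_Lauchli:
  fixes c :: "(nat list \<Rightarrow> nat list) \<Rightarrow> 'c"
  assumes d: "0 < d" and fin: "finite (c ` {k. semb d m k})"
    and dep: "\<And>k k'. semb d m k \<Longrightarrow> semb d m k' \<Longrightarrow> (\<forall>u\<in>lev d m. k u = k' u) \<Longrightarrow> c k = c k'"
  shows "\<exists>k0. semb d m k0 \<and> (\<forall>k. semb d m k \<longrightarrow> c (\<lambda>u. k0 (k u)) = c k0)"
proof -
  let ?D = "lev d m" and ?E = "{z. set z \<subseteq> extensional (lev d m)} :: (nat list \<Rightarrow> nat) list set"
  have "(\<lambda>u. u) \<in> {\<sigma>. \<forall>u\<in>?D. take m (\<sigma> u) = u}" by (simp add: lev_def)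
  then have "{\<sigma>. \<forall>u\<in>?D. take m (\<sigma> u) = u} \<noteq> {}" by (metis ex_in_conv)
  from stage_ultrafilters[OF this, where \<iota> = last] obtain V x where Vx:
    "ultra V" "ultra x" "?E \<in> V" "{y. y \<noteq> [] \<and> hd y = last} \<in> x"
    "\<forall>\<sigma>\<in>{\<sigma>. \<forall>u\<in>?D. take m (\<sigma> u) = u}. V \<odot> pushU (project ?D \<sigma>) x = V"
    "\<forall>\<sigma>\<in>{\<sigma>. \<forall>u\<in>?D. take m (\<sigma> u) = u}. \<forall>\<sigma>'\<in>{\<sigma>. \<forall>u\<in>?D. take m (\<sigma> u) = u}.
      pushU (project ?D \<sigma>) x \<odot> pushU (project ?D \<sigma>') x = pushU (project ?D \<sigma>) x"
    by (elim exE conjE)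
  have "finite ((\<lambda>z. c (insert_word d m z)) ` ?E)"
    by (rule finite_subset[OF _ fin]) (use semb_insert_word[OF d] in blast)
  from ultra_finite_range[OF Vx(1) this Vx(3)]
  obtain j where "{z \<in> ?E. c (insert_word d m z) = j} \<in> V" by (elim exE)
  then have A: "{z. c (insert_word d m z) = j} \<in> V"
    by (rule ultra_mono[OF Vx(1)]) auto
  have Sec: "\<sigma> \<in> {\<sigma>. \<forall>u\<in>?D. take m (\<sigma> u) = u}" if "\<sigma> \<in> sections d m n" for \<sigma> n
    using sections_take[OF that] by simp
  have "\<exists>W Y. (\<forall>n. \<forall>\<sigma>\<in>sections d m n. project ?D \<sigma> (W n) \<in> {z. c (insert_word d m z) = j}) \<and>
    (\<forall>n. W (Suc n) = map (\<lambda>g. g \<circ> butlast) (W n) @ last # Y n)"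
  proof (rule Halpern_Lauchli_words[OF Vx(1-4) A])
    show "V \<odot> pushU (project ?D \<sigma>) x = V" if "\<sigma> \<in> sections d m n" for \<sigma> n
      using bspec[OF Vx(5) Sec[OF that]] .
    show "pushU (project ?D \<sigma>) x \<odot> pushU (project ?D \<sigma>') x = pushU (project ?D \<sigma>) x"
      if "\<sigma> \<in> sections d m n" "\<sigma>' \<in> sections d m n'" for \<sigma> \<sigma>' n n'
      using bspec[OF bspec[OF Vx(6) Sec[OF that(1)]] Sec[OF that(2)]] .
  qed
  then obtain W Y where W:
    "\<forall>n. \<forall>\<sigma>\<in>sections d m n. project ?D \<sigma> (W n) \<in> {z. c (insert_word d m z) = j}"
    "\<forall>n. W (Suc n) = map (\<lambda>g. g \<circ> butlast) (W n) @ last # Y n"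
    by (elim exE conjE)
  obtain k0 where k0: "semb d m k0"
    "\<forall>n. \<forall>u\<in>lev d (m + n). k0 u = take m u @ evw d u (W n)"
    using Halpern_Lauchli_limit[of d W Y m, OF d W(2)[rule_format]] by (elim exE conjE)
  have *: "c (\<lambda>u. k0 (k u)) = j" if k: "semb d m k" for k
  proof -
    \<comment> \<open>The word \<open>replicate m 0\<close> represents level \<open>m\<close>, which
      \<open>k\<close> sends to level \<open>m + n\<close>.\<close>
    define n where "n = length (k (replicate m 0)) - m"
    have kD: "k u \<in> lev d (m + n) \<and> take m (k u) = u" if u: "u \<in> ?D" for u
    proof -
      have "length u = m" "u \<in> tree d" using u by (auto simp: lev_def)
      moreover have "length (k u) = length (k (replicate m 0))"
        using u by (intro semb_length_cong[OF k]) (simp add: lev_def)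
      moreover have "m \<le> length (k (replicate m 0))"
        using semb_length_ge[OF k, of "replicate m 0"] by simp
      ultimately show ?thesis
        using semb_take[OF k, of u] semb_tree[OF k, of u] by (auto simp: lev_def n_def)
    qed
    have "restrict k ?D \<in> sections d m n"
      unfolding sections_def by (rule restrict_PiE_iff[THEN iffD2]) (use kD in auto)
    then have "c (insert_word d m (project ?D (restrict k ?D) (W n))) = j" using W(1) by blast
    \<comment> \<open>On level \<open>m\<close> the composite sees \<open>W n\<close> only at the
      nodes picked by \<open>k\<close>; this is the insertion of the projection of
      \<open>W n\<close> along the restricted \<open>k\<close>.\<close>
    moreover have "c (\<lambda>u. k0 (k u)) = c (insert_word d m (project ?D (restrict k ?D) (W n)))"
    proof (rule dep[OF semb_comp[OF k0(1) k] semb_insert_word[OF d]], rule ballI)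
      fix u assume u: "u \<in> ?D"
      have "k0 (k u) = take m (k u) @ evw d (k u) (W n)" using k0(2) kD[OF u] by blast
      also have "\<dots> = u @ map (\<lambda>g. g (k u) mod d) (W n)" using kD[OF u] by (simp add: evw_def)
      also have "\<dots> = insert_word d m (project ?D (restrict k ?D) (W n)) u"
        using u by (simp add: insert_word_def evw_def project_def lev_def)
      finally show "k0 (k u) = insert_word d m (project ?D (restrict k ?D) (W n)) u" .
    qed
    ultimately show ?thesis by simp
  qed
  show ?thesis using *[OF semb_id] * k0(1) by auto
qed

section \<open>Milliken's theorem\<close>

text \<open>The infinite composite of the improvements \<open>q i\<close> makes sense because
  \<open>q i\<close> fixes all words shorter than \<open>m + i\<close>, so that at a given word all
  but finitely many factors act trivially. The limit is \<open>G (Suc i)\<close> applied after an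
  embedding that fixes all words up to length \<open>m + i\<close>; hence \<open>pres\<close>
  carries \<open>Q (m + i)\<close> over to it.\<close>

lemma fusion:
  assumes step: "\<And>n g. m \<le> n \<Longrightarrow> semb d m g \<Longrightarrow> \<exists>q. semb d n q \<and> Q n (\<lambda>u. g (q u))"
    and pres: "\<And>n g r. m \<le> n \<Longrightarrow> semb d m g \<Longrightarrow> Q n g \<Longrightarrow> semb d (Suc n) r \<Longrightarrow> Q n (\<lambda>u. g (r u))"
  shows "\<exists>g. semb d m g \<and> (\<forall>n\<ge>m. Q n g)"
proof -
  obtain qq where qq: "\<And>n g. m \<le> n \<Longrightarrow> semb d m g \<Longrightarrow> semb d n (qq n g) \<and> Q n (\<lambda>u. g (qq n g u))"
    using step by metis
  define G where "G = rec_nat (\<lambda>u. u) (\<lambda>i g u. g (qq (m + i) g u))"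
  define q where "q i = qq (m + i) (G i)" for i
  have G0: "G 0 = (\<lambda>u. u)" and GS: "G (Suc i) = (\<lambda>u. G i (q i u))" for i
    by (simp_all add: G_def q_def)
  have qq1: "semb d (m + i) (qq (m + i) g)" and qq2: "Q (m + i) (\<lambda>u. g (qq (m + i) g u))"
    if "semb d m g" for i g using qq[OF _ that, of "m + i"] by simp_all
  have G: "semb d m (G i)" for i
  proof (induction i)
    case (Suc i)
    have "semb d (m + i) (q i)" unfolding q_def by (rule qq1[OF Suc])
    then show ?case unfolding GS by (rule semb_comp_le[OF Suc]) simp
  qed (simp add: G0 semb_id)
  have q: "semb d (m + i) (q i)" "Q (m + i) (G (Suc i))" for i
    unfolding GS unfolding q_def using qq1[OF G] qq2[OF G] by simp_all
  define C where "C i = rec_nat (\<lambda>u. u) (\<lambda>j f u. f (q (i + j) u))" for i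
  have C0: "C i 0 = (\<lambda>u. u)" and CS: "C i (Suc j) = (\<lambda>u. C i j (q (i + j) u))" for i j
    by (simp_all add: C_def)
  have C: "semb d (m + i) (C i j)" for i j
  proof (induction j)
    case (Suc j)
    then show ?case unfolding CS by (rule semb_comp_le[OF _ q(1)]) simp
  qed (simp add: C0 semb_id)
  have C_add: "C i (a + b) u = C i a (C (i + a) b u)" for i a b u
    by (induction b arbitrary: u) (simp_all add: C0 CS add.assoc)
  have CG: "C 0 i = G i" for i
    by (induction i) (simp_all add: C0 CS G0 GS)
  \<comment> \<open>The factor \<open>q (i + j)\<close> fixes \<open>u\<close> as soon as
    \<open>length u < j\<close>; so \<open>Suc (length u)\<close> factors determine the limit at
    \<open>u\<close>.\<close>
  define r where "r i u = C i (Suc (length u)) u" for i u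
  have C_stable: "C i j u = r i u" if "length u < j" for i j u
    using that
  proof (induction j)
    case (Suc j)
    show ?case
    proof (cases "length u = j")
      case False
      then have "q (i + j) u = u" using Suc.prems by (intro semb_fix[OF q(1)]) simp
      then show ?thesis using Suc False by (simp add: CS)
    qed (simp add: r_def)
  qed simp
  have r: "semb d (m + i) (r i)" for i
    unfolding semb_def
  proof (intro conjI allI ballI impI)
    fix u a
    show "prefix (r i u @ [a]) (r i (u @ [a]))"
      using semb_step[OF C, of i "Suc (Suc (length u))" u a]
      by (simp add: C_stable)
  next
    fix u v :: "nat list" assume len: "length u = length v"
    show "length (r i u) = length (r i v)"
      unfolding r_def len by (rule semb_length_cong[OF C len])
  next
    fix u assume "u \<in> tree d"
    then show "r i u \<in> tree d" unfolding r_def by (rule semb_tree[OF C])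
  next
    fix u :: "nat list" assume "length u < m + i"
    then show "r i u = u" unfolding r_def by (rule semb_fix[OF C])
  qed
  have decomp: "r 0 = (\<lambda>u. G (Suc i) (r (Suc i) u))" for i
  proof
    fix u
    have "r 0 u = C 0 (Suc i + Suc (length u)) u" by (rule C_stable[symmetric]) simp
    then show "r 0 u = G (Suc i) (r (Suc i) u)"
      unfolding C_add by (simp only: CG r_def add_0)
  qed
  have "Q n (r 0)" if "m \<le> n" for n
  proof -
    define i where "i = n - m"
    have i: "n = m + i" using that by (simp add: i_def)
    have "semb d (Suc n) (r (Suc i))" using r[of "Suc i"] i by simp
    from pres[OF that G _ this, of "Suc i"] have "Q n (\<lambda>u. G (Suc i) (r (Suc i) u))"
      using q(2)[of i] i by simp
    then show ?thesis unfolding decomp[of i] .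
  qed
  then show ?thesis using r[of 0] by auto
qed

section \<open>Factoring strong embeddings at a level\<close>

definition graft :: "nat \<Rightarrow> (nat list \<Rightarrow> nat list) \<Rightarrow> nat list \<Rightarrow> nat list" where
  "graft m k u = (if length u \<le> m then k u else k (take m u) @ drop m u)"

lemma semb_graft:
  assumes k: "semb d m k"
  shows "semb d m (graft m k)"
  unfolding semb_def
proof (intro conjI allI ballI impI)
  fix u a
  show "prefix (graft m k u @ [a]) (graft m k (u @ [a]))"
    using semb_step[OF k, of u a] by (auto simp: graft_def)
next
  fix u v :: "nat list" assume len: "length u = length v"
  then have "length (k (take m u)) = length (k (take m v))" "length (k u) = length (k v)"
    by (intro semb_length_cong[OF k], simp)+
  then show "length (graft m k u) = length (graft m k v)" using len by (simp add: graft_def)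
next
  fix u assume "u \<in> tree d"
  then show "graft m k u \<in> tree d"
    by (simp add: graft_def semb_tree[OF k] tree_take tree_drop)
qed (simp add: graft_def semb_fix[OF k])

definition remainder :: "nat \<Rightarrow> (nat list \<Rightarrow> nat list) \<Rightarrow> nat list \<Rightarrow> nat list" where
  "remainder m k u =
    (if length u \<le> m then u else take m u @ drop (length (k (take m u))) (k u))"

lemma prefix_drop: "prefix u v \<Longrightarrow> prefix (drop n u) (drop n v)"
  by (auto simp: prefix_def)

lemma semb_remainder:
  assumes k: "semb d m k"
  shows "semb d (Suc m) (remainder m k)"
  unfolding semb_def
proof (intro conjI allI ballI impI)
  fix u a
  let ?L = "length (k (take m u))"
  have step: "prefix (k u @ [a]) (k (u @ [a]))" by (rule semb_step[OF k])
  show "prefix (remainder m k u @ [a]) (remainder m k (u @ [a]))"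
  proof (cases "length u < m")
    case True then show ?thesis by (auto simp: remainder_def)
  next
    case False
    have "?L \<le> length (k u)" by (rule semb_length_le[OF k]) simp
    then have "prefix (drop ?L (k u) @ [a]) (drop ?L (k (u @ [a])))"
      using prefix_drop[OF step, of ?L] by simp
    then show ?thesis using False by (auto simp: remainder_def)
  qed
next
  fix u v :: "nat list" assume len: "length u = length v"
  then have "length (k (take m u)) = length (k (take m v))" "length (k u) = length (k v)"
    by (intro semb_length_cong[OF k], simp)+
  then show "length (remainder m k u) = length (remainder m k v)"
    using len by (simp add: remainder_def)
next
  fix u assume "u \<in> tree d"
  then show "remainder m k u \<in> tree d"
    by (simp add: remainder_def semb_tree[OF k] tree_take tree_drop)
qed (simp add: remainder_def)

text \<open>An embedding splits into its effect on level \<open>m\<close> and an embedding that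
  fixes this level as well. Embeddings with given values on level \<open>m\<close> are thus
  parametrized by embeddings in \<open>semb d (Suc m)\<close>, which is what the induction for
  Milliken's theorem needs.\<close>

lemma graft_remainder:
  assumes k: "semb d m k" and eq: "\<forall>u\<in>lev d m. k u = k1 u" and "semb d m k1" "u \<in> tree d"
  shows "graft m k1 (remainder m k u) = k u"
proof (cases "length u < m")
  case True
  then show ?thesis using assms by (simp add: graft_def remainder_def semb_fix)
next
  case False
  then have u: "take m u \<in> lev d m" using assms(4) by (simp add: lev_def tree_take)
  show ?thesis
  proof (cases "length u = m")
    case True
    then show ?thesis using u eq by (simp add: graft_def remainder_def)
  next
    case l: False
    have "length (k (take m u)) < length (k u)"
      by (rule semb_passing(1)[OF k]) (use False l in simp)
    moreover have "prefix (k (take m u)) (k u)"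
      by (rule semb_prefix[OF k]) (rule take_is_prefix)
    ultimately show ?thesis using False l u eq
      by (auto simp: graft_def remainder_def prefix_def)
  qed
qed

text \<open>A refinement \<open>k'\<close> made inside the grafted tree is traded for a refinement
  \<open>q\<close> of the ambient tree that fixes level \<open>l\<close>. In this form it can be
  composed with other refinements during fusion.\<close>

lemma lift_semb:
  assumes d: "0 < d" and k: "semb d m k" and k': "semb d (Suc m) k'" and l: "m \<le> l"
    and len: "\<forall>u\<in>lev d m. length (k u) = l"
  shows "\<exists>q. semb d (Suc l) q \<and> (\<forall>u\<in>tree d. q (graft m k u) = graft m k (k' u))"
proof -
  \<comment> \<open>Successors \<open>k u @ [a]\<close> of image nodes are pulled back to
    \<open>u @ [a]\<close>. All other words get a default of the same length \<open>Suc m\<close>,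
    so that \<open>q\<close> lengthens words of equal length equally.\<close>
  define base where "base s = (if \<exists>u\<in>lev d m. \<exists>a. s = k u @ [a]
    then (SOME w. \<exists>u\<in>lev d m. \<exists>a. s = k u @ [a] \<and> w = u @ [a]) else replicate (Suc m) 0)" for s
  have base_eq: "base (k u @ [a]) = u @ [a]" if u: "u \<in> lev d m" for u a
  proof -
    have "\<exists>w. \<exists>v\<in>lev d m. \<exists>b. k u @ [a] = k v @ [b] \<and> w = v @ [b]" using u by blast
    then have "\<exists>v\<in>lev d m. \<exists>b. k u @ [a] = k v @ [b] \<and>
        (SOME w. \<exists>v\<in>lev d m. \<exists>b. k u @ [a] = k v @ [b] \<and> w = v @ [b]) = v @ [b]"
      by (rule someI_ex)
    then obtain v b where "k u @ [a] = k v @ [b]"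
      "(SOME w. \<exists>v\<in>lev d m. \<exists>b. k u @ [a] = k v @ [b] \<and> w = v @ [b]) = v @ [b]" by blast
    moreover have "\<exists>v\<in>lev d m. \<exists>b. k u @ [a] = k v @ [b]" using u by blast
    ultimately show ?thesis using injD[OF semb_inj[OF k], of u v] by (simp add: base_def)
  qed
  have base_other: "base s = replicate (Suc m) 0" if "\<not> (\<exists>u\<in>lev d m. \<exists>a. s = k u @ [a])" for s
    using that by (simp only: base_def if_False)
  have base_len: "length (base s) = Suc m" for s
  proof (cases "\<exists>u\<in>lev d m. \<exists>a. s = k u @ [a]")
    case True then show ?thesis using base_eq by (auto simp: lev_def)
  next
    case False
    show ?thesis unfolding base_other[OF False] by simp
  qed
  have base_tree: "base s \<in> tree d" if "s \<in> tree d" for s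
  proof (cases "\<exists>u\<in>lev d m. \<exists>a. s = k u @ [a]")
    case True then show ?thesis using base_eq that by (auto simp: lev_def)
  next
    case False
    show ?thesis unfolding base_other[OF False] using d by (intro tree_replicate)
  qed
  define q where "q w = (if length w < Suc l then w else take (Suc l) w @
    drop (Suc m) (k' (base (take (Suc l) w) @ drop (Suc l) w)))" for w
  have "semb d (Suc l) q"
    unfolding semb_def
  proof (intro conjI allI ballI impI)
    fix u a
    show "prefix (q u @ [a]) (q (u @ [a]))"
    proof (cases "length u < Suc l")
      case True
      then show ?thesis by (cases "length u = l") (auto simp: q_def)
    next
      case False
      let ?w = "base (take (Suc l) u) @ drop (Suc l) u"
      have "Suc m \<le> length (k' ?w)" using semb_length_ge[OF k', of ?w] base_len by simp
      then have "prefix (drop (Suc m) (k' ?w) @ [a]) (drop (Suc m) (k' (?w @ [a])))"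
        using prefix_drop[OF semb_step[OF k', of ?w a], of "Suc m"] by simp
      then show ?thesis using False by (simp add: q_def)
    qed
  next
    fix u v :: "nat list" assume len: "length u = length v"
    then have "length (k' (base (take (Suc l) u) @ drop (Suc l) u)) =
        length (k' (base (take (Suc l) v) @ drop (Suc l) v))"
      by (intro semb_length_cong[OF k']) (simp add: base_len)
    then show "length (q u) = length (q v)" using len by (simp add: q_def)
  next
    fix u assume "u \<in> tree d"
    then show "q u \<in> tree d"
      by (simp add: q_def tree_take tree_drop semb_tree[OF k'] base_tree)
  qed (simp add: q_def)
  moreover have "q (graft m k u) = graft m k (k' u)" if u: "u \<in> tree d" for u
  proof (cases "length u \<le> m")
    case True
    have "length (k u) \<le> l"
    proof (cases "length u = m")
      case True then show ?thesis using len u by (simp add: lev_def)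
    next
      case False then show ?thesis using True l semb_fix[OF k, of u] by simp
    qed
    then show ?thesis using True semb_fix[OF k', of u] by (simp add: graft_def q_def)
  next
    case False
    let ?u = "take m u" and ?a = "u ! m"
    have s: "take (Suc m) u = ?u @ [?a]" using False by (simp add: take_Suc_conv_app_nth)
    have lu: "?u \<in> lev d m" using u False by (simp add: lev_def tree_take)
    then have lk: "length (k ?u) = l" using len by blast
    have dm: "drop m u = ?a # drop (Suc m) u" using False by (simp add: Cons_nth_drop_Suc)
    have g: "graft m k u = (k ?u @ [?a]) @ drop (Suc m) u" using False dm by (simp add: graft_def)
    have "q (graft m k u) = k ?u @ [?a] @ drop (Suc m) (k' (base (k ?u @ [?a]) @ drop (Suc m) u))"
      unfolding g q_def using lk by simp
    also have "base (k ?u @ [?a]) @ drop (Suc m) u = u"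
      unfolding base_eq[OF lu] s[symmetric] by simp
    finally have q: "q (graft m k u) = k ?u @ [?a] @ drop (Suc m) (k' u)" .
    have t: "take (Suc m) (k' u) = ?u @ [?a]" using semb_take[OF k', of u] False s by simp
    have "length u \<le> length (k' u)" by (rule semb_length_ge[OF k'])
    then have "k' u = ?u @ [?a] @ drop (Suc m) (k' u)"
      using append_take_drop_id[of "Suc m" "k' u"] unfolding t by simp
    then have "graft m k (k' u) = graft m k (?u @ [?a] @ drop (Suc m) (k' u))" by simp
    also have "\<dots> = k ?u @ [?a] @ drop (Suc m) (k' u)" using False by (simp add: graft_def)
    finally show ?thesis using q by simp
  qed
  ultimately show ?thesis by blast
qed

section \<open>Milliken's theorem by induction on the number of relevant levels\<close>

definition depends_below :: "nat \<Rightarrow> nat \<Rightarrow> nat \<Rightarrow> ((nat list \<Rightarrow> nat list) \<Rightarrow> 'c) \<Rightarrow> bool" where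
  "depends_below d m N c \<longleftrightarrow> (\<forall>k k'. semb d m k \<longrightarrow> semb d m k' \<longrightarrow>
     (\<forall>u\<in>tree d. length u < N \<longrightarrow> k u = k' u) \<longrightarrow> c k = c k')"

lemma depends_belowD:
  "depends_below d m N c \<Longrightarrow> semb d m k \<Longrightarrow> semb d m k' \<Longrightarrow>
    (\<And>u. u \<in> tree d \<Longrightarrow> length u < N \<Longrightarrow> k u = k' u) \<Longrightarrow> c k = c k'"
  unfolding depends_below_def by metis

text \<open>After refinement by \<open>g\<close>, the values \<open>x\<close> on level
  \<open>m\<close> leave no further influence on the colour. Once this holds for every possible
  \<open>x\<close>, the colouring is one for the Halpern--Lauchli theorem.\<close>

definition level_determined where
  "level_determined d m x c g \<longleftrightarrow> (\<forall>k k'. semb d m k \<longrightarrow> semb d m k' \<longrightarrow>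
     (\<forall>u\<in>lev d m. k u = x u \<and> k' u = x u) \<longrightarrow> c (\<lambda>u. g (k u)) = c (\<lambda>u. g (k' u)))"

lemma level_determinedD:
  "level_determined d m x c g \<Longrightarrow> semb d m k \<Longrightarrow> semb d m k' \<Longrightarrow>
    (\<And>u. u \<in> lev d m \<Longrightarrow> k u = x u) \<Longrightarrow> (\<And>u. u \<in> lev d m \<Longrightarrow> k' u = x u) \<Longrightarrow>
    c (\<lambda>u. g (k u)) = c (\<lambda>u. g (k' u))"
  unfolding level_determined_def by metis

text \<open>The values \<open>x\<close> lie on level \<open>l\<close>, which \<open>r\<close> does
  not move.\<close>

lemma level_determined_comp:
  assumes ld: "level_determined d m x c g" and r: "semb d (Suc l) r" and "m \<le> l"
    and x: "\<And>u. u \<in> lev d m \<Longrightarrow> length (x u) = l"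
  shows "level_determined d m x c (\<lambda>u. g (r u))"
  unfolding level_determined_def
proof (intro allI impI)
  fix k k' assume k: "semb d m k" and k': "semb d m k'" and eq: "\<forall>u\<in>lev d m. k u = x u \<and> k' u = x u"
  have r': "semb d m r" using r by (rule semb_mono) (use \<open>m \<le> l\<close> in simp)
  show "c (\<lambda>u. g (r (k u))) = c (\<lambda>u. g (r (k' u)))"
    by (rule level_determinedD[OF ld semb_comp[OF r' k] semb_comp[OF r' k']])
      (use eq x in \<open>auto intro!: semb_fix[OF r]\<close>)
qed

text \<open>All embeddings with values \<open>x\<close> on level \<open>m\<close> are one graft
  composed with embeddings that fix this level. For the latter the induction hypothesis gives
  \<open>k0\<close>, and \<open>lift_semb\<close> turns \<open>k0\<close> into a refinement of the
  whole tree that fixes level \<open>l\<close>.\<close>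

lemma ex_level_determined:
  fixes c :: "(nat list \<Rightarrow> nat list) \<Rightarrow> 'c"
  assumes d: "0 < d" and l: "m \<le> l" and g: "semb d m g"
    and fin: "finite (c ` {k. semb d m k})" and dep: "depends_below d m (m + Suc H) c"
    and IH: "\<And>c' :: (nat list \<Rightarrow> nat list) \<Rightarrow> 'c. finite (c' ` {k. semb d (Suc m) k}) \<Longrightarrow>
      depends_below d (Suc m) (Suc m + H) c' \<Longrightarrow>
      \<exists>k0. semb d (Suc m) k0 \<and> (\<forall>k. semb d (Suc m) k \<longrightarrow> c' (\<lambda>u. k0 (k u)) = c' k0)"
    and x: "\<And>u. u \<in> lev d m \<Longrightarrow> length (x u) = l"
  shows "\<exists>q. semb d (Suc l) q \<and> level_determined d m x c (\<lambda>u. g (q u))"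
proof (cases "\<exists>k. semb d m k \<and> (\<forall>u\<in>lev d m. k u = x u)")
  case False
  then have "level_determined d m x c g" unfolding level_determined_def by blast
  then show ?thesis using semb_id[of d "Suc l"] by (intro exI[of _ "\<lambda>u. u"]) simp
next
  case True
  then obtain k1 where k1: "semb d m k1" "\<forall>u\<in>lev d m. k1 u = x u" by blast
  let ?e = "graft m k1"
  have e: "semb d m ?e" by (rule semb_graft[OF k1(1)])
  have ge: "semb d m (\<lambda>u. g (?e (k u)))" if "semb d (Suc m) k" for k
    by (intro semb_comp[OF g] semb_comp[OF e] semb_mono[OF that]) simp
  let ?c' = "\<lambda>k. c (\<lambda>u. g (?e (k u)))"
  have fin': "finite (?c' ` {k. semb d (Suc m) k})"
    by (rule finite_subset[OF _ fin]) (use ge in blast)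
  have dep': "depends_below d (Suc m) (Suc m + H) ?c'"
    unfolding depends_below_def
  proof (intro allI impI)
    fix k k' assume "semb d (Suc m) k" "semb d (Suc m) k'"
      "\<forall>u\<in>tree d. length u < Suc m + H \<longrightarrow> k u = k' u"
    then show "?c' k = ?c' k'" by (intro depends_belowD[OF dep] ge) simp_all
  qed
  obtain k0 where k0: "semb d (Suc m) k0"
    "\<And>k. semb d (Suc m) k \<Longrightarrow> ?c' (\<lambda>u. k0 (k u)) = ?c' k0"
    using IH[OF fin' dep'] by metis
  have "\<forall>u\<in>lev d m. length (k1 u) = l" using k1(2) x by simp
  then obtain q where q: "semb d (Suc l) q" "\<forall>u\<in>tree d. q (?e u) = ?e (k0 u)"
    using lift_semb[OF d k1(1) k0(1) l] by metis
  have q': "semb d m q" using q(1) by (rule semb_mono) (use l in simp)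
  have "c (\<lambda>u. g (q (k u))) = ?c' k0" if k: "semb d m k" "\<forall>u\<in>lev d m. k u = x u" for k
  proof -
    let ?r = "remainder m k"
    have r: "semb d (Suc m) ?r" by (rule semb_remainder[OF k(1)])
    have kk: "\<forall>u\<in>lev d m. k u = k1 u" using k(2) k1(2) by simp
    have "c (\<lambda>u. g (q (k u))) = c (\<lambda>u. g (?e (k0 (?r u))))"
    proof (rule depends_belowD[OF dep])
      show "semb d m (\<lambda>u. g (q (k u)))" by (intro semb_comp[OF g] semb_comp[OF q'] k(1))
      show "semb d m (\<lambda>u. g (?e (k0 (?r u))))" by (intro ge semb_comp[OF k0(1)] r)
      fix u assume u: "u \<in> tree d"
      have "k u = ?e (?r u)" using graft_remainder[OF k(1) kk k1(1) u] by simp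
      then have "q (k u) = ?e (k0 (?r u))" using q(2) semb_tree[OF r u] by simp
      then show "g (q (k u)) = g (?e (k0 (?r u)))" by simp
    qed
    then show ?thesis using k0(2)[OF r] by simp
  qed
  then have "level_determined d m x c (\<lambda>u. g (q u))"
    unfolding level_determined_def by metis
  then show ?thesis using q(1) by blast
qed

theorem Milliken:
  fixes c :: "(nat list \<Rightarrow> nat list) \<Rightarrow> 'c"
  assumes d: "0 < d" and "finite (c ` {k. semb d m k})" and "depends_below d m (m + H) c"
  shows "\<exists>k0. semb d m k0 \<and> (\<forall>k. semb d m k \<longrightarrow> c (\<lambda>u. k0 (k u)) = c k0)"
  using assms(2,3)
proof (induction H arbitrary: m c)
  case 0
  have *: "c k = c (\<lambda>u. u)" if "semb d m k" for k
    by (rule depends_belowD[OF 0(2) that semb_id]) (use semb_fix[OF that] in simp)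
  show ?case
  proof (intro exI[of _ "\<lambda>u. u"] conjI allI impI semb_id)
    fix k assume "semb d m k"
    then show "c (\<lambda>u. k u) = c (\<lambda>u. u)" by (rule *)
  qed
next
  case (Suc H)
  note fin = Suc.prems(1) and dep = Suc.prems(2)
  let ?X = "\<lambda>l. PiE (lev d m) (\<lambda>_. lev d l)"
  \<comment> \<open>The index is \<open>Suc l\<close> because the refinement that handles values on
    level \<open>l\<close> has to fix that level.\<close>
  define Q where "Q n g \<longleftrightarrow> (\<forall>l. n = Suc l \<longrightarrow> m \<le> l \<longrightarrow>
    (\<forall>x\<in>?X l. level_determined d m x c g))" for n g
  have xl: "length (x u) = l" if "x \<in> ?X l" "u \<in> lev d m" for x l u
    using PiE_mem[OF that] by (simp add: lev_def)
  have "\<exists>g. semb d m g \<and> (\<forall>n\<ge>m. Q n g)"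
  proof (rule fusion)
    fix n g assume "m \<le> n" and g: "semb d m g"
    show "\<exists>q. semb d n q \<and> Q n (\<lambda>u. g (q u))"
    proof (cases "\<exists>l. n = Suc l \<and> m \<le> l")
      case False
      then have "Q n g" unfolding Q_def by blast
      then show ?thesis using semb_id[of d n] by (intro exI[of _ "\<lambda>u. u"]) simp
    next
      case True
      then obtain l where l: "n = Suc l" "m \<le> l" by metis
      have "\<exists>q. semb d (Suc l) q \<and> (\<forall>x\<in>F. level_determined d m x c (\<lambda>u. g (q u)))"
        if "finite F" "F \<subseteq> ?X l" for F
        using that
      proof (induction F rule: finite_induct)
        case empty show ?case using semb_id[of d "Suc l"] by (intro exI[of _ "\<lambda>u. u"]) simp
      next
        case (insert x F)
        then obtain q where q: "semb d (Suc l) q" "\<forall>x\<in>F. level_determined d m x c (\<lambda>u. g (q u))"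
          by auto
        have q': "semb d m q" using q(1) by (rule semb_mono) (use l in simp)
        have xX: "x \<in> ?X l" using insert.prems by simp
        have "\<exists>q2. semb d (Suc l) q2 \<and> level_determined d m x c (\<lambda>u. g (q (q2 u)))"
          by (rule ex_level_determined[OF d l(2) semb_comp[OF g q'] fin dep])
            (erule (1) Suc.IH, erule xl[OF xX])
        then obtain q2 where q2: "semb d (Suc l) q2" "level_determined d m x c (\<lambda>u. g (q (q2 u)))"
          by (elim exE conjE)
        have "level_determined d m y c (\<lambda>u. g (q (q2 u)))" if y: "y \<in> F" for y
        proof -
          have "y \<in> ?X l" using y insert.prems by blast
          from level_determined_comp[OF bspec[OF q(2) y] q2(1) l(2) xl[OF this]] show ?thesis .
        qed
        then have "\<forall>y\<in>insert x F. level_determined d m y c (\<lambda>u. g (q (q2 u)))" using q2(2) by simp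
        then show ?case using semb_comp[OF q(1) q2(1)] by blast
      qed
      then obtain q where "semb d (Suc l) q" "\<forall>x\<in>?X l. level_determined d m x c (\<lambda>u. g (q u))"
        using finite_PiE[OF finite_lev, of d m "\<lambda>_. lev d l"] finite_lev by blast
      then have "semb d n q" "Q n (\<lambda>u. g (q u))" using l(1) by (simp_all add: Q_def)
      then show ?thesis by blast
    qed
  next
    fix n g r assume mn: "m \<le> n" and g: "semb d m g" and Q: "Q n g" and r: "semb d (Suc n) r"
    have r': "semb d n r" using r by (rule semb_mono) simp
    show "Q n (\<lambda>u. g (r u))"
      unfolding Q_def
    proof (intro allI impI ballI)
      fix l x assume l: "n = Suc l" "m \<le> l" and x: "x \<in> ?X l"
      have "level_determined d m x c g" using Q l x unfolding Q_def by blast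
      from level_determined_comp[OF this r'[unfolded l(1)] l(2) xl[OF x]]
      show "level_determined d m x c (\<lambda>u. g (r u))" .
    qed
  qed
  then obtain g where g: "semb d m g" "\<And>n. m \<le> n \<Longrightarrow> Q n g" by blast
  let ?c = "\<lambda>k. c (\<lambda>u. g (k u))"
  have fin': "finite (?c ` {k. semb d m k})"
    by (rule finite_subset[OF _ fin]) (use semb_comp[OF g(1)] in blast)
  have dep': "?c k = ?c k'" if k: "semb d m k" and k': "semb d m k'" and eq: "\<forall>u\<in>lev d m. k u = k' u" for k k'
  proof -
    define l where "l = length (k (replicate m 0))"
    have l: "m \<le> l" using semb_length_ge[OF k, of "replicate m 0"] by (simp add: l_def)
    have kl: "k u \<in> lev d l" if "u \<in> lev d m" for u
    proof -
      have "length (k u) = l" unfolding l_def by (rule semb_length_cong[OF k]) (use that in \<open>simp add: lev_def\<close>)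
      then show ?thesis using that semb_tree[OF k, of u] by (simp add: lev_def)
    qed
    have "restrict k (lev d m) \<in> ?X l" using kl by (intro restrict_PiE_iff[THEN iffD2]) simp
    then have "level_determined d m (restrict k (lev d m)) c g"
      using g(2)[of "Suc l"] l unfolding Q_def by simp
    then show ?thesis by (rule level_determinedD[OF _ k k']) (use eq in simp_all)
  qed
  obtain k1 where k1: "semb d m k1" "\<forall>k. semb d m k \<longrightarrow> ?c (\<lambda>u. k1 (k u)) = ?c k1"
    using Halpern_Lauchli[OF d fin' dep'] by blast
  show ?case using semb_comp[OF g(1) k1(1)] k1(2) by blast
qed

section \<open>Homogeneity for the equality pattern of a colouring\<close>

definition homogeneous :: "nat \<Rightarrow> nat \<Rightarrow> nat \<Rightarrow> (nat list set \<Rightarrow> 'c) \<Rightarrow> (nat list \<Rightarrow> nat list) \<Rightarrow> bool" where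
  "homogeneous d H m \<gamma> g \<longleftrightarrow> (\<forall>k X Y. semb d m k \<longrightarrow>
     X \<subseteq> {u \<in> tree d. length u < m + H} \<longrightarrow> Y \<subseteq> {u \<in> tree d. length u < m + H} \<longrightarrow>
     (\<gamma> ((\<lambda>u. g (k u)) ` X) = \<gamma> ((\<lambda>u. g (k u)) ` Y) \<longleftrightarrow> \<gamma> (g ` X) = \<gamma> (g ` Y)))"

lemma finite_tree_below: "finite {u \<in> tree d. length u < N}"
proof -
  have "{u \<in> tree d. length u < N} = (\<Union>l<N. lev d l)" by (auto simp: lev_def)
  then show ?thesis by (simp add: finite_lev)
qed

text \<open>For each embedding the set of pairs of subsets of the tree below level
  \<open>n + H\<close> whose images have equal colours is one of finitely many. Milliken's theorem
  is applied to this set for every \<open>n\<close>, and fusion combines the results.\<close>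

theorem ex_homogeneous:
  assumes d: "0 < d"
  shows "\<exists>g. semb d 0 g \<and> (\<forall>m. homogeneous d H m \<gamma> g)"
proof -
  have "\<exists>g. semb d 0 g \<and> (\<forall>n\<ge>0. homogeneous d H n \<gamma> g)"
  proof (rule fusion)
    fix n g assume g: "semb d 0 g"
    let ?S = "{u \<in> tree d. length u < n + H}"
    define c where "c k = {(X, Y). X \<subseteq> ?S \<and> Y \<subseteq> ?S \<and>
      \<gamma> ((\<lambda>u. g (k u)) ` X) = \<gamma> ((\<lambda>u. g (k u)) ` Y)}" for k
    have "c ` {k. semb d n k} \<subseteq> Pow (Pow ?S \<times> Pow ?S)" by (auto simp: c_def)
    then have fin: "finite (c ` {k. semb d n k})"
      by (rule finite_subset) (simp add: finite_tree_below)
    have dep: "depends_below d n (n + H) c"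
      unfolding depends_below_def
    proof (intro allI impI)
      fix k k' :: "nat list \<Rightarrow> nat list"
      assume "\<forall>u\<in>tree d. length u < n + H \<longrightarrow> k u = k' u"
      then have "(\<lambda>u. g (k u)) ` X = (\<lambda>u. g (k' u)) ` X" if "X \<subseteq> ?S" for X
        using that by (intro image_cong) auto
      then show "c k = c k'" unfolding c_def by auto
    qed
    obtain q where q: "semb d n q" "\<And>k. semb d n k \<Longrightarrow> c (\<lambda>u. q (k u)) = c q"
      using Milliken[OF d fin dep] by blast
    have "homogeneous d H n \<gamma> (\<lambda>u. g (q u))"
      unfolding homogeneous_def
    proof (intro allI impI)
      fix k X Y assume k: "semb d n k" and XY: "X \<subseteq> ?S" "Y \<subseteq> ?S"
      have "(X, Y) \<in> c (\<lambda>u. q (k u)) \<longleftrightarrow> (X, Y) \<in> c q" using q(2)[OF k] by simp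
      then show "\<gamma> ((\<lambda>u. g (q (k u))) ` X) = \<gamma> ((\<lambda>u. g (q (k u))) ` Y) \<longleftrightarrow>
          \<gamma> ((\<lambda>u. g (q u)) ` X) = \<gamma> ((\<lambda>u. g (q u)) ` Y)"
        using XY by (simp add: c_def)
    qed
    then show "\<exists>q. semb d n q \<and> homogeneous d H n \<gamma> (\<lambda>u. g (q u))" using q(1) by blast
  next
    fix n g r assume hom: "homogeneous d H n \<gamma> g" and "semb d (Suc n) r"
    then have r: "semb d n r" by (auto intro: semb_mono)
    show "homogeneous d H n \<gamma> (\<lambda>u. g (r u))"
      unfolding homogeneous_def
    proof (intro allI impI)
      fix k X Y assume k: "semb d n k" and XY: "X \<subseteq> {u \<in> tree d. length u < n + H}"
        "Y \<subseteq> {u \<in> tree d. length u < n + H}"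
      show "\<gamma> ((\<lambda>u. g (r (k u))) ` X) = \<gamma> ((\<lambda>u. g (r (k u))) ` Y) \<longleftrightarrow>
          \<gamma> ((\<lambda>u. g (r u)) ` X) = \<gamma> ((\<lambda>u. g (r u)) ` Y)"
        using hom[unfolded homogeneous_def, rule_format, OF semb_comp[OF r k] XY]
          hom[unfolded homogeneous_def, rule_format, OF r XY] by simp
    qed
  qed
  then show ?thesis by simp
qed

section \<open>Rainbow sets of words\<close>

lemma semb_insert_letter:
  assumes "\<And>s. a s < d"
  shows "semb d l (\<lambda>u. if length u < l then u else take l u @ a (take l u) # drop l u)"
    (is "semb d l ?k")
  unfolding semb_def
proof (intro conjI allI ballI impI)
  fix u b
  show "prefix (?k u @ [b]) (?k (u @ [b]))"
    by (cases "Suc (length u) = l") auto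
next
  fix u v :: "nat list" assume "length u = length v"
  then show "length (?k u) = length (?k v)" by simp
next
  fix u assume "u \<in> tree d"
  then show "?k u \<in> tree d" using assms by (simp add: tree_take tree_drop)
qed simp

text \<open>Levels at which no word of \<open>Z\<close> ends and no two of them split are removed one by one.\<close>

lemma envelope:
  assumes "0 < d" "finite Z" "Z \<subseteq> tree d" "\<forall>z\<in>Z. m \<le> length z" "card Z \<le> c"
  shows "\<exists>k Z0. semb d m k \<and> Z0 \<subseteq> tree d \<and>
    (\<forall>z\<in>Z0. m \<le> length z \<and> length z < m + Suc (c + c * c)) \<and> Z = k ` Z0"
  using assms(2-5)
proof (induction "\<Sum>z\<in>Z. length z" arbitrary: Z rule: less_induct)
  case less
  \<comment> \<open>Ends of words occupy at most \<open>c\<close> levels and splittings of pairs at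
    most \<open>c * c\<close>; so among \<open>?B\<close> consecutive levels at least one is
    free.\<close>
  let ?B = "Suc (c + c * c)"
  show ?case
  proof (cases "\<forall>z\<in>Z. length z < m + ?B")
    case True
    then show ?thesis using less.prems semb_id
      by (intro exI[of _ "\<lambda>u. u"] exI[of _ Z]) auto
  next
    case False
    then obtain z1 where z1: "z1 \<in> Z" "m + ?B \<le> length z1" by (auto simp: not_less)
    define df where "df z z' = (LEAST i. take (Suc i) z \<noteq> take (Suc i) z')" for z z' :: "nat list"
    let ?C = "length ` Z \<union> (\<lambda>(z, z'). df z z') ` (Z \<times> Z)"
    have fin: "finite ?C" using less.prems by simp
    have "card ?C \<le> card (length ` Z) + card ((\<lambda>(z, z'). df z z') ` (Z \<times> Z))" by (rule card_Un_le)
    also have "\<dots> \<le> card Z + card (Z \<times> Z)"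
      using less.prems(1) by (intro add_mono card_image_le) simp_all
    also have "\<dots> \<le> c + c * c"
      using less.prems(4) by (simp add: card_cartesian_product add_mono mult_mono)
    finally have "card ?C < card {m..<m + ?B}" by simp
    then have "\<not> {m..<m + ?B} \<subseteq> ?C" using card_mono[OF fin] by (metis not_less)
    then obtain l where "l \<in> {m..<m + ?B}" and lC: "l \<notin> ?C" by (meson subsetI)
    then have l: "m \<le> l" "l < m + ?B" by simp_all
    have len: "length z \<noteq> l" if "z \<in> Z" for z using that lC by blast
    have agree: "z ! l = z' ! l"
      if z: "z \<in> Z" "z' \<in> Z" "l < length z" "l < length z'" and eq: "take l z = take l z'" for z z'
    proof (rule ccontr)
      assume ne: "z ! l \<noteq> z' ! l"
      have "df z z' = l" unfolding df_def
      proof (rule Least_equality)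
        show "take (Suc l) z \<noteq> take (Suc l) z'"
          using z ne eq by (simp add: take_Suc_conv_app_nth)
        fix i assume i: "take (Suc i) z \<noteq> take (Suc i) z'"
        show "l \<le> i"
        proof (rule ccontr)
          assume "\<not> l \<le> i"
          then have "take (Suc i) z = take (Suc i) (take l z)" "take (Suc i) z' = take (Suc i) (take l z')"
            by (simp_all add: min_def)
          then show False using i eq by simp
        qed
      qed
      then show False using lC z by force
    qed
    \<comment> \<open>At the free level all words of \<open>Z\<close> through \<open>s\<close>
      continue with the same letter, which is the one to be reinserted. Where no word passes, the
      default is 0.\<close>
    define a where "a s = (if \<exists>z\<in>Z. l < length z \<and> take l z = s
      then (SOME z. z \<in> Z \<and> l < length z \<and> take l z = s) ! l else 0)" for s
    have a_eq: "a (take l z) = z ! l" if z: "z \<in> Z" "l < length z" for z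
    proof -
      let ?z = "SOME z'. z' \<in> Z \<and> l < length z' \<and> take l z' = take l z"
      have "?z \<in> Z \<and> l < length ?z \<and> take l ?z = take l z"
        by (rule someI[where x = z]) (use z in simp)
      then have "?z ! l = z ! l" using agree z by blast
      then show ?thesis using z by (auto simp: a_def)
    qed
    have a_less: "a s < d" for s
    proof (cases "\<exists>z\<in>Z. l < length z \<and> take l z = s")
      case True
      then obtain z where z: "z \<in> Z" "l < length z" "take l z = s" by blast
      have "z \<in> tree d" using z(1) less.prems(2) by blast
      then show ?thesis using a_eq[OF z(1,2)] z(2,3) tree_nth by simp
    next
      case False
      then have "a s = 0" unfolding a_def by (rule if_not_P)
      then show ?thesis using assms(1) by simp
    qed
    define k where "k u = (if length u < l then u else take l u @ a (take l u) # drop l u)" for u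
    have k: "semb d l k" unfolding k_def[abs_def] by (rule semb_insert_letter) (rule a_less)
    \<comment> \<open>On \<open>Z\<close> the embedding \<open>k\<close> undoes \<open>del\<close>.
      At least \<open>z1\<close> becomes shorter, so the total length drops.\<close>
    define del where "del z = take l z @ drop (Suc l) z" for z :: "nat list"
    have kdel: "k (del z) = z" if "z \<in> Z" for z
    proof (cases "length z < l")
      case False
      then have "l < length z" using len[OF that] by simp
      then have "take l (del z) = take l z" "drop l (del z) = drop (Suc l) z" "l \<le> length (del z)"
        by (simp_all add: del_def)
      then have "k (del z) = take l z @ z ! l # drop (Suc l) z"
        using a_eq[OF that \<open>l < length z\<close>] by (simp add: k_def)
      then show ?thesis using \<open>l < length z\<close> by (simp add: id_take_nth_drop[symmetric])
    qed (simp add: k_def del_def)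
    have inj: "inj_on del Z" using kdel by (rule inj_on_inverseI)
    have le: "length (del z) \<le> length z" for z by (simp add: del_def)
    have "(\<Sum>z\<in>del ` Z. length z) = (\<Sum>z\<in>Z. length (del z))" by (simp add: sum.reindex[OF inj])
    also have "\<dots> < (\<Sum>z\<in>Z. length z)"
    proof (rule sum_strict_mono_ex1)
      show "\<exists>z\<in>Z. length (del z) < length z"
        using z1 l by (intro bexI[of _ z1]) (simp_all add: del_def)
    qed (use less.prems le in auto)
    finally have small: "(\<Sum>z\<in>del ` Z. length z) < (\<Sum>z\<in>Z. length z)" .
    have "\<forall>z\<in>del ` Z. m \<le> length z"
    proof
      fix y assume "y \<in> del ` Z"
      then obtain z where z: "z \<in> Z" "y = del z" by blast
      show "m \<le> length y" using z(2) l(1) len[OF z(1)] bspec[OF less.prems(3) z(1)]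
        by (auto simp: del_def min_def)
    qed
    moreover have "del ` Z \<subseteq> tree d"
      using less.prems(2) by (auto simp: del_def tree_take tree_drop subset_iff)
    moreover have "card (del ` Z) \<le> c" using less.prems(4) card_image[OF inj] by simp
    ultimately obtain k' Z0 where k': "semb d m k'" "Z0 \<subseteq> tree d"
      "\<forall>z\<in>Z0. m \<le> length z \<and> length z < m + ?B" "del ` Z = k' ` Z0"
      using less.hyps[OF small] less.prems(1) by (metis finite_imageI)
    have "Z = k ` (del ` Z)" using kdel by (simp add: image_image)
    then have "Z = (\<lambda>u. k (k' u)) ` Z0" unfolding k'(4) by (simp add: image_image)
    moreover have "semb d m (\<lambda>u. k (k' u))"
      by (rule semb_comp[OF semb_mono[OF k l(1)] k'(1)])
    ultimately show ?thesis using k'(2,3) by blast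
  qed
qed

section \<open>Choosing the words one after the other\<close>

definition tails :: "nat \<Rightarrow> nat \<Rightarrow> (nat list \<Rightarrow> nat list) \<Rightarrow> nat list set \<Rightarrow> bool" where
  "tails d i \<rho> Z \<longleftrightarrow> finite Z \<and> Z \<subseteq> tree d \<and> (\<forall>z\<in>Z. \<exists>\<tau>\<in>lev d i. prefix (\<rho> \<tau>) z)"

text \<open>The list \<open>\<tau>\<close> gives the letters of a later word at the lengths of the
  \<open>i\<close> chosen words, and \<open>\<rho> \<tau>\<close> is the common stem of all later
  words of this type. The last condition speaks of all tails on these stems because it must cover
  words still to be chosen; for empty \<open>Z\<close> it is the rainbow property of the chosen
  ones.\<close>

definition stage where
  "stage d c e \<gamma> i vs M \<rho> \<longleftrightarrow> length vs = i \<and>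
    (\<forall>v\<in>set vs. v \<in> tree d \<and> length v < M) \<and>
    (\<forall>j<i. \<forall>j'<j. length (vs ! j') < length (vs ! j) \<and> vs ! j ! length (vs ! j') = e j j') \<and>
    (\<forall>\<tau>\<in>lev d i. \<rho> \<tau> \<in> tree d \<and> length (\<rho> \<tau>) = M \<and> (\<forall>j<i. \<rho> \<tau> ! length (vs ! j) = \<tau> ! j)) \<and>
    (\<forall>X Y Z. X \<subseteq> set vs \<longrightarrow> Y \<subseteq> set vs \<longrightarrow> X \<noteq> Y \<longrightarrow> tails d i \<rho> Z \<longrightarrow>
      card X + card Z = c \<longrightarrow> card Y + card Z = c \<longrightarrow> \<gamma> (X \<union> Z) \<noteq> \<gamma> (Y \<union> Z))"

text \<open>The sets \<open>insert b W\<close> with \<open>b\<close> in \<open>T\<close> play the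
  role of a delta-system with kernel \<open>W\<close>; \<open>c\<close> is the size of all coloured
  sets.\<close>

definition delta_bounded :: "nat \<Rightarrow> nat \<Rightarrow> nat \<Rightarrow> (nat list set \<Rightarrow> 'c) \<Rightarrow> bool" where
  "delta_bounded d c K \<gamma> \<longleftrightarrow> (\<forall>W T. W \<subseteq> tree d \<longrightarrow> finite W \<longrightarrow> Suc (card W) = c \<longrightarrow>
    T \<subseteq> tree d - W \<longrightarrow> card T = Suc K \<longrightarrow> (\<exists>b\<in>T. \<exists>b'\<in>T. \<gamma> (insert b W) \<noteq> \<gamma> (insert b' W)))"

lemma delta_bounded_card:
  assumes db: "delta_bounded d c K \<gamma>" and W: "W \<subseteq> tree d" "finite W" "Suc (card W) = c"
    and cand: "inj_on cand {..<N}" "\<And>t. t < N \<Longrightarrow> cand t \<in> tree d - W"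
  shows "card {t. t < N \<and> y = \<gamma> (insert (cand t) W)} \<le> K"
proof (rule ccontr)
  assume "\<not> ?thesis"
  then have "Suc K \<le> card {t. t < N \<and> y = \<gamma> (insert (cand t) W)}" by simp
  then obtain T where T: "T \<subseteq> {t. t < N \<and> y = \<gamma> (insert (cand t) W)}" "card T = Suc K"
    by (rule obtain_subset_with_card_n)
  have "card (cand ` T) = Suc K"
    using T by (subst card_image) (auto intro: inj_on_subset[OF cand(1)])
  moreover have "cand ` T \<subseteq> tree d - W" using T(1) cand(2) by blast
  ultimately have "\<exists>b\<in>cand ` T. \<exists>b'\<in>cand ` T. \<gamma> (insert b W) \<noteq> \<gamma> (insert b' W)"
    using db W unfolding delta_bounded_def by blast
  then obtain b b' where b: "b \<in> cand ` T" "b' \<in> cand ` T" "\<gamma> (insert b W) \<noteq> \<gamma> (insert b' W)"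
    by blast
  have *: "\<gamma> (insert b W) = y" if "b \<in> cand ` T" for b using that T(1) by auto
  show False using b(3) *[OF b(1)] *[OF b(2)] by simp
qed

text \<open>This reduces arbitrary tails to the finitely many coded by \<open>S\<close>. The
  envelope writes \<open>Z\<close> as the image of a set \<open>Z0\<close> of short tails under an
  embedding that fixes words shorter than \<open>M\<close>, in particular \<open>X\<close> and
  \<open>Y\<close>. Homogeneity carries the inequality of colours from \<open>Z0\<close> to
  \<open>Z\<close>.\<close>

lemma stage_mixed:
  fixes \<rho> :: "nat list \<Rightarrow> nat list"
  assumes d: "0 < d" and hom: "homogeneous d (Suc (c + c * c)) M \<gamma> (\<lambda>u. u)"
    and \<rho>: "\<And>\<tau>. \<tau> \<in> lev d i \<Longrightarrow> \<rho> \<tau> \<in> tree d \<and> length (\<rho> \<tau>) = M"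
    and XY: "\<And>v. v \<in> X \<union> Y \<Longrightarrow> v \<in> tree d \<and> length v < M" "finite Y"
    and free: "\<And>S. S \<subseteq> lev d i \<times> {s \<in> tree d. length s < Suc (c + c * c)} \<Longrightarrow>
      card (Y \<union> (\<lambda>(\<tau>, s). \<rho> \<tau> @ s) ` S) = c \<Longrightarrow>
      \<gamma> (X \<union> (\<lambda>(\<tau>, s). \<rho> \<tau> @ s) ` S) \<noteq> \<gamma> (Y \<union> (\<lambda>(\<tau>, s). \<rho> \<tau> @ s) ` S)"
    and Z: "tails d i \<rho> Z" "card Y + card Z = c"
  shows "\<gamma> (X \<union> Z) \<noteq> \<gamma> (Y \<union> Z)"
proof -
  let ?B = "Suc (c + c * c)"
  have Zlen: "M \<le> length z" if "z \<in> Z" for z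
    using Z(1) that \<rho> prefix_length_le unfolding tails_def by metis
  have "\<exists>k Z0. semb d M k \<and> Z0 \<subseteq> tree d \<and>
      (\<forall>z\<in>Z0. M \<le> length z \<and> length z < M + ?B) \<and> Z = k ` Z0"
    by (rule envelope[OF d]) (use Z Zlen in \<open>auto simp: tails_def\<close>)
  then obtain k Z0 where k: "semb d M k" and Z0: "Z0 \<subseteq> tree d"
    "\<forall>z\<in>Z0. M \<le> length z \<and> length z < M + ?B" "Z = k ` Z0" by (elim exE conjE)
  define S where "S = {p \<in> lev d i \<times> {s \<in> tree d. length s < ?B}. \<rho> (fst p) @ snd p \<in> Z0}"
  have "z \<in> (\<lambda>(\<tau>, s). \<rho> \<tau> @ s) ` S" if z: "z \<in> Z0" for z
  proof -
    have "k z \<in> Z" using z Z0(3) by simp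
    then obtain \<tau> where \<tau>: "\<tau> \<in> lev d i" "prefix (\<rho> \<tau>) (k z)" using Z(1) unfolding tails_def by blast
    \<comment> \<open>As \<open>k\<close> keeps the first \<open>M\<close> letters, \<open>z\<close>
      lies on the same stem as \<open>k z\<close>.\<close>
    have "take M z = take M (k z)" using semb_take[OF k] z Z0(2) by simp
    also have "\<dots> = \<rho> \<tau>" using \<tau>(2) \<rho>[OF \<tau>(1)] by (auto simp: prefix_def)
    finally have eq: "z = \<rho> \<tau> @ drop M z" by (metis append_take_drop_id)
    have "drop M z \<in> tree d" "length (drop M z) < ?B"
      using z Z0(1,2) tree_drop by auto
    then have "(\<tau>, drop M z) \<in> S" using \<tau>(1) eq z by (simp add: S_def)
    then show ?thesis by (rule image_eqI[rotated]) (use eq in simp)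
  qed
  then have Z0S: "(\<lambda>(\<tau>, s). \<rho> \<tau> @ s) ` S = Z0" by (auto simp: S_def)
  have fix_k: "k ` V = V" if "V \<subseteq> X \<union> Y" for V
    using that XY(1) semb_fix[OF k] by (force simp: image_iff)
  have "finite Z" using Z(1) by (simp add: tails_def)
  then have finZ0: "finite Z0" using Z0(3) semb_inj[OF k] by (metis finite_imageD inj_on_subset subset_UNIV)
  have "card Z = card Z0" unfolding Z0(3) by (rule card_image) (rule inj_on_subset[OF semb_inj[OF k] subset_UNIV])
  moreover have "Y \<inter> Z0 = {}" using XY(1) Z0(2) by force
  ultimately have "card (Y \<union> Z0) = c" using Z(2) XY(2) finZ0 by (simp add: card_Un_disjoint)
  then have ne: "\<gamma> (X \<union> Z0) \<noteq> \<gamma> (Y \<union> Z0)"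
    using free[of S] unfolding Z0S by (auto simp: S_def)
  have sub: "V \<union> Z0 \<subseteq> {u \<in> tree d. length u < M + ?B}" if "V \<subseteq> X \<union> Y" for V
    using that XY(1) Z0(1,2) by (fastforce intro: less_le_trans)
  have "(\<gamma> ((\<lambda>u. k u) ` (X \<union> Z0)) = \<gamma> ((\<lambda>u. k u) ` (Y \<union> Z0))) = (\<gamma> (id ` (X \<union> Z0)) = \<gamma> (id ` (Y \<union> Z0)))"
    using hom k sub[of X] sub[of Y] unfolding homogeneous_def id_def by blast
  then show ?thesis using ne fix_k[of X] fix_k[of Y] Z0(3) by (simp add: image_Un)
qed

lemma stage_step:
  assumes d: "0 < d" and e: "\<And>j i. e j i < d"
    and hom: "\<And>m. homogeneous d (Suc (c + c * c)) m \<gamma> (\<lambda>u. u)"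
    and db: "delta_bounded d c K \<gamma>"
    and st: "stage d c e \<gamma> i vs M \<rho>"
  shows "\<exists>b M' \<rho>'. stage d c e \<gamma> (Suc i) (vs @ [b]) M' \<rho>'"
proof -
  have vs: "length vs = i" "\<And>v. v \<in> set vs \<Longrightarrow> v \<in> tree d \<and> length v < M"
    "\<And>j j'. j < i \<Longrightarrow> j' < j \<Longrightarrow> length (vs ! j') < length (vs ! j) \<and> vs ! j ! length (vs ! j') = e j j'"
    and \<rho>: "\<And>\<tau>. \<tau> \<in> lev d i \<Longrightarrow> \<rho> \<tau> \<in> tree d \<and> length (\<rho> \<tau>) = M"
    "\<And>\<tau> j. \<tau> \<in> lev d i \<Longrightarrow> j < i \<Longrightarrow> \<rho> \<tau> ! length (vs ! j) = \<tau> ! j"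
    and free: "\<And>X Y Z. X \<subseteq> set vs \<Longrightarrow> Y \<subseteq> set vs \<Longrightarrow> X \<noteq> Y \<Longrightarrow> tails d i \<rho> Z \<Longrightarrow>
      card X + card Z = c \<Longrightarrow> card Y + card Z = c \<Longrightarrow> \<gamma> (X \<union> Z) \<noteq> \<gamma> (Y \<union> Z)"
    using st unfolding stage_def by simp_all
  let ?S = "lev d (Suc i) \<times> {s \<in> tree d. length s < Suc (c + c * c)}"
  \<comment> \<open>These are the triples to be avoided. A tail is recorded in \<open>S\<close> by
    the type of its stem and the remainder, not as a word; so the size of \<open>?I\<close> is known
    before \<open>N\<close> and the new stems are.\<close>
  let ?I = "Pow (set vs) \<times> Pow (set vs) \<times> Pow ?S"
  have finI: "finite ?I" by (simp add: finite_lev finite_tree_below)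
  have finS: "finite ?S" by (simp add: finite_lev finite_tree_below)
  \<comment> \<open>Each triple excludes at most \<open>K\<close> candidates, so one of
    \<open>N\<close> survives.\<close>
  define N where "N = Suc (K * card ?I)"
  define \<tau>0 where "\<tau>0 = map (e i) [0..<i]"
  have \<tau>0: "\<tau>0 \<in> lev d i" using e by (auto simp: \<tau>0_def lev_def tree_def)
  \<comment> \<open>All candidates lie on the stem of the type prescribed by \<open>e i\<close> and
    differ only in length.\<close>
  define cand where "cand t = \<rho> \<tau>0 @ replicate t 0" for t :: nat
  \<comment> \<open>All positions from \<open>M\<close> to \<open>M + N - 1\<close> carry the new
    letter, so a new stem has the right letter at \<open>length (cand t) = M + t\<close> for every
    \<open>t < N\<close>. This allows the stems to be fixed before \<open>t\<close> is
    chosen.\<close>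
  define \<rho>' where "\<rho>' \<tau> = \<rho> (butlast \<tau>) @ replicate N (last \<tau>)" for \<tau> :: "nat list"
  have butlast: "butlast \<tau> \<in> lev d i" "last \<tau> < d" "last \<tau> = \<tau> ! i" "\<And>j. j < i \<Longrightarrow> butlast \<tau> ! j = \<tau> ! j"
    if "\<tau> \<in> lev d (Suc i)" for \<tau>
  proof -
    have \<tau>: "length \<tau> = Suc i" "\<tau> \<in> tree d" "\<tau> \<noteq> []" using that by (auto simp: lev_def)
    then show "last \<tau> = \<tau> ! i" by (simp add: last_conv_nth)
    then show "last \<tau> < d" using tree_nth[OF \<tau>(2)] \<tau>(1) by simp
    show "butlast \<tau> \<in> lev d i" using \<tau> by (simp add: lev_def butlast_conv_take tree_take)
    show "\<And>j. j < i \<Longrightarrow> butlast \<tau> ! j = \<tau> ! j" using \<tau>(1) by (simp add: nth_butlast)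
  qed
  have \<rho>'1: "\<rho>' \<tau> \<in> tree d" "length (\<rho>' \<tau>) = M + N" if "\<tau> \<in> lev d (Suc i)" for \<tau>
    using \<rho>(1)[OF butlast(1)[OF that]] butlast(2)[OF that] by (simp_all add: \<rho>'_def)
  have cand: "cand t \<in> tree d" "length (cand t) = M + t" for t
    using \<rho>(1)[OF \<tau>0] d by (simp_all add: cand_def)
  let ?Z = "\<lambda>S. (\<lambda>(\<tau>, s). \<rho>' \<tau> @ s) ` S"
  have Zt: "z \<in> tree d \<and> M + N \<le> length z" if z: "z \<in> ?Z S" "S \<subseteq> ?S" for z S
  proof -
    obtain \<tau> s where *: "(\<tau>, s) \<in> S" "z = \<rho>' \<tau> @ s" using z(1) by auto
    then have "\<tau> \<in> lev d (Suc i)" "s \<in> tree d" using z(2) by auto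
    then show ?thesis using *(2) \<rho>'1 by simp
  qed
  define bad where "bad = (\<lambda>(X, Y, S). if Suc (card (Y \<union> ?Z S)) = c
    then {t. t < N \<and> \<gamma> (X \<union> ?Z S) = \<gamma> (insert (cand t) (Y \<union> ?Z S))} else {})"
  have card_bad: "card (bad p) \<le> K" if "p \<in> ?I" for p
  proof -
    obtain X Y S where p: "p = (X, Y, S)" by (metis prod_cases3)
    have XYS: "X \<subseteq> set vs" "Y \<subseteq> set vs" "S \<subseteq> ?S" using that unfolding p by auto
    show ?thesis
    proof (cases "Suc (card (Y \<union> ?Z S)) = c")
      case True
      have "card {t. t < N \<and> \<gamma> (X \<union> ?Z S) = \<gamma> (insert (cand t) (Y \<union> ?Z S))} \<le> K"
      proof (rule delta_bounded_card[OF db _ _ True])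
        show "Y \<union> ?Z S \<subseteq> tree d" using XYS(2) vs(2) Zt[OF _ XYS(3)] by blast
        show "finite (Y \<union> ?Z S)"
          using finite_subset[OF XYS(2)] finite_subset[OF XYS(3) finS] by simp
        show "inj_on cand {..<N}" by (rule inj_onI) (simp add: cand_def)
        show "cand t \<in> tree d - (Y \<union> ?Z S)" if "t < N" for t
        proof -
          have "cand t \<notin> Y" using XYS(2) vs(2) cand(2)[of t] by force
          moreover have "cand t \<notin> ?Z S"
          proof
            assume "cand t \<in> ?Z S"
            from Zt[OF this XYS(3)] show False using cand(2)[of t] that by simp
          qed
          ultimately show ?thesis using cand(1) by blast
        qed
      qed
      then show ?thesis using True by (simp add: bad_def p)
    qed (simp add: bad_def p)
  qed
  have "card (\<Union>p\<in>?I. bad p) \<le> (\<Sum>p\<in>?I. card (bad p))" by (rule card_UN_le[OF finI])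
  also have "\<dots> \<le> (\<Sum>p\<in>?I. K)" by (rule sum_mono) (rule card_bad)
  also have "\<dots> = K * card ?I" by simp
  also have "\<dots> < card {..<N}" by (simp add: N_def)
  finally have less: "card (\<Union>p\<in>?I. bad p) < card {..<N}" .
  have "\<not> {..<N} \<subseteq> (\<Union>p\<in>?I. bad p)"
  proof
    assume sub: "{..<N} \<subseteq> (\<Union>p\<in>?I. bad p)"
    have "bad p \<subseteq> {..<N}" for p by (auto simp: bad_def split: prod.splits)
    then have "finite (\<Union>p\<in>?I. bad p)" by (meson UN_least finite_lessThan finite_subset)
    then show False using card_mono[OF _ sub] less by simp
  qed
  then obtain t where t: "t < N" "t \<notin> (\<Union>p\<in>?I. bad p)" by (meson lessThan_iff subsetI)
  define b where "b = cand t"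
  have b: "b \<in> tree d" "length b = M + t" using cand by (simp_all add: b_def)
  have bvs: "b \<notin> set vs" using vs(2) b(2) by force
  have \<rho>tree: "\<And>\<tau>. \<tau> \<in> lev d (Suc i) \<Longrightarrow> \<rho>' \<tau> \<in> tree d \<and> length (\<rho>' \<tau>) = M + N" using \<rho>'1 by blast
  have vsM: "v \<in> tree d \<and> length v < M + N" if "v \<in> insert b (set vs)" for v
    using that vs(2)[of v] b t(1) by auto
  have mixed: "\<gamma> (X \<union> Z) \<noteq> \<gamma> (insert b Y \<union> Z)"
    if X: "X \<subseteq> set vs" and Y: "Y \<subseteq> set vs" and Z: "tails d (Suc i) \<rho>' Z" "card (insert b Y) + card Z = c"
    for X Y Z
  proof (rule stage_mixed[OF d hom \<rho>tree _ _ _ Z])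
    show "v \<in> tree d \<and> length v < M + N" if "v \<in> X \<union> insert b Y" for v
      using that X Y vsM by blast
    show "finite (insert b Y)" using finite_subset[OF Y] by simp
    fix S assume S: "S \<subseteq> ?S" and c: "card (insert b Y \<union> ?Z S) = c"
    have "finite (Y \<union> ?Z S)" using finite_subset[OF Y] finite_subset[OF S finS] by simp
    moreover have "b \<notin> ?Z S"
    proof
      assume "b \<in> ?Z S"
      from Zt[OF this S] show False using b(2) t(1) by simp
    qed
    then have "b \<notin> Y \<union> ?Z S" using bvs Y by blast
    ultimately have "Suc (card (Y \<union> ?Z S)) = c" using c by simp
    moreover have "t \<notin> bad (X, Y, S)" using t(2) X Y S by blast
    ultimately show "\<gamma> (X \<union> ?Z S) \<noteq> \<gamma> (insert b Y \<union> ?Z S)" using t(1) by (simp add: bad_def b_def)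
  qed
  have old_tails: "tails d i \<rho> Z" if Z: "tails d (Suc i) \<rho>' Z" for Z
    unfolding tails_def
  proof (intro conjI ballI)
    show "finite Z" "Z \<subseteq> tree d" using Z by (auto simp: tails_def)
    fix z assume "z \<in> Z"
    then obtain \<tau> where \<tau>: "\<tau> \<in> lev d (Suc i)" "prefix (\<rho>' \<tau>) z"
      using Z unfolding tails_def by blast
    then have "prefix (\<rho> (butlast \<tau>)) z" unfolding \<rho>'_def by (rule_tac append_prefixD)
    then show "\<exists>\<tau>\<in>lev d i. prefix (\<rho> \<tau>) z" using butlast(1)[OF \<tau>(1)] by blast
  qed
  have "stage d c e \<gamma> (Suc i) (vs @ [b]) (M + N) \<rho>'"
    unfolding stage_def
  proof (intro conjI allI impI ballI)
    show "length (vs @ [b]) = Suc i" using vs(1) by simp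
  next
    fix v assume "v \<in> set (vs @ [b])"
    then show "v \<in> tree d" "length v < M + N" using vsM[of v] by auto
  next
    fix j j' assume j: "j < Suc i" "j' < j"
    show "length ((vs @ [b]) ! j') < length ((vs @ [b]) ! j)"
      "(vs @ [b]) ! j ! length ((vs @ [b]) ! j') = e j j'"
    proof -
      have "length ((vs @ [b]) ! j') < length ((vs @ [b]) ! j) \<and>
        (vs @ [b]) ! j ! length ((vs @ [b]) ! j') = e j j'"
      proof (cases "j < i")
        case True then show ?thesis using vs(1,3) j by (simp add: nth_append)
      next
        case False
        then have ji: "j = i" "j' < i" using j by auto
        have l: "length (vs ! j') < M" using vs(1) vs(2)[of "vs ! j'"] ji by simp
        then have "b ! length (vs ! j') = \<rho> \<tau>0 ! length (vs ! j')"
          using \<rho>(1)[OF \<tau>0] by (simp add: b_def cand_def nth_append)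
        also have "\<dots> = e i j'" using \<rho>(2)[OF \<tau>0 ji(2)] ji by (simp add: \<tau>0_def)
        finally show ?thesis using ji l b(2) vs(1) by (simp add: nth_append)
      qed
      then show "length ((vs @ [b]) ! j') < length ((vs @ [b]) ! j)"
        "(vs @ [b]) ! j ! length ((vs @ [b]) ! j') = e j j'" by auto
    qed
  next
    fix \<tau> assume \<tau>: "\<tau> \<in> lev d (Suc i)"
    show "\<rho>' \<tau> \<in> tree d" "length (\<rho>' \<tau>) = M + N" using \<rho>'1[OF \<tau>] by auto
    fix j assume j: "j < Suc i"
    show "\<rho>' \<tau> ! length ((vs @ [b]) ! j) = \<tau> ! j"
    proof (cases "j < i")
      case True
      have "length (vs ! j) < M" using vs(1) vs(2)[of "vs ! j"] True by simp
      then have "\<rho>' \<tau> ! length (vs ! j) = \<rho> (butlast \<tau>) ! length (vs ! j)"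
        using \<rho>(1)[OF butlast(1)[OF \<tau>]] by (simp add: \<rho>'_def nth_append)
      also have "\<dots> = \<tau> ! j" using \<rho>(2)[OF butlast(1)[OF \<tau>] True] butlast(4)[OF \<tau> True] by simp
      finally show ?thesis using True vs(1) by (simp add: nth_append)
    next
      case False
      then have "j = i" using j by simp
      then show ?thesis using vs(1) b(2) t(1) \<rho>(1)[OF butlast(1)[OF \<tau>]] butlast(3)[OF \<tau>]
        by (simp add: \<rho>'_def nth_append)
    qed
  next
    fix X Y Z assume X: "X \<subseteq> set (vs @ [b])" and Y: "Y \<subseteq> set (vs @ [b])" and "X \<noteq> Y"
      and Z: "tails d (Suc i) \<rho>' Z" and cX: "card X + card Z = c" and cY: "card Y + card Z = c"
    have XY: "X - {b} \<subseteq> set vs" "Y - {b} \<subseteq> set vs" using X Y by auto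
    \<comment> \<open>If \<open>b\<close> is in neither set, the previous stage applies. If it is in
      both, it is moved into the tail, since it extends the old stem \<open>\<rho> \<tau>0\<close>.
      If it is in exactly one, the choice of \<open>b\<close> gives the claim.\<close>
    consider "b \<notin> X" "b \<notin> Y" | "b \<in> X" "b \<in> Y" | "b \<notin> X" "b \<in> Y" | "b \<in> X" "b \<notin> Y" by blast
    then show "\<gamma> (X \<union> Z) \<noteq> \<gamma> (Y \<union> Z)"
    proof cases
      case 1
      then show ?thesis using free[OF _ _ \<open>X \<noteq> Y\<close> old_tails[OF Z] cX cY] XY by simp
    next
      case 2
      have bZ: "b \<notin> Z"
      proof
        assume "b \<in> Z"
        then obtain \<tau> where "\<tau> \<in> lev d (Suc i)" "prefix (\<rho>' \<tau>) b" using Z by (auto simp: tails_def)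
        then have "M + N \<le> length b" using \<rho>'1(2) prefix_length_le by metis
        then show False using b(2) t(1) by simp
      qed
      have finZ: "finite Z" using Z by (simp add: tails_def)
      have "prefix (\<rho> \<tau>0) b" by (simp add: b_def cand_def)
      then have tb: "tails d i \<rho> (insert b Z)"
        using old_tails[OF Z] b(1) \<tau>0 unfolding tails_def by auto
      have fin: "finite X" "finite Y" using X Y finite_subset by blast+
      have "card X = Suc (card (X - {b}))" "card Y = Suc (card (Y - {b}))"
        using 2 fin by (simp_all only: card_Suc_Diff1)
      then have "card (X - {b}) + card (insert b Z) = c" "card (Y - {b}) + card (insert b Z) = c"
        using cX cY finZ bZ by simp_all
      then have "\<gamma> ((X - {b}) \<union> insert b Z) \<noteq> \<gamma> ((Y - {b}) \<union> insert b Z)"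
        using \<open>X \<noteq> Y\<close> 2 by (intro free[OF XY _ tb]) blast+
      moreover have "(X - {b}) \<union> insert b Z = X \<union> Z" "(Y - {b}) \<union> insert b Z = Y \<union> Z" using 2 by auto
      ultimately show ?thesis by simp
    next
      case 3
      then have Yb: "insert b (Y - {b}) = Y" by blast
      have Xv: "X \<subseteq> set vs" using XY(1) 3 by simp
      show ?thesis using mixed[OF Xv XY(2) Z] cY unfolding Yb by simp
    next
      case 4
      then have Xb: "insert b (X - {b}) = X" by blast
      have Yv: "Y \<subseteq> set vs" using XY(2) 4 by simp
      show ?thesis using mixed[OF Yv XY(1) Z] cX unfolding Xb by metis
    qed
  qed
  then show ?thesis by blast
qed

lemma rainbow_words_homogeneous:
  fixes e :: "nat \<Rightarrow> nat \<Rightarrow> nat"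
  assumes d: "0 < d" and e: "\<And>j i. e j i < d"
    and hom: "\<And>m. homogeneous d (Suc (c + c * c)) m \<gamma> (\<lambda>u. u)"
    and db: "delta_bounded d c K \<gamma>"
  shows "\<exists>v. (\<forall>j. v j \<in> tree d) \<and>
    (\<forall>j i. i < j \<longrightarrow> length (v i) < length (v j) \<and> v j ! length (v i) = e j i) \<and>
    (\<forall>X Y. X \<subseteq> range v \<longrightarrow> Y \<subseteq> range v \<longrightarrow> finite X \<longrightarrow> finite Y \<longrightarrow>
      card X = c \<longrightarrow> card Y = c \<longrightarrow> X \<noteq> Y \<longrightarrow> \<gamma> X \<noteq> \<gamma> Y)"
proof -
  define P where "P i = (\<lambda>(vs, M, \<rho>). stage d c e \<gamma> i vs M \<rho>)" for i
  have "stage d c e \<gamma> 0 [] 0 (\<lambda>_. [])" by (simp add: stage_def lev_def)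
  then have "P 0 ([], 0, \<lambda>_. [])" by (simp add: P_def)
  moreover have "\<exists>s'. P (Suc i) s' \<and> (\<exists>b. fst s' = fst s @ [b])" if "P i s" for i s
  proof -
    obtain vs M \<rho> where s: "s = (vs, M, \<rho>)" by (metis prod_cases3)
    have "\<exists>b M' \<rho>'. stage d c e \<gamma> (Suc i) (vs @ [b]) M' \<rho>'"
      by (rule stage_step[OF d e hom db]) (use that in \<open>simp add: s P_def\<close>)
    then obtain b M' \<rho>' where "P (Suc i) (vs @ [b], M', \<rho>')" unfolding P_def by auto
    then show ?thesis unfolding s by (intro exI[of _ "(vs @ [b], M', \<rho>')"]) simp
  qed
  ultimately obtain S where S: "\<And>i. P i (S i)" "\<And>i. \<exists>b. fst (S (Suc i)) = fst (S i) @ [b]"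
    using dependent_nat_choice[of P "\<lambda>_ s s'. \<exists>b. fst s' = fst s @ [b]"] by metis
  define vs where "vs i = fst (S i)" for i
  have st: "\<exists>M \<rho>. stage d c e \<gamma> i (vs i) M \<rho>" for i
    using S(1)[of i] by (cases "S i") (auto simp: P_def vs_def)
  have len: "length (vs i) = i" for i using st[of i] by (auto simp: stage_def)
  define v where "v j = vs (Suc j) ! j" for j
  have vs_nth: "vs n ! j = v j" if "j < n" for n j
    using that
  proof (induction n)
    case (Suc n)
    obtain b where b: "vs (Suc n) = vs n @ [b]" using S(2)[of n] by (auto simp: vs_def)
    show ?case
    proof (cases "j = n")
      case False then show ?thesis using Suc b len by (simp add: nth_append)
    qed (simp add: v_def)
  qed simp
  have set_vs: "set (vs n) = v ` {..<n}" for n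
  proof -
    have "vs n = map v [0..<n]" by (rule nth_equalityI) (simp_all add: len vs_nth)
    then show ?thesis by (simp add: atLeast0LessThan)
  qed
  show ?thesis
  proof (intro exI[of _ v] conjI allI impI)
    fix j
    have "v j \<in> set (vs (Suc j))" by (simp add: set_vs)
    then show "v j \<in> tree d" using st[of "Suc j"] by (auto simp: stage_def)
  next
    fix j i :: nat assume ij: "i < j"
    obtain M \<rho> where "stage d c e \<gamma> (Suc j) (vs (Suc j)) M \<rho>" using st by blast
    then have "length (vs (Suc j) ! i) < length (vs (Suc j) ! j) \<and>
        vs (Suc j) ! j ! length (vs (Suc j) ! i) = e j i"
      using ij unfolding stage_def by blast
    then show "length (v i) < length (v j)" "v j ! length (v i) = e j i"
      using ij by (simp_all add: vs_nth)
  next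
    fix X Y assume XY: "X \<subseteq> range v" "Y \<subseteq> range v" "finite X" "finite Y" "card X = c" "card Y = c" "X \<noteq> Y"
    obtain J where J: "finite J" "X \<union> Y = v ` J"
      using finite_subset_image[of "X \<union> Y" v UNIV] XY by auto
    obtain n where "J \<subseteq> {..<n}" using finite_nat_iff_bounded J(1) by blast
    then have sub: "X \<union> Y \<subseteq> set (vs n)" unfolding J(2) set_vs by (rule image_mono)
    obtain M \<rho> where stn: "stage d c e \<gamma> n (vs n) M \<rho>" using st by blast
    have "tails d n \<rho> {}" by (simp add: tails_def)
    then have "\<gamma> (X \<union> {}) \<noteq> \<gamma> (Y \<union> {})"
      using stn sub XY(5-7) unfolding stage_def by (metis Un_subset_iff add.right_neutral card.empty)
    then show "\<gamma> X \<noteq> \<gamma> Y" by simp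
  qed
qed

text \<open>The words are chosen for the colouring pulled back along a homogenizing \<open>g\<close>
  and then mapped by \<open>g\<close>. Strong embeddings keep the order of lengths and the passing
  letters, and \<open>delta_bounded\<close> survives the pullback because \<open>g\<close> is
  injective.\<close>

theorem rainbow_words:
  fixes e :: "nat \<Rightarrow> nat \<Rightarrow> nat"
  assumes d: "0 < d" and e: "\<And>j i. e j i < d" and db: "delta_bounded d c K \<gamma>"
  shows "\<exists>v. (\<forall>j. v j \<in> tree d) \<and>
    (\<forall>j i. i < j \<longrightarrow> length (v i) < length (v j) \<and> v j ! length (v i) = e j i) \<and>
    (\<forall>X Y. X \<subseteq> range v \<longrightarrow> Y \<subseteq> range v \<longrightarrow> finite X \<longrightarrow> finite Y \<longrightarrow>
      card X = c \<longrightarrow> card Y = c \<longrightarrow> X \<noteq> Y \<longrightarrow> \<gamma> X \<noteq> \<gamma> Y)"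
proof -
  obtain g where g: "semb d 0 g" "\<And>m. homogeneous d (Suc (c + c * c)) m \<gamma> g"
    using ex_homogeneous[OF d] by metis
  have inj: "inj g" by (rule semb_inj[OF g(1)])
  let ?\<gamma> = "\<lambda>X. \<gamma> (g ` X)"
  have hom: "homogeneous d (Suc (c + c * c)) m ?\<gamma> (\<lambda>u. u)" for m
    using g(2)[of m] by (simp add: homogeneous_def image_image)
  have db': "delta_bounded d c K ?\<gamma>"
    unfolding delta_bounded_def
  proof (intro allI impI)
    fix W T assume W: "W \<subseteq> tree d" "finite W" "Suc (card W) = c" and T: "T \<subseteq> tree d - W" "card T = Suc K"
    have inj': "inj_on g A" for A using inj by (rule inj_on_subset) simp
    have "g ` W \<subseteq> tree d" using W(1) semb_tree[OF g(1)] by blast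
    moreover have "finite (g ` W)" "Suc (card (g ` W)) = c" "card (g ` T) = Suc K"
      using W(2,3) T(2) card_image[OF inj'] by auto
    moreover have "g ` T \<subseteq> tree d - g ` W"
      using T(1) semb_tree[OF g(1)] injD[OF inj] by blast
    ultimately have "\<exists>b\<in>g ` T. \<exists>b'\<in>g ` T. \<gamma> (insert b (g ` W)) \<noteq> \<gamma> (insert b' (g ` W))"
      by (intro db[unfolded delta_bounded_def, rule_format])
    then show "\<exists>b\<in>T. \<exists>b'\<in>T. \<gamma> (g ` insert b W) \<noteq> \<gamma> (g ` insert b' W)" by simp
  qed
  have "\<exists>v. (\<forall>j. v j \<in> tree d) \<and>
    (\<forall>j i. i < j \<longrightarrow> length (v i) < length (v j) \<and> v j ! length (v i) = e j i) \<and>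
    (\<forall>X Y. X \<subseteq> range v \<longrightarrow> Y \<subseteq> range v \<longrightarrow> finite X \<longrightarrow> finite Y \<longrightarrow>
      card X = c \<longrightarrow> card Y = c \<longrightarrow> X \<noteq> Y \<longrightarrow> ?\<gamma> X \<noteq> ?\<gamma> Y)"
    by (rule rainbow_words_homogeneous[OF d e hom db'])
  then obtain v where v: "\<forall>j. v j \<in> tree d"
    "\<forall>j i. i < j \<longrightarrow> length (v i) < length (v j) \<and> v j ! length (v i) = e j i"
    and free: "\<forall>X Y. X \<subseteq> range v \<longrightarrow> Y \<subseteq> range v \<longrightarrow> finite X \<longrightarrow> finite Y \<longrightarrow>
      card X = c \<longrightarrow> card Y = c \<longrightarrow> X \<noteq> Y \<longrightarrow> ?\<gamma> X \<noteq> ?\<gamma> Y"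
    by (elim exE conjE)
  show ?thesis
  proof (intro exI[of _ "\<lambda>j. g (v j)"] conjI allI impI)
    show "g (v j) \<in> tree d" for j using semb_tree[OF g(1) v(1)[rule_format]] .
    show "length (g (v i)) < length (g (v j))" "g (v j) ! length (g (v i)) = e j i" if "i < j" for j i
      using semb_passing[OF g(1), of "v i" "v j"] v(2)[rule_format, OF that] by simp_all
    fix X Y assume XY: "X \<subseteq> range (\<lambda>j. g (v j))" "Y \<subseteq> range (\<lambda>j. g (v j))" "finite X" "finite Y"
      "card X = c" "card Y = c" "X \<noteq> Y"
    have pre: "\<exists>X'. X' \<subseteq> range v \<and> finite X' \<and> card X' = card X \<and> X = g ` X'"
      if X: "X \<subseteq> range (\<lambda>j. g (v j))" "finite X" for X
    proof -
      have "X \<subseteq> g ` range v" using X(1) by (simp add: image_image)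
      then obtain X' where X': "X' \<subseteq> range v" "finite X'" "X = g ` X'"
        using finite_subset_image[OF X(2)] by metis
      have "card X = card X'" unfolding X'(3) by (rule card_image) (rule inj_on_subset[OF inj subset_UNIV])
      then show ?thesis using X' by metis
    qed
    obtain X' where X': "X' \<subseteq> range v" "finite X'" "card X' = card X" "X = g ` X'"
      using pre[OF XY(1,3)] by metis
    obtain Y' where Y': "Y' \<subseteq> range v" "finite Y'" "card Y' = card Y" "Y = g ` Y'"
      using pre[OF XY(2,4)] by metis
    have "X' \<noteq> Y'" using XY(7) X'(4) Y'(4) by blast
    then show "\<gamma> X \<noteq> \<gamma> Y"
      using free[rule_format, OF X'(1) Y'(1) X'(2) Y'(2)] X'(3,4) Y'(3,4) XY(5,6) by simp
  qed
qed

section \<open>Structures coded by words\<close>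

text \<open>
  The letter \<open>p\<close> of a word \<open>y\<close> at position \<open>length x\<close> codes the relations between \<open>x\<close> and \<open>y\<close>: \<open>fwd\<close> gives
  the \<open>q\<close> with \<open>E_q(x, y)\<close> and \<open>bwd\<close> those with \<open>E_q(y, x)\<close>. One letter is needed even for \<open>n = 0\<close>, to
  have an infinite tree.
\<close>

definition fwd :: "nat \<Rightarrow> nat \<Rightarrow> nat \<Rightarrow> nat \<Rightarrow> bool" where
  "fwd n m p q \<longleftrightarrow> q < n \<and> (p < m \<and> q = p \<or> m \<le> p \<and> even (p - m) \<and> q = m + (p - m) div 2)"

definition bwd :: "nat \<Rightarrow> nat \<Rightarrow> nat \<Rightarrow> nat \<Rightarrow> bool" where
  "bwd n m p q \<longleftrightarrow> q < n \<and> (p < m \<and> q = p \<or> m \<le> p \<and> odd (p - m) \<and> q = m + (p - m) div 2)"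

definition letters :: "nat \<Rightarrow> nat \<Rightarrow> nat" where
  "letters n m = max 1 (deg n m)"

section \<open>Translation between structures and words\<close>

lemma nm_structureD:
  assumes "nm_structure n m A"
  shows nm_bounded: "n \<le> i \<Longrightarrow> x \<in> univ A \<Longrightarrow> y \<in> univ A \<Longrightarrow> \<not> rel A i x y"
    and nm_irrefl: "i < n \<Longrightarrow> x \<in> univ A \<Longrightarrow> \<not> rel A i x x"
    and nm_sym: "i < m \<Longrightarrow> x \<in> univ A \<Longrightarrow> y \<in> univ A \<Longrightarrow> rel A i x y \<Longrightarrow> rel A i y x"
    and nm_asym: "m \<le> i \<Longrightarrow> i < n \<Longrightarrow> x \<in> univ A \<Longrightarrow> y \<in> univ A \<Longrightarrow> rel A i x y \<Longrightarrow> \<not> rel A i y x"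
    and nm_disjoint: "i < n \<Longrightarrow> j < n \<Longrightarrow> x \<in> univ A \<Longrightarrow> y \<in> univ A \<Longrightarrow> i \<noteq> j \<Longrightarrow> x \<noteq> y \<Longrightarrow>
      rel A i x y \<Longrightarrow> \<not> rel A j x y \<and> \<not> rel A j y x"
    and nm_total: "n \<noteq> 0 \<Longrightarrow> x \<in> univ A \<Longrightarrow> y \<in> univ A \<Longrightarrow> x \<noteq> y \<Longrightarrow> \<exists>i<n. rel A i x y \<or> rel A i y x"
  by (use assms[unfolded nm_structure_def] in \<open>elim conjE, meson\<close>)+

lemma nm_rel_eq:
  assumes "nm_structure n m R" "x \<in> univ R" "y \<in> univ R" "x \<noteq> y"
    and "rel R i x y \<or> rel R i y x" "rel R j x y \<or> rel R j y x"
  shows "i = j" "i < n"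
proof -
  have n: "i < n" "j < n" using nm_bounded[OF assms(1)] assms(2,3,5,6) by (meson not_le)+
  then show "i < n" by simp
  show "i = j"
  proof (rule ccontr)
    assume "i \<noteq> j"
    then have "\<not> (rel R i a b \<and> (rel R j a b \<or> rel R j b a))"
      if "a \<in> univ R" "b \<in> univ R" "a \<noteq> b" for a b
      using nm_disjoint[OF assms(1) n that(1,2) \<open>i \<noteq> j\<close> that(3)] by blast
    then show False using assms(2-6) by metis
  qed
qed

text \<open>For \<open>n \<noteq> 0\<close> exactly one relation holds between two distinct points,
  in both directions if it is symmetric and in one otherwise; letters enumerate these
  \<open>m + 2 * (n - m)\<close> cases. For \<open>n = 0\<close> the only letter codes the absence
  of relations.\<close>

lemma letter_exists:
  assumes nm: "nm_structure n m R" and "m \<le> n" and xy: "x \<in> univ R" "y \<in> univ R" "x \<noteq> y"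
  shows "\<exists>p<letters n m. \<forall>q. (rel R q x y \<longleftrightarrow> fwd n m p q) \<and> (rel R q y x \<longleftrightarrow> bwd n m p q)"
proof (cases "n = 0")
  case True
  then have "\<not> rel R q x y" "\<not> rel R q y x" for q
    using nm_bounded[OF nm] xy by simp_all
  then show ?thesis using True by (intro exI[of _ 0]) (simp add: letters_def fwd_def bwd_def)
next
  case False
  then obtain i where i: "i < n" "rel R i x y \<or> rel R i y x"
    using nm_total[OF nm False xy] by blast
  have uniq: "q = i" if "rel R q x y \<or> rel R q y x" for q
    using nm_rel_eq(1)[OF nm xy that i(2)] .
  show ?thesis
  proof (cases "i < m")
    case True
    then have "rel R i x y \<and> rel R i y x" using nm_sym[OF nm True] xy i(2) by blast
    then have "rel R q x y \<longleftrightarrow> q = i" "rel R q y x \<longleftrightarrow> q = i" for q using uniq by blast+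
    then show ?thesis using True i(1)
      by (intro exI[of _ i]) (auto simp: letters_def deg_def fwd_def bwd_def)
  next
    case im: False
    have asym: "\<not> (rel R i x y \<and> rel R i y x)"
      using nm_asym[OF nm _ i(1) xy(1,2)] im by auto
    show ?thesis
    proof (cases "rel R i x y")
      case True
      then have "rel R q x y \<longleftrightarrow> q = i" "\<not> rel R q y x" for q using uniq asym by blast+
      then show ?thesis using im i(1)
        by (intro exI[of _ "m + 2 * (i - m)"]) (auto simp: letters_def deg_def fwd_def bwd_def)
    next
      case False
      then have "rel R i y x" using i(2) by blast
      then have "rel R q y x \<longleftrightarrow> q = i" "\<not> rel R q x y" for q using uniq False by blast+
      then show ?thesis using im i(1)
        by (intro exI[of _ "m + (2 * (i - m) + 1)"]) (auto simp: letters_def deg_def fwd_def bwd_def)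
    qed
  qed
qed

lemma copies_induced: "copies (induced R X) C = {Y \<in> copies R C. Y \<subseteq> X}" if "X \<subseteq> univ R"
proof -
  have "isomorphic (induced (induced R X) Y) C \<longleftrightarrow> isomorphic (induced R Y) C" if "Y \<subseteq> X" for Y
  proof -
    have "induced (induced R X) Y = induced R Y"
      using that by (auto simp: induced_def fun_eq_iff)
    then show ?thesis by simp
  qed
  then show ?thesis using that by (auto simp: copies_def induced_def)
qed

lemma copies_finite_card:
  assumes "Y \<in> copies R (induced R F)" "finite F"
  shows "finite Y" "card Y = card F"
proof -
  obtain f where "bij_betw f Y F"
    using assms(1) by (auto simp: copies_def isomorphic_def isomorphism_def induced_def)
  then show "finite Y" "card Y = card F"
    using assms(2) bij_betw_finite bij_betw_same_card by blast+
qed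

text \<open>Sets that are not mapped to copies get pairwise different odd colours.\<close>

lemma k_delta_imp_delta_bounded:
  fixes R :: "'a binstr" and \<gamma> :: "'a set \<Rightarrow> nat" and h :: "nat list \<Rightarrow> 'a"
  assumes kd: "k_delta K R C \<gamma>" and K: "1 \<le> K" and h: "inj_on h (tree d)"
  defines "\<gamma>' \<equiv> \<lambda>X. if h ` X \<in> copies R C then 2 * \<gamma> (h ` X)
    else Suc (2 * to_nat_on {X. finite X} X)"
  shows "delta_bounded d c K \<gamma>'"
  unfolding delta_bounded_def
proof (intro allI impI)
  fix W T assume W: "W \<subseteq> tree d" "finite W" and T: "T \<subseteq> tree d - W" "card T = Suc K"
  show "\<exists>b\<in>T. \<exists>b'\<in>T. \<gamma>' (insert b W) \<noteq> \<gamma>' (insert b' W)"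
  proof (rule ccontr)
    assume neg: "\<not> ?thesis"
    \<comment> \<open>Here \<open>1 \<le> K\<close> enters: two different members of
      \<open>T\<close> identify the kernel of the delta-system and rule out sets that are no
      copies.\<close>
    have "2 \<le> card T" using T(2) K by simp
    then obtain B where B: "B \<subseteq> T" "card B = 2" by (rule obtain_subset_with_card_n)
    then obtain b0 b1 where b01: "b0 \<in> T" "b1 \<in> T" "b0 \<noteq> b1" by (auto simp: card_2_iff)
    have eq: "\<gamma>' (insert b W) = \<gamma>' (insert b' W)" if "b \<in> T" "b' \<in> T" for b b'
      using neg that by blast
    \<comment> \<open>An odd colour determines its set, so two different sets cannot share
      it.\<close>
    have mem: "h ` insert b W \<in> copies R C" if b: "b \<in> T" for b
    proof (rule ccontr)
      assume no: "h ` insert b W \<notin> copies R C"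
      obtain b' where b': "b' \<in> T" "b' \<noteq> b" using b01 by metis
      have odd: "odd (\<gamma>' (insert b W))" using no by (simp add: \<gamma>'_def)
      then have no': "h ` insert b' W \<notin> copies R C"
        using eq[OF b b'(1)] by (auto simp: \<gamma>'_def split: if_splits)
      have "to_nat_on {X. finite X} (insert b W) = to_nat_on {X. finite X} (insert b' W)"
        using eq[OF b b'(1)] no no' by (simp add: \<gamma>'_def)
      moreover have "countable {X :: nat list set. finite X}" by (rule countable_Collect_finite)
      ultimately have "insert b W = insert b' W"
        using W(2) by (subst (asm) to_nat_on_inj) simp_all
      then show False using b b' T(1) by blast
    qed
    define S where "S = (\<lambda>b. h ` insert b W) ` T"
    have hT: "h b \<notin> h ` W" if "b \<in> T" for b
    proof
      assume "h b \<in> h ` W"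
      then obtain w where "w \<in> W" "h b = h w" by blast
      then have "b = w" using inj_onD[OF h, of b w] that T(1) W(1) by blast
      then show False using that T(1) \<open>w \<in> W\<close> by blast
    qed
    have hinj: "inj_on h T" using h by (rule inj_on_subset) (use T(1) in blast)
    have "inj_on (\<lambda>b. h ` insert b W) T"
    proof (rule inj_onI)
      fix b b' assume *: "b \<in> T" "b' \<in> T" "h ` insert b W = h ` insert b' W"
      then have "h b \<in> insert (h b') (h ` W)" by auto
      then show "b = b'" using hT *(1,2) inj_onD[OF hinj] by blast
    qed
    then have "card S = K + 1" unfolding S_def using T(2) by (simp add: card_image)
    moreover have "delta_system R C S"
      unfolding delta_system_def
    proof (intro conjI ballI)
      show "S \<subseteq> copies R C" using mem by (auto simp: S_def)
      have ne: "h b0 \<noteq> h b1" using b01 inj_onD[OF hinj] by blast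
      have int: "\<Inter>S = h ` W"
      proof
        have "\<Inter>S \<subseteq> h ` insert b0 W \<inter> h ` insert b1 W" using b01 by (auto simp: S_def)
        also have "\<dots> \<subseteq> h ` W" using ne by auto
        finally show "\<Inter>S \<subseteq> h ` W" .
        show "h ` W \<subseteq> \<Inter>S" by (auto simp: S_def)
      qed
      fix X assume "X \<in> S"
      then obtain b where b: "b \<in> T" "X = h ` insert b W" by (auto simp: S_def)
      have "X - \<Inter>S = {h b}" unfolding int b(2) using hT[OF b(1)] by auto
      then show "is_singleton (X - \<Inter>S)" by (simp add: is_singleton_def)
    qed
    moreover have "\<forall>X\<in>S. \<gamma> X = \<gamma> (h ` insert b0 W)"
    proof
      fix X assume "X \<in> S"
      then obtain b where b: "b \<in> T" "X = h ` insert b W" by (auto simp: S_def)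
      show "\<gamma> X = \<gamma> (h ` insert b0 W)"
        using eq[OF b(1) b01(1)] mem[OF b(1)] mem[OF b01(1)] b(2) by (simp add: \<gamma>'_def)
    qed
    ultimately show False using kd unfolding k_delta_def by metis
  qed
qed

text \<open>Enumerate \<open>R\<close> as \<open>r 0\<close>, \<open>r 1\<close> and so on, and let
  \<open>e j i\<close> be the letter that codes the pair of \<open>r i\<close> and
  \<open>r j\<close>. Words with these letters are mapped by \<open>h\<close> onto an induced copy
  of \<open>R\<close>, in which different copies of \<open>F\<close> come from different sets of
  \<open>card F\<close> words.\<close>

theorem rainbow_copy:
  fixes R :: "'a binstr" and h :: "nat list \<Rightarrow> 'a"
  assumes mn: "m \<le> n" and R: "countable (univ R)" "infinite (univ R)" "nm_structure n m R"
    and h: "inj_on h (tree (letters n m))" "h ` tree (letters n m) \<subseteq> univ R"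
    and h_rel: "\<And>x y q. x \<in> tree (letters n m) \<Longrightarrow> y \<in> tree (letters n m) \<Longrightarrow> length x < length y \<Longrightarrow>
      (rel R q (h x) (h y) \<longleftrightarrow> fwd n m (y ! length x) q) \<and> (rel R q (h y) (h x) \<longleftrightarrow> bwd n m (y ! length x) q)"
    and F: "finite F" and kd: "1 \<le> K" "k_delta K R (induced R F) \<gamma>"
  shows "\<exists>X\<in>copies R R. inj_on \<gamma> (copies (induced R X) (induced R F))"
proof -
  let ?d = "letters n m" and ?C = "induced R F"
  define r where "r = from_nat_into (univ R)"
  have r: "bij_betw r UNIV (univ R)" unfolding r_def by (rule bij_betw_from_nat_into[OF R(1,2)])
  have r_mem: "r i \<in> univ R" for i using r by (auto simp: bij_betw_def)
  have r_inj: "r i = r j \<longleftrightarrow> i = j" for i j using r by (auto simp: bij_betw_def inj_def)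
  define L where "L j i p \<longleftrightarrow> p < ?d \<and> (\<forall>q. (rel R q (r i) (r j) \<longleftrightarrow> fwd n m p q) \<and>
    (rel R q (r j) (r i) \<longleftrightarrow> bwd n m p q))" for j i p
  define e where "e j i = (if i < j then (SOME p. L j i p) else 0)" for j i
  have eL: "L j i (e j i)" if "i < j" for j i
  proof -
    have "\<exists>p. L j i p"
      using letter_exists[OF R(3) mn r_mem r_mem, of i j] that r_inj unfolding L_def by auto
    then show ?thesis using that unfolding e_def by (simp add: someI_ex)
  qed
  have e: "e j i < ?d" for j i
  proof (cases "i < j")
    case True then show ?thesis using eL unfolding L_def by blast
  qed (simp add: e_def letters_def)
  have d: "0 < ?d" by (simp add: letters_def)
  define \<gamma>' where "\<gamma>' = (\<lambda>X. if h ` X \<in> copies R ?C then 2 * \<gamma> (h ` X)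
    else Suc (2 * to_nat_on {X. finite X} X))"
  have db: "delta_bounded ?d (card F) K \<gamma>'"
    unfolding \<gamma>'_def by (rule k_delta_imp_delta_bounded[OF kd(2,1) h(1)])
  have "\<exists>v. (\<forall>j. v j \<in> tree ?d) \<and>
    (\<forall>j i. i < j \<longrightarrow> length (v i) < length (v j) \<and> v j ! length (v i) = e j i) \<and>
    (\<forall>X Y. X \<subseteq> range v \<longrightarrow> Y \<subseteq> range v \<longrightarrow> finite X \<longrightarrow> finite Y \<longrightarrow>
      card X = card F \<longrightarrow> card Y = card F \<longrightarrow> X \<noteq> Y \<longrightarrow> \<gamma>' X \<noteq> \<gamma>' Y)"
    by (rule rainbow_words[OF d e db])
  then obtain v where v: "\<forall>j. v j \<in> tree ?d"
    "\<forall>j i. i < j \<longrightarrow> length (v i) < length (v j) \<and> v j ! length (v i) = e j i"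
    and free: "\<forall>X Y. X \<subseteq> range v \<longrightarrow> Y \<subseteq> range v \<longrightarrow> finite X \<longrightarrow> finite Y \<longrightarrow>
      card X = card F \<longrightarrow> card Y = card F \<longrightarrow> X \<noteq> Y \<longrightarrow> \<gamma>' X \<noteq> \<gamma>' Y"
    by (elim exE conjE)
  have v_inj: "v i \<noteq> v j" if "i < j" for i j using v(2)[rule_format, OF that] by auto
  have v_less: "rel R q (h (v i)) (h (v j)) \<longleftrightarrow> rel R q (r i) (r j)"
    "rel R q (h (v j)) (h (v i)) \<longleftrightarrow> rel R q (r j) (r i)" if "i < j" for i j q
    using h_rel[OF v(1)[rule_format] v(1)[rule_format], of i j q] v(2)[rule_format, OF that] eL[OF that]
    unfolding L_def by simp_all
  define g where "g i = h (v i)" for i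
  have g_inj: "inj g"
  proof (rule injI)
    fix i j assume "g i = g j"
    then have "v i = v j" using inj_onD[OF h(1)] v(1) unfolding g_def by blast
    then show "i = j" using v_inj[of i j] v_inj[of j i] by (metis linorder_neqE_nat)
  qed
  have irrefl: "\<not> rel R q x x" if "x \<in> univ R" for q x
    using nm_bounded[OF R(3), of q x x] nm_irrefl[OF R(3), of q x] that by (cases "q < n") auto
  have g_mem: "g i \<in> univ R" for i using h(2) v(1) unfolding g_def by blast
  have g_rel: "rel R q (g i) (g j) \<longleftrightarrow> rel R q (r i) (r j)" for q i j
    using v_less[of i j q] v_less[of j i q] irrefl[OF g_mem] irrefl[OF r_mem] unfolding g_def
    by (metis linorder_neqE_nat)
  let ?X = "range g"
  have X_sub: "?X \<subseteq> univ R" using g_mem by blast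
  have "isomorphism (r \<circ> inv g) (induced R ?X) R"
    unfolding isomorphism_def
  proof (intro conjI allI ballI)
    have "bij_betw (inv g) (range g) UNIV" using g_inj by (simp add: inj_imp_bij_betw_inv)
    then have "bij_betw (r \<circ> inv g) ?X (univ R)" using r by (rule bij_betw_trans)
    then show "bij_betw (r \<circ> inv g) (univ (induced R ?X)) (univ R)" by (simp add: induced_def)
    fix q x y assume "x \<in> univ (induced R ?X)" "y \<in> univ (induced R ?X)"
    then obtain i j where "x = g i" "y = g j" by (auto simp: induced_def)
    then show "rel (induced R ?X) q x y \<longleftrightarrow> rel R q ((r \<circ> inv g) x) ((r \<circ> inv g) y)"
      using g_rel g_inj by (simp add: induced_def)
  qed
  then have "?X \<in> copies R R" using X_sub unfolding copies_def isomorphic_def by blast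
  moreover have "inj_on \<gamma> (copies (induced R ?X) ?C)"
  proof (rule inj_onI, rule ccontr)
    fix Y1 Y2 assume Y: "Y1 \<in> copies (induced R ?X) ?C" "Y2 \<in> copies (induced R ?X) ?C"
      and eq: "\<gamma> Y1 = \<gamma> Y2" and ne: "Y1 \<noteq> Y2"
    have pre: "\<exists>Z. Z \<subseteq> range v \<and> finite Z \<and> card Z = card F \<and> h ` Z = Y \<and> \<gamma>' Z = 2 * \<gamma> Y"
      if Y: "Y \<in> copies (induced R ?X) ?C" for Y
    proof -
      have Y': "Y \<in> copies R ?C" "Y \<subseteq> ?X" using Y copies_induced[OF X_sub] by auto
      have fin: "finite Y" "card Y = card F" by (rule copies_finite_card[OF Y'(1) F])+
      have "Y \<subseteq> h ` range v" using Y'(2) by (auto simp: g_def)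
      then obtain Z where Z: "Z \<subseteq> range v" "finite Z" "Y = h ` Z"
        using finite_subset_image[OF fin(1)] by metis
      have "Z \<subseteq> tree ?d" using Z(1) v(1) by blast
      then have "card Y = card Z" unfolding Z(3) by (intro card_image inj_on_subset[OF h(1)])
      moreover have "\<gamma>' Z = 2 * \<gamma> Y" using Y'(1) Z(3) by (simp add: \<gamma>'_def)
      ultimately show ?thesis using Z fin(2) by metis
    qed
    obtain Z1 where Z1: "Z1 \<subseteq> range v" "finite Z1" "card Z1 = card F" "h ` Z1 = Y1" "\<gamma>' Z1 = 2 * \<gamma> Y1"
      using pre[OF Y(1)] by metis
    obtain Z2 where Z2: "Z2 \<subseteq> range v" "finite Z2" "card Z2 = card F" "h ` Z2 = Y2" "\<gamma>' Z2 = 2 * \<gamma> Y2"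
      using pre[OF Y(2)] by metis
    have "Z1 \<noteq> Z2" using ne Z1(4) Z2(4) by blast
    then have "\<gamma>' Z1 \<noteq> \<gamma>' Z2" using free[rule_format, OF Z1(1) Z2(1) Z1(2) Z2(2) Z1(3) Z2(3)] by simp
    then show False using Z1(5) Z2(5) eq by simp
  qed
  ultimately show ?thesis by blast
qed

text \<open>The maximum takes care of \<open>k = 0\<close>, since the delta condition is only used
  from 1 on.\<close>

lemma k_bounded_imp_k_delta:
  assumes "k_bounded k R C \<gamma>"
  shows "k_delta (max 1 k) R C \<gamma>"
  unfolding k_delta_def
proof
  assume "\<exists>S. delta_system R C S \<and> card S = max 1 k + 1 \<and> (\<exists>j. \<forall>X\<in>S. \<gamma> X = j)"
  then obtain S j where S: "S \<subseteq> copies R C" "card S = max 1 k + 1" "\<forall>X\<in>S. \<gamma> X = j"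
    unfolding delta_system_def by blast
  have "S \<subseteq> {X \<in> copies R C. \<gamma> X = j}" using S by blast
  moreover have "finite {X \<in> copies R C. \<gamma> X = j}" "card {X \<in> copies R C. \<gamma> X = j} \<le> k"
    using assms unfolding k_bounded_def by blast+
  ultimately have "card S \<le> k" using card_mono order_trans by metis
  then show False using S(2) by simp
qed

theorem rainbow_Ramsey_if_tree_embeds:
  fixes R :: "'a binstr" and h :: "nat list \<Rightarrow> 'a"
  assumes mn: "m \<le> n" and R: "countable (univ R)" "infinite (univ R)" "nm_structure n m R"
    and h: "inj_on h (tree (letters n m))" "h ` tree (letters n m) \<subseteq> univ R"
    and h_rel: "\<And>x y q. x \<in> tree (letters n m) \<Longrightarrow> y \<in> tree (letters n m) \<Longrightarrow> length x < length y \<Longrightarrow>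
      (rel R q (h x) (h y) \<longleftrightarrow> fwd n m (y ! length x) q) \<and> (rel R q (h y) (h x) \<longleftrightarrow> bwd n m (y ! length x) q)"
  shows "rainbow_Ramsey R \<and> delta_rainbow_Ramsey R"
proof -
  note copy = rainbow_copy[OF mn R h h_rel]
  show ?thesis
    unfolding rainbow_Ramsey_def delta_rainbow_Ramsey_def
  proof (intro conjI allI impI R)
    fix F k \<gamma>
    assume "F \<subseteq> univ R \<and> finite F \<and> k_bounded k R (induced R F) \<gamma>"
    then show "\<exists>X\<in>copies R R. inj_on \<gamma> (copies (induced R X) (induced R F))"
      using k_bounded_imp_k_delta by (intro copy[where K = "max 1 k"]) auto
  next
    fix F k \<gamma>
    assume "F \<subseteq> univ R \<and> finite F \<and> 1 \<le> k \<and> k_delta k R (induced R F) \<gamma>"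
    then show "\<exists>X\<in>copies R R. inj_on \<gamma> (copies (induced R X) (induced R F))"
      by (intro copy[where K = k]) auto
  qed
qed

section \<open>Structures coded by a total asymmetric relation and letters\<close>

definition coded :: "nat \<Rightarrow> nat \<Rightarrow> ('a \<Rightarrow> 'a \<Rightarrow> bool) \<Rightarrow> ('a \<Rightarrow> 'a \<Rightarrow> nat) \<Rightarrow> nat \<Rightarrow> 'a \<Rightarrow> 'a \<Rightarrow> bool" where
  "coded n m lt l q x y \<longleftrightarrow> lt x y \<and> fwd n m (l x y) q \<or> lt y x \<and> bwd n m (l y x) q"

lemma fwd_bwd_bounded: "fwd n m p q \<Longrightarrow> q < n" "bwd n m p q \<Longrightarrow> q < n"
  by (simp_all add: fwd_def bwd_def)

lemma fwd_bwd_sym: "q < m \<Longrightarrow> fwd n m p q \<longleftrightarrow> bwd n m p q"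
  by (auto simp: fwd_def bwd_def)

lemma fwd_bwd_asym: "m \<le> q \<Longrightarrow> \<not> (fwd n m p q \<and> bwd n m p q)"
  by (auto simp: fwd_def bwd_def)

lemma fwd_bwd_unique:
  "fwd n m p q \<or> bwd n m p q \<Longrightarrow> fwd n m p q' \<or> bwd n m p q' \<Longrightarrow> q = q'"
  by (auto simp: fwd_def bwd_def)

lemma fwd_bwd_total:
  assumes "m \<le> n" "n \<noteq> 0" "p < letters n m"
  shows "\<exists>q<n. fwd n m p q \<or> bwd n m p q"
proof -
  have p: "p < m + 2 * (n - m)" using assms by (auto simp: letters_def deg_def)
  show ?thesis
  proof (cases "p < m")
    case True then show ?thesis using assms(1) by (intro exI[of _ p]) (auto simp: fwd_def)
  next
    case False
    then have "m + (p - m) div 2 < n" using p by linarith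
    then show ?thesis using False
      by (intro exI[of _ "m + (p - m) div 2"]) (auto simp: fwd_def bwd_def)
  qed
qed

lemma nm_structure_coded:
  assumes "m \<le> n" and irr: "\<And>x. \<not> lt x x"
    and asym: "\<And>x y. x \<in> A \<Longrightarrow> y \<in> A \<Longrightarrow> lt x y \<Longrightarrow> \<not> lt y x"
    and tot: "\<And>x y. x \<in> A \<Longrightarrow> y \<in> A \<Longrightarrow> x \<noteq> y \<Longrightarrow> lt x y \<or> lt y x"
    and l: "\<And>x y. x \<in> A \<Longrightarrow> y \<in> A \<Longrightarrow> l x y < letters n m"
    and S: "univ S = A" "\<And>q x y. x \<in> A \<Longrightarrow> y \<in> A \<Longrightarrow> rel S q x y \<longleftrightarrow> coded n m lt l q x y"
  shows "nm_structure n m S"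
  unfolding nm_structure_def S(1)
proof (intro conjI allI impI ballI)
  fix i x y assume xy: "x \<in> A" "y \<in> A"
  show "\<not> rel S i x y" if "n \<le> i"
    using that fwd_bwd_bounded unfolding S(2)[OF xy] coded_def by (meson not_le)
  show "rel S i y x" if "i < m" "rel S i x y"
    using that(2) fwd_bwd_sym[OF that(1)] unfolding S(2)[OF xy] S(2)[OF xy(2,1)] coded_def by metis
  show "\<not> rel S i y x" if "m \<le> i \<and> i < n" "rel S i x y"
    using that fwd_bwd_asym[of m i n] asym[OF xy] asym[OF xy(2,1)]
    unfolding S(2)[OF xy] S(2)[OF xy(2,1)] coded_def by metis
  fix j assume "i \<noteq> j \<and> x \<noteq> y \<and> rel S i x y"
  then show "\<not> rel S j x y" "\<not> rel S j y x"
    using fwd_bwd_unique asym[OF xy] asym[OF xy(2,1)]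
    unfolding S(2)[OF xy] S(2)[OF xy(2,1)] coded_def by metis+
next
  fix i x assume "x \<in> A"
  then show "\<not> rel S i x x" using irr S(2) by (simp add: coded_def)
next
  fix x y assume "n \<noteq> 0" and xy: "x \<in> A" "y \<in> A" and "x \<noteq> y"
  then consider "lt x y" | "lt y x" using tot by blast
  then show "\<exists>i<n. rel S i x y \<or> rel S i y x"
    using fwd_bwd_total[OF assms(1) \<open>n \<noteq> 0\<close> l[OF xy]] fwd_bwd_total[OF assms(1) \<open>n \<noteq> 0\<close> l[OF xy(2,1)]]
    unfolding S(2)[OF xy] S(2)[OF xy(2,1)] coded_def by cases blast+
qed

section \<open>The structures T(n,m) and D(n,m)\<close>

definition wless :: "nat list \<Rightarrow> nat list \<Rightarrow> bool" where
  "wless x y \<longleftrightarrow> length x < length y \<or> length x = length y \<and> prec x y"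

text \<open>The letter 0, read in the direction of \<open>prec\<close>, reproduces the rule of
  \<open>tree_rel\<close> for words of equal length: symmetric for \<open>m > 0\<close>, directed
  for \<open>m = 0\<close>.\<close>

definition wletter :: "nat list \<Rightarrow> nat list \<Rightarrow> nat" where
  "wletter x y = (if length x < length y then y ! length x else 0)"

lemma wletter_less: "x \<in> tree (letters n m) \<Longrightarrow> y \<in> tree (letters n m) \<Longrightarrow> wletter x y < letters n m"
  using tree_nth[of y "letters n m" "length x"]
  by (cases "length x < length y") (simp_all add: wletter_def, simp add: letters_def max_def)

lemma meet_commute: "longest_common_prefix x y = longest_common_prefix y x"
  by (induction x y rule: longest_common_prefix.induct) auto

lemma meet_self: "longest_common_prefix x x = x"
  by (induction x) auto

lemma not_prec_sym: "prec x y \<Longrightarrow> \<not> prec y x"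
  by (auto simp: prec_def meet_commute)

lemma prec_total:
  assumes "length x = length y" "x \<noteq> y"
  shows "prec x y \<or> prec y x"
proof -
  let ?p = "longest_common_prefix x y"
  have par: "parallel x y" "parallel y x"
    using assms by (auto simp: parallel_def prefix_def)
  have px: "prefix ?p x" "prefix ?p y" by (rule longest_common_prefix_prefix1 longest_common_prefix_prefix2)+
  have "length ?p \<noteq> length x"
  proof
    assume "length ?p = length x"
    then have "\<not> strict_prefix ?p x" "\<not> strict_prefix ?p y"
      using assms(1) prefix_length_less by fastforce+
    then show False using px assms(2) by (metis strict_prefix_def)
  qed
  then have l: "length ?p < length x" using px(1) prefix_length_le by fastforce
  have "x ! length ?p \<noteq> y ! length ?p"
  proof
    assume eq: "x ! length ?p = y ! length ?p"
    have "prefix (?p @ [x ! length ?p]) x" by (rule append_one_prefix[OF px(1) l])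
    moreover have "prefix (?p @ [x ! length ?p]) y"
      unfolding eq using append_one_prefix[OF px(2)] l assms(1) by simp
    ultimately have "prefix (?p @ [x ! length ?p]) ?p" by (rule longest_common_prefix_max_prefix)
    then show False using prefix_length_le by fastforce
  qed
  then show ?thesis using par by (auto simp: prec_def meet_commute)
qed

lemma nm_structure_words:
  assumes "m \<le> n" "univ S = tree (letters n m)"
    and "\<And>q x y. x \<in> tree (letters n m) \<Longrightarrow> y \<in> tree (letters n m) \<Longrightarrow>
      rel S q x y \<longleftrightarrow> coded n m wless wletter q x y"
  shows "nm_structure n m S"
proof (rule nm_structure_coded[OF assms(1) _ _ _ wletter_less assms(2,3)])
  show "\<not> wless x x" for x using not_prec_sym[of x x] by (auto simp: wless_def)
  show "\<not> wless y x" if "wless x y" for x y using that not_prec_sym[of x y] by (auto simp: wless_def)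
  show "wless x y \<or> wless y x" if "x \<noteq> y" for x y using that prec_total[of x y]
    by (auto simp: wless_def)
qed

lemma coded_less:
  assumes "length x < length y"
  shows "coded n m wless wletter q x y \<longleftrightarrow> fwd n m (y ! length x) q"
    "coded n m wless wletter q y x \<longleftrightarrow> bwd n m (y ! length x) q"
  using assms by (auto simp: coded_def wless_def wletter_def)

lemma odd_diff_div: "odd (p - m) \<Longrightarrow> (p - Suc m) div 2 = (p - m) div 2" for p m :: nat
  by presburger

text \<open>The case \<open>n = 0\<close> has to be excluded: \<open>tree_rel\<close> would still
  put the relation 0 between words of equal length, whereas \<open>coded\<close> would be
  empty.\<close>

lemma tree_rel_coded:
  assumes mn: "m \<le> n" "n \<noteq> 0" and xy: "x \<in> tree (letters n m)" "y \<in> tree (letters n m)"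
  shows "tree_rel m q x y \<longleftrightarrow> coded n m wless wletter q x y"
proof -
  have bound: "m + (p - m) div 2 < n" if "m \<le> p" "p < letters n m" for p
    using that mn by (auto simp: letters_def deg_def split: if_splits)
  consider "length x < length y" | "length y < length x" | "length x = length y" by linarith
  then show ?thesis
  proof cases
    case 1
    then have p: "y ! length x < letters n m" using xy tree_nth by blast
    have "tree_rel m q x y \<longleftrightarrow> y ! length x < m \<and> q = y ! length x \<or>
        m \<le> y ! length x \<and> even (y ! length x - m) \<and> q = m + (y ! length x - m) div 2"
      by (subst tree_rel.simps) (use 1 in auto)
    also have "\<dots> \<longleftrightarrow> fwd n m (y ! length x) q" using bound[OF _ p] mn by (auto simp: fwd_def)
    finally show ?thesis using coded_less(1)[OF 1] by simp
  next
    case 2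
    then have p: "x ! length y < letters n m" using xy tree_nth by blast
    have "tree_rel m q x y \<longleftrightarrow> x ! length y < m \<and> q = x ! length y \<or>
        m \<le> x ! length y \<and> odd (x ! length y - m) \<and> q = m + (x ! length y - m) div 2"
      by (subst tree_rel.simps) (use 2 in \<open>auto simp: odd_diff_div\<close>)
    also have "\<dots> \<longleftrightarrow> bwd n m (x ! length y) q" using bound[OF _ p] mn by (auto simp: bwd_def)
    finally show ?thesis using coded_less(2)[OF 2] by simp
  next
    case 3
    have "tree_rel m q x y \<longleftrightarrow> q = 0 \<and> (prec x y \<or> prec y x \<and> 0 < m)"
      by (subst tree_rel.simps) (use 3 in auto)
    also have "\<dots> \<longleftrightarrow> coded n m wless wletter q x y"
      using 3 mn by (auto simp: coded_def wless_def wletter_def fwd_def bwd_def)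
    finally show ?thesis .
  qed
qed

lemma letters_deg: "2 \<le> deg n m \<Longrightarrow> letters n m = deg n m"
  by (simp add: letters_def)

lemma infinite_tree: "0 < d \<Longrightarrow> infinite (tree d)"
proof
  assume "0 < d" "finite (tree d)"
  moreover have "range (\<lambda>i. replicate i 0) \<subseteq> tree d" using \<open>0 < d\<close> by auto
  moreover have "inj (\<lambda>i. replicate i (0 :: nat))" by (rule injI) (metis length_replicate)
  ultimately show False using finite_subset finite_imageD by blast
qed

lemma T_str_coded:
  assumes "m \<le> n" "2 \<le> deg n m" "x \<in> tree (letters n m)" "y \<in> tree (letters n m)"
  shows "rel (T_str n m) q x y \<longleftrightarrow> coded n m wless wletter q x y"
proof -
  have "n \<noteq> 0" using assms(1,2) by (auto simp: deg_def)
  then show ?thesis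
    using tree_rel_coded[OF assms(1) _ assms(3,4)] assms(3,4) letters_deg[OF assms(2)]
    by (simp add: T_str_def)
qed

lemma nm_structure_T: "m \<le> n \<Longrightarrow> 2 \<le> deg n m \<Longrightarrow> nm_structure n m (T_str n m)"
  by (rule nm_structure_words) (simp_all add: T_str_coded letters_deg, simp add: T_str_def letters_deg)

theorem rainbow_T:
  assumes mn: "m \<le> n" and deg: "2 \<le> deg n m"
  shows "rainbow_Ramsey (T_str n m) \<and> delta_rainbow_Ramsey (T_str n m)"
proof (rule rainbow_Ramsey_if_tree_embeds[OF mn _ _ nm_structure_T[OF mn deg], where h = "\<lambda>x. x"])
  have u: "univ (T_str n m) = tree (letters n m)" by (simp add: T_str_def letters_deg[OF deg])
  show "countable (univ (T_str n m))" by simp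
  show "infinite (univ (T_str n m))" unfolding u by (rule infinite_tree) (simp add: letters_def)
  show "(\<lambda>x. x) ` tree (letters n m) \<subseteq> univ (T_str n m)" by (simp add: u)
  show "(rel (T_str n m) q x y \<longleftrightarrow> fwd n m (y ! length x) q) \<and>
      (rel (T_str n m) q y x \<longleftrightarrow> bwd n m (y ! length x) q)"
    if "x \<in> tree (letters n m)" "y \<in> tree (letters n m)" "length x < length y" for x y q
    using that by (simp add: T_str_coded[OF mn deg] coded_less)
qed simp

lemma nm_structure_induced:
  assumes "nm_structure n m A" "X \<subseteq> univ A"
  shows "nm_structure n m (induced A X)"
  unfolding nm_structure_def
proof (intro conjI allI impI ballI)
  fix i x y assume "x \<in> univ (induced A X)" "y \<in> univ (induced A X)"
  then have X: "x \<in> X" "y \<in> X" and xy: "x \<in> univ A" "y \<in> univ A"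
    using assms(2) by (auto simp: induced_def)
  show "\<not> rel (induced A X) i x y" if "n \<le> i"
    using nm_bounded[OF assms(1) that xy] by (simp add: induced_def)
  show "rel (induced A X) i y x" if "i < m" "rel (induced A X) i x y"
    using nm_sym[OF assms(1) that(1) xy] that(2) by (simp add: induced_def)
  show "\<not> rel (induced A X) i y x" if "m \<le> i \<and> i < n" "rel (induced A X) i x y"
    using nm_asym[OF assms(1) _ _ xy] that by (simp add: induced_def)
  show "\<not> rel (induced A X) j x y" "\<not> rel (induced A X) j y x"
    if "i < n" "j < n" "i \<noteq> j \<and> x \<noteq> y \<and> rel (induced A X) i x y" for j
    using nm_disjoint[OF assms(1) that(1,2) xy] that(3) by (simp_all add: induced_def)
  show "\<exists>i<n. rel (induced A X) i x y \<or> rel (induced A X) i y x" if "n \<noteq> 0" "x \<noteq> y"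
    using nm_total[OF assms(1) that(1) xy that(2)] X by (simp add: induced_def)
next
  fix i x assume "i < n" "x \<in> univ (induced A X)"
  then show "\<not> rel (induced A X) i x x"
    using nm_irrefl[OF assms(1)] assms(2) by (auto simp: induced_def)
qed

theorem rainbow_D:
  assumes mn: "m \<le> n" and deg: "2 \<le> deg n m" and f: "strong_diagonalization (deg n m) f"
  shows "rainbow_Ramsey (D_str n m f) \<and> delta_rainbow_Ramsey (D_str n m f)"
proof (rule rainbow_Ramsey_if_tree_embeds[OF mn, where h = f])
  let ?T = "tree (letters n m)"
  note l = letters_deg[OF deg]
  have u: "univ (D_str n m f) = f ` ?T" by (simp add: D_str_def induced_def l)
  note f' = f[unfolded strong_diagonalization_def, folded l]
  have inj: "inj_on f ?T" using f' by (rule conjunct1)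
  have sub: "f ` ?T \<subseteq> ?T" using f'[THEN conjunct2] by (rule conjunct1)
  have len: "\<forall>x\<in>?T. \<forall>y\<in>?T. \<forall>z\<in>?T. \<forall>u\<in>?T.
      length (meet x y) < length (meet z u) \<longrightarrow> length (meet (f x) (f y)) < length (meet (f z) (f u))"
    using f'[THEN conjunct2, THEN conjunct2, THEN conjunct2] by (rule conjunct1)
  have pass: "\<forall>x\<in>?T. \<forall>z\<in>?T. length z > length x \<longrightarrow> z ! length x = f z ! length (f x)"
    using f'[THEN conjunct2, THEN conjunct2, THEN conjunct2, THEN conjunct2] by (rule conjunct1)
  show "countable (univ (D_str n m f))" by simp
  show "infinite (univ (D_str n m f))"
    unfolding u using infinite_tree[of "letters n m"] finite_imageD[OF _ inj] by (auto simp: letters_def)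
  show "nm_structure n m (D_str n m f)"
    unfolding D_str_def
    by (rule nm_structure_induced[OF nm_structure_T[OF mn deg]]) (use sub in \<open>simp add: T_str_def l\<close>)
  show "inj_on f ?T" by (rule inj)
  show "f ` ?T \<subseteq> univ (D_str n m f)" by (simp add: u)
  fix x y q assume xy: "x \<in> ?T" "y \<in> ?T" "length x < length y"
  \<comment> \<open>The condition on meets is used for equal words, where the meet is the word
    itself.\<close>
  have lf: "length (f x) < length (f y)"
    using len[rule_format, OF xy(1,1,2,2)] xy(3) by (simp add: meet_self)
  have "f y ! length (f x) = y ! length x" using pass xy by simp
  moreover have "f x \<in> ?T" "f y \<in> ?T" using sub xy by blast+
  ultimately show "(rel (D_str n m f) q (f x) (f y) \<longleftrightarrow> fwd n m (y ! length x) q) \<and>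
      (rel (D_str n m f) q (f y) (f x) \<longleftrightarrow> bwd n m (y ! length x) q)"
    using xy T_str_coded[OF mn deg] coded_less[OF lf]
    by (simp add: D_str_def induced_def l)
qed

section \<open>The Fraisse limits U(n,m)\<close>

definition embeds_on :: "'b binstr \<Rightarrow> 'a binstr \<Rightarrow> ('b \<Rightarrow> 'a) \<Rightarrow> 'b set \<Rightarrow> bool" where
  "embeds_on P U \<phi> A \<longleftrightarrow> inj_on \<phi> A \<and> \<phi> ` A \<subseteq> univ U \<and>
    (\<forall>q. \<forall>a\<in>A. \<forall>b\<in>A. rel P q a b \<longleftrightarrow> rel U q (\<phi> a) (\<phi> b))"

lemma embeds_onD:
  assumes "embeds_on P U \<phi> A"
  shows "inj_on \<phi> A" "\<phi> ` A \<subseteq> univ U"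
    "a \<in> A \<Longrightarrow> b \<in> A \<Longrightarrow> rel P q a b \<longleftrightarrow> rel U q (\<phi> a) (\<phi> b)"
  by (use assms[unfolded embeds_on_def] in \<open>elim conjE, meson\<close>)+

lemma embeds_on_cong:
  "(\<And>a. a \<in> A \<Longrightarrow> \<phi> a = \<psi> a) \<Longrightarrow> embeds_on P U \<phi> A \<longleftrightarrow> embeds_on P U \<psi> A"
  by (simp add: embeds_on_def cong: inj_on_cong image_cong_simp)

lemma nm_structure_pullback:
  assumes "embeds_on P U \<phi> A" "univ P = A" "nm_structure n m P" "\<phi> ` A = univ U"
  shows "nm_structure n m U"
proof -
  note e = embeds_onD[OF assms(1)] and nm = assms(3)
  have ex: "\<exists>a\<in>A. x = \<phi> a" if "x \<in> univ U" for x using that assms(4) by blast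
  show ?thesis
    unfolding nm_structure_def
  proof (intro conjI allI impI ballI)
    fix i x y assume "x \<in> univ U" "y \<in> univ U"
    then obtain a b where ab: "a \<in> A" "b \<in> A" "x = \<phi> a" "y = \<phi> b" using ex by meson
    have P: "a \<in> univ P" "b \<in> univ P" using ab assms(2) by simp_all
    have r: "rel U q x y \<longleftrightarrow> rel P q a b" "rel U q y x \<longleftrightarrow> rel P q b a" for q
      unfolding ab(3,4) using e(3) ab(1,2) by simp_all
    show "\<not> rel U i x y" if "n \<le> i" using nm_bounded[OF nm that P] r by simp
    show "rel U i y x" if "i < m" "rel U i x y" using nm_sym[OF nm that(1) P] that(2) r by simp
    show "\<not> rel U i y x" if "m \<le> i \<and> i < n" "rel U i x y"
      using nm_asym[OF nm _ _ P] that r by simp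
    show "\<not> rel U j x y" "\<not> rel U j y x" if "i < n" "j < n" "i \<noteq> j \<and> x \<noteq> y \<and> rel U i x y" for j
      using nm_disjoint[OF nm that(1,2) P] that(3) r ab by auto
    show "\<exists>i<n. rel U i x y \<or> rel U i y x" if "n \<noteq> 0" "x \<noteq> y"
      using nm_total[OF nm that(1) P] that(2) r ab by auto
  next
    fix i x assume "i < n" "x \<in> univ U"
    then obtain a where "a \<in> A" "x = \<phi> a" using ex by meson
    then show "\<not> rel U i x x" using nm_irrefl[OF nm \<open>i < n\<close>, of a] assms(2) e(3) by simp
  qed
qed

lemma nm_structure_local:
  assumes "\<And>x y. x \<in> univ U \<Longrightarrow> y \<in> univ U \<Longrightarrow> nm_structure n m (induced U {x, y})"
  shows "nm_structure n m U"
  unfolding nm_structure_def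
proof (intro conjI allI impI ballI)
  fix i x y assume xy: "x \<in> univ U" "y \<in> univ U"
  note nm = assms[OF xy]
  have u: "x \<in> univ (induced U {x, y})" "y \<in> univ (induced U {x, y})" by (simp_all add: induced_def)
  have r: "rel (induced U {x, y}) q x y \<longleftrightarrow> rel U q x y" "rel (induced U {x, y}) q y x \<longleftrightarrow> rel U q y x" for q
    by (simp_all add: induced_def)
  show "\<not> rel U i x y" if "n \<le> i" using nm_bounded[OF nm that u] r by simp
  show "rel U i y x" if "i < m" "rel U i x y" using nm_sym[OF nm that(1) u] that(2) r by simp
  show "\<not> rel U i y x" if "m \<le> i \<and> i < n" "rel U i x y" using nm_asym[OF nm _ _ u] that r by simp
  show "\<not> rel U j x y" "\<not> rel U j y x" if "i < n" "j < n" "i \<noteq> j \<and> x \<noteq> y \<and> rel U i x y" for j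
    using nm_disjoint[OF nm that(1,2) u] that(3) r by auto
  show "\<exists>i<n. rel U i x y \<or> rel U i y x" if "n \<noteq> 0" "x \<noteq> y"
    using nm_total[OF nm that(1) u that(2)] r by simp
next
  fix i x assume "i < n" "x \<in> univ U"
  then show "\<not> rel U i x x"
    using nm_irrefl[OF assms[of x x] \<open>i < n\<close>, of x] by (simp add: induced_def)
qed

text \<open>The axioms concern at most two points at a time, and substructures with at most two
  points, copied to natural numbers, lie in the age.\<close>

lemma nm_structure_U:
  fixes U :: "'a binstr"
  assumes "is_U n m U"
  shows "nm_structure n m U"
proof (rule nm_structure_local)
  fix x y assume xy: "x \<in> univ U" "y \<in> univ U"
  let ?X = "{x, y}"
  obtain f where f: "bij_betw f {0..<card ?X} ?X" using ex_bij_betw_nat_finite[of ?X] by auto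
  define C where "C = \<lparr>univ = {0..<card ?X}, rel = (\<lambda>q a b. rel U q (f a) (f b))\<rparr>"
  have fX: "f a \<in> ?X" if "a < card ?X" for a using bij_betwE[OF f] that by simp
  have "isomorphism f C (induced U ?X)"
    using f fX by (simp add: isomorphism_def C_def induced_def)
  then have "isomorphic C (induced U ?X)" unfolding isomorphic_def by blast
  moreover have "?X \<subseteq> univ U" "finite (univ C)" using xy by (simp_all add: C_def)
  ultimately have "C \<in> age U" unfolding age_def by blast
  then have "nm_structure n m C" using assms by (auto simp: is_U_def fraisse_limit_def)
  moreover have "embeds_on C (induced U ?X) f (univ C)"
    using f fX by (auto simp: embeds_on_def C_def induced_def bij_betw_def)
  moreover have "f ` univ C = univ (induced U ?X)" using f by (simp add: C_def induced_def bij_betw_def)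
  ultimately show "nm_structure n m (induced U ?X)" using nm_structure_pullback by metis
qed

text \<open>The structure on the first \<open>Suc N\<close> points lies in the age and embeds by
  some \<open>g\<close>. Ultrahomogeneity gives an automorphism of \<open>U\<close> that moves the
  images of the first \<open>N\<close> points under \<open>g\<close> to those under
  \<open>\<phi>\<close>.\<close>

lemma extend_embedding:
  assumes U: "is_U n m U" and P: "nm_structure n m P" "univ P = UNIV"
    and \<phi>: "embeds_on P U \<phi> {..<N :: nat}"
  shows "\<exists>\<psi>. embeds_on P U \<psi> {..<Suc N} \<and> (\<forall>a<N. \<psi> a = \<phi> a)"
proof -
  let ?C = "induced P {..<Suc N}"
  have "nm_structure n m ?C" by (rule nm_structure_induced[OF P(1)]) (simp add: P(2))
  moreover have "finite (univ ?C)" by (simp add: induced_def)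
  ultimately have "?C \<in> age U" using U by (simp add: is_U_def fraisse_limit_def)
  then obtain X g where X: "X \<subseteq> univ U" and g: "isomorphism g ?C (induced U X)"
    unfolding age_def isomorphic_def by blast
  have g_bij: "bij_betw g {..<Suc N} X" using g by (simp add: isomorphism_def induced_def)
  have g_mem: "g a \<in> X" if "a < Suc N" for a using bij_betwE[OF g_bij] that by simp
  have g_rel: "rel P q a b \<longleftrightarrow> rel U q (g a) (g b)" if "a < Suc N" "b < Suc N" for q a b
    using g that g_mem unfolding isomorphism_def induced_def by simp
  have g_inj: "inj_on g {..<Suc N}" using g_bij by (rule bij_betw_imp_inj_on)
  note \<phi>' = embeds_onD[OF \<phi>]
  define f where "f = \<phi> \<circ> inv_into {..<N} g"
  have gN: "inj_on g {..<N}" using g_inj by (rule inj_on_subset) auto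
  have f: "f (g a) = \<phi> a" if "a < N" for a using that gN by (simp add: f_def)
  have "isomorphism f (induced U (g ` {..<N})) (induced U (\<phi> ` {..<N}))"
    unfolding isomorphism_def
  proof (intro conjI allI ballI)
    have "bij_betw (inv_into {..<N} g) (g ` {..<N}) {..<N}"
      by (rule bij_betw_inv_into) (use gN in \<open>simp add: bij_betw_def\<close>)
    moreover have "bij_betw \<phi> {..<N} (\<phi> ` {..<N})" using \<phi>'(1) by (simp add: bij_betw_def)
    ultimately show "bij_betw f (univ (induced U (g ` {..<N}))) (univ (induced U (\<phi> ` {..<N})))"
      unfolding f_def by (simp add: induced_def bij_betw_trans)
    fix q x y assume "x \<in> univ (induced U (g ` {..<N}))" "y \<in> univ (induced U (g ` {..<N}))"
    then obtain a b where ab: "a < N" "b < N" "x = g a" "y = g b" by (auto simp: induced_def)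
    have "rel U q x y \<longleftrightarrow> rel U q (f x) (f y)"
      using ab f g_rel[of a b q] \<phi>'(3)[of a b q] by simp
    then show "rel (induced U (g ` {..<N})) q x y \<longleftrightarrow> rel (induced U (\<phi> ` {..<N})) q (f x) (f y)"
      using ab f by (simp add: induced_def)
  qed
  moreover have "ultrahomogeneous U" using U by (simp add: is_U_def fraisse_limit_def)
  moreover have "g ` {..<N} \<subseteq> univ U" "\<phi> ` {..<N} \<subseteq> univ U" using g_mem X \<phi>'(2) by auto
  ultimately have "\<exists>G. isomorphism G U U \<and> (\<forall>x\<in>g ` {..<N}. G x = f x)"
    unfolding ultrahomogeneous_def by (meson finite_imageI finite_lessThan)
  then obtain G where G: "isomorphism G U U" "\<forall>x\<in>g ` {..<N}. G x = f x" by (elim exE conjE)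
  have G_bij: "bij_betw G (univ U) (univ U)" using G(1) by (simp add: isomorphism_def)
  have G_rel: "rel U q x y \<longleftrightarrow> rel U q (G x) (G y)" if "x \<in> univ U" "y \<in> univ U" for q x y
    using G(1) that unfolding isomorphism_def by blast
  have gU: "g a \<in> univ U" if "a < Suc N" for a using g_mem[OF that] X by blast
  have "embeds_on P U (\<lambda>a. G (g a)) {..<Suc N}"
    unfolding embeds_on_def
  proof (intro conjI allI ballI)
    show "inj_on (\<lambda>a. G (g a)) {..<Suc N}"
      using comp_inj_on[OF g_inj inj_on_subset[OF bij_betw_imp_inj_on[OF G_bij]]] gU
      by (auto simp: comp_def image_subset_iff)
    show "(\<lambda>a. G (g a)) ` {..<Suc N} \<subseteq> univ U" using gU bij_betwE[OF G_bij] by auto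
    show "rel P q a b \<longleftrightarrow> rel U q (G (g a)) (G (g b))" if "a \<in> {..<Suc N}" "b \<in> {..<Suc N}" for q a b
      using that g_rel[of a b q] G_rel[OF gU gU, of a b q] by simp
  qed
  moreover have "G (g a) = \<phi> a" if "a < N" for a using G(2) f[OF that] that by simp
  ultimately show ?thesis by blast
qed

lemma universal_U:
  assumes U: "is_U n m U" and P: "nm_structure n m P" "univ P = (UNIV :: nat set)"
  shows "\<exists>\<phi>. embeds_on P U \<phi> UNIV"
proof -
  have "\<exists>\<Phi>. \<forall>N. embeds_on P U (\<Phi> N) {..<N} \<and> (\<forall>a<N. \<Phi> (Suc N) a = \<Phi> N a)"
  proof (rule dependent_nat_choice)
    show "\<exists>\<phi>. embeds_on P U \<phi> {..<0}" by (simp add: embeds_on_def)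
    show "\<exists>\<psi>. embeds_on P U \<psi> {..<Suc N} \<and> (\<forall>a<N. \<psi> a = \<phi> a)"
      if "embeds_on P U \<phi> {..<N}" for \<phi> N using extend_embedding[OF U P that] .
  qed
  then obtain \<Phi> where \<Phi>: "\<And>N. embeds_on P U (\<Phi> N) {..<N}" "\<And>N a. a < N \<Longrightarrow> \<Phi> (Suc N) a = \<Phi> N a"
    by metis
  define \<phi> where "\<phi> a = \<Phi> (Suc a) a" for a
  have eq: "\<Phi> N a = \<phi> a" if "a < N" for N a
    using that
  proof (induction N)
    case (Suc N)
    then show ?case using \<Phi>(2)[of a N] by (cases "a = N") (auto simp: \<phi>_def)
  qed simp
  have fin: "embeds_on P U \<phi> {..<N}" for N
    using \<Phi>(1)[of N] embeds_on_cong[of "{..<N}" "\<Phi> N" \<phi> P U] eq by simp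
  have "embeds_on P U \<phi> UNIV"
    unfolding embeds_on_def
  proof (intro conjI allI ballI)
    show "inj \<phi>"
    proof (rule injI)
      fix a b assume "\<phi> a = \<phi> b"
      then show "a = b" using inj_onD[OF embeds_onD(1)[OF fin[of "Suc (max a b)"]], of a b] by simp
    qed
    show "range \<phi> \<subseteq> univ U"
      using embeds_onD(2)[OF fin] by blast
    show "rel P q a b \<longleftrightarrow> rel U q (\<phi> a) (\<phi> b)" for q a b
      using embeds_onD(3)[OF fin[of "Suc (max a b)"], of a b q] by simp
  qed
  then show ?thesis by blast
qed

text \<open>For all \<open>m \<le> n\<close> the words with the relations \<open>coded\<close> form
  a structure of the class, even when there is only one letter. Numbered by natural numbers, this
  structure embeds into \<open>U\<close> by universality.\<close>

theorem rainbow_U: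
  fixes U :: "'a binstr"
  assumes mn: "m \<le> n" and U: "is_U n m U"
  shows "rainbow_Ramsey U \<and> delta_rainbow_Ramsey U"
proof -
  let ?T = "tree (letters n m)"
  have d: "0 < letters n m" by (simp add: letters_def)
  define w where "w = from_nat_into ?T"
  have w: "bij_betw w UNIV ?T" unfolding w_def
    by (rule bij_betw_from_nat_into) (simp_all add: infinite_tree[OF d])
  have w_mem: "w a \<in> ?T" for a using w by (auto simp: bij_betw_def)
  have w_inj: "w a = w b \<longleftrightarrow> a = b" for a b using w by (auto simp: bij_betw_def inj_def)
  define P where "P = \<lparr>univ = UNIV :: nat set, rel = (\<lambda>q a b. coded n m wless wletter q (w a) (w b))\<rparr>"
  have T: "nm_structure n m \<lparr>univ = ?T, rel = coded n m wless wletter\<rparr>"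
    by (rule nm_structure_words[OF mn]) simp_all
  have "nm_structure n m P"
  proof (rule nm_structure_pullback[OF _ _ T])
    have inv: "w (inv_into UNIV w x) = x" if "x \<in> ?T" for x
      using that w by (simp add: bij_betw_def f_inv_into_f)
    show "embeds_on \<lparr>univ = ?T, rel = coded n m wless wletter\<rparr> P (inv_into UNIV w) ?T"
      using inv inj_on_inv_into[of ?T w UNIV] w by (simp add: embeds_on_def P_def bij_betw_def)
    show "inv_into UNIV w ` ?T = univ P"
      using bij_betw_inv_into[OF w] by (simp add: P_def bij_betw_def)
  qed simp
  moreover have "univ P = UNIV" by (simp add: P_def)
  ultimately obtain \<phi> where \<phi>: "embeds_on P U \<phi> UNIV" using universal_U[OF U] by blast
  define h where "h x = \<phi> (inv_into UNIV w x)" for x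
  have hw: "h (w a) = \<phi> a" for a using w by (simp add: h_def bij_betw_def)
  have ex: "\<exists>a. x = w a" if "x \<in> ?T" for x using that w by (auto simp: bij_betw_def)
  have h_rel: "rel U q (h x) (h y) \<longleftrightarrow> coded n m wless wletter q x y" if xy: "x \<in> ?T" "y \<in> ?T" for q x y
  proof -
    obtain a b where "x = w a" "y = w b" using ex[OF xy(1)] ex[OF xy(2)] by blast
    then show ?thesis using embeds_onD(3)[OF \<phi>, of a b q] hw by (simp add: P_def)
  qed
  have inj: "inj_on h ?T"
  proof (rule inj_onI)
    fix x y assume xy: "x \<in> ?T" "y \<in> ?T" "h x = h y"
    obtain a b where ab: "x = w a" "y = w b" using ex[OF xy(1)] ex[OF xy(2)] by blast
    then have "\<phi> a = \<phi> b" using xy(3) hw by simp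
    then have "a = b" by (rule injD[OF embeds_onD(1)[OF \<phi>]])
    then show "x = y" using ab by simp
  qed
  have sub: "h ` ?T \<subseteq> univ U" using embeds_onD(2)[OF \<phi>] by (auto simp: h_def)
  show ?thesis
  proof (rule rainbow_Ramsey_if_tree_embeds[OF mn _ _ nm_structure_U[OF U] inj sub])
    show "countable (univ U)" using U by (simp add: is_U_def fraisse_limit_def)
    show "infinite (univ U)"
      using finite_subset[OF sub] finite_imageD[OF _ inj] infinite_tree[OF d] by blast
    show "(rel U q (h x) (h y) \<longleftrightarrow> fwd n m (y ! length x) q) \<and>
        (rel U q (h y) (h x) \<longleftrightarrow> bwd n m (y ! length x) q)"
      if "x \<in> ?T" "y \<in> ?T" "length x < length y" for x y q
      using that h_rel coded_less by simp
  qed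
qed

theorem theorem5p2:
  fixes n m :: nat
  assumes "m \<le> n"
  shows "(\<forall>U :: 'a binstr. is_U n m U \<longrightarrow> rainbow_Ramsey U \<and> delta_rainbow_Ramsey U) \<and>
    (m + 2 * (n - m) \<ge> 2 \<longrightarrow>
       rainbow_Ramsey (T_str n m) \<and> delta_rainbow_Ramsey (T_str n m) \<and>
       (\<forall>f. strong_diagonalization (m + 2 * (n - m)) f \<longrightarrow>
          rainbow_Ramsey (D_str n m f) \<and> delta_rainbow_Ramsey (D_str n m f)))"
  using rainbow_U[OF assms] rainbow_T[OF assms] rainbow_D[OF assms] unfolding deg_def by blast

end
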